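(* Let $X_0,X_1,\dots,X_n$ be smooth vector fields on a bounded domain $\Omega\subset\mathbb{R}^p$, free up to weight $r$ and satisfying Hörmander's condition of step $r$ in $\Omega$. Let $\rho(\xi,\eta)=\|\Theta(\xi,\eta)\|$ and let $d$ be the distance induced by the vector fields (defined in the context). Then for every $\xi_0\in\Omega$ there exist a neighborhood $W$ of $\xi_0$ and constants $c,c_1,c_2>0$ such that for any $\xi,\eta,\zeta\in W$: $$\rho(\xi,\eta)\ge0;\qquad \rho(\xi,\eta)=0\iff\xi=\eta;\qquad \rho(\xi,\eta)=\rho(\eta,\xi);$$ $$\rho(\xi,\eta)\le c\{\rho(\xi,\zeta)+\rho(\zeta,\eta)\};\qquad c_1d(\xi,\eta)\le\rho(\xi,\eta)\le c_2d(\xi,\eta).$$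
   Context: Weights and commutators: $X_0$ has weight $p_0=2$, $X_i$ has weight $p_i=1$ for $i\ge1$. For $I=(i_1,\dots,i_k)$, $i_j\in\{0,\dots,n\}$, $|I|=\sum_j p_{i_j}$ and $X_{[I]}=[X_{i_1},[X_{i_2},\dots[X_{i_{k-1}},X_{i_k}]\dots]]$, $X_{[(i)]}=X_i$. Hörmander's condition of step $r$ in $\Omega$: $\{(X_{[I]})_x\}_{|I|\le r}$ spans $\mathbb{R}^p$ for every $x\in\Omega$. In noncommuting indeterminates $\xi_0,\dots,\xi_n$ write $\xi_{[I]}=[\xi_{i_1},[\dots,\xi_{i_k}]\dots]=\sum_JA_{IJ}\xi_J$. The fields are free up to weight $r$ in $\Omega$ if at each $x\in\Omega$: $\sum_{|I|\le r}a_I(X_{[I]})_x=0$ (real constants $a_I$) implies $\sum_{|I|\le r} a_IA_{IJ}=0$ for all $J$. A set $B$ of $p$ multiindices of weight $\le r$ is fixed so that $\{(X_{[I]})_x\}_{I\in B}$ is a basis of $\mathbb{R}^p$ at every $x\in\Omega$. The map $\Theta$: $\exp(Z)(\eta)$ is the time-1 value of the solution of $\phi'=Z_\phi$, $\phi(0)=\eta$. For $\eta\in\Omega$ the map $u=(u_I)_{I\in B}\mapsto\xi=\exp(\sum_{I\in B}u_IX_{[I]})(\eta)$ is a diffeomorphism from a neighborhood of $0\in\mathbb{R}^p$ onto a neighborhood of $\eta$; its inverse is $u=\Theta(\eta,\xi)$, defined and smooth for $(\eta,\xi)$ near the diagonal. Put $|u|_k=\sum_{J\in B,|J|=k}|u_J|$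 and $\|u\|=\sum_{k=1}^r|u|_k^{1/k}$. Distance $d$: for $\delta>0$ let $C(\delta)$ be the class of absolutely continuous $\varphi:[0,1]\to\Omega$ with $\varphi'(t)=\sum_{|I|\le r}a_I(t)(X_{[I]})_{\varphi(t)}$ for a.e. $t$, with $|a_I(t)|\le\delta^{|I|}$; $d(x,y)=\inf\{\delta>0:\exists\varphi\in C(\delta),\ \varphi(0)=x,\ \varphi(1)=y\}$. *)

theory Defs
  imports "HOL-Analysis.Analysis"
begin

subsection \<open>Smooth maps\<close>

text \<open>All directional derivatives of order at most \<open>k\<close> exist as values of Frechet derivatives
  and are continuous; on an open subset of a finite-dimensional space this is the class
  \<open>C\<^sup>k\<close>. It is used on open sets only.\<close>

primrec Ck_on ::
  "nat \<Rightarrow> ('a::real_normed_vector \<Rightarrow> 'b::real_normed_vector) \<Rightarrow> 'a set \<Rightarrow> bool" where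
  "Ck_on 0 f S \<longleftrightarrow> continuous_on S f"
| "Ck_on (Suc k) f S \<longleftrightarrow>
     (\<forall>x\<in>S. f differentiable (at x)) \<and>
     (\<forall>v. Ck_on k (\<lambda>x. frechet_derivative f (at x) v) S)"

definition smooth_on ::
  "('a::real_normed_vector \<Rightarrow> 'b::real_normed_vector) \<Rightarrow> 'a set \<Rightarrow> bool" where
  "smooth_on f S \<longleftrightarrow> (\<forall>k. Ck_on k f S)"

definition diffeomorphism ::
  "'a::real_normed_vector set \<Rightarrow> 'b::real_normed_vector set \<Rightarrow> ('a \<Rightarrow> 'b) \<Rightarrow> ('b \<Rightarrow> 'a) \<Rightarrow> bool" where
  "diffeomorphism U V f g \<longleftrightarrow>
     open U \<and> open V \<and> homeomorphism U V f g \<and> smooth_on f U \<and> smooth_on g V"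

subsection \<open>Iterated commutators of vector fields\<close>

text \<open>A vector field \<open>\<Sum>\<^sub>j b\<^sub>j \<partial>\<^sub>j\<close> is identified with its coefficient map \<open>b\<close>; the bracket is
  that of the differential operators, \<open>[X, Y] = X Y - Y X\<close>.\<close>

definition lie_bracket ::
  "('a::real_normed_vector \<Rightarrow> 'a) \<Rightarrow> ('a \<Rightarrow> 'a) \<Rightarrow> 'a \<Rightarrow> 'a" where
  "lie_bracket X Y x = frechet_derivative Y (at x) (X x) - frechet_derivative X (at x) (Y x)"

text \<open>Multiindices are nonempty lists over \<open>{0..n}\<close>; the value at \<open>[]\<close> is a dummy.\<close>

fun iter_bracket :: "(nat \<Rightarrow> 'a::real_normed_vector \<Rightarrow> 'a) \<Rightarrow> nat list \<Rightarrow> 'a \<Rightarrow> 'a" where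
  "iter_bracket X [] = (\<lambda>x. 0)"
| "iter_bracket X [i] = X i"
| "iter_bracket X (i # j # I) = lie_bracket (X i) (iter_bracket X (j # I))"

definition weight :: "nat list \<Rightarrow> nat" where
  "weight I = sum_list (map (\<lambda>i. if i = 0 then 2 else 1) I)"

definition multiindices :: "nat \<Rightarrow> nat \<Rightarrow> nat list set" where
  "multiindices n r = {I. I \<noteq> [] \<and> set I \<subseteq> {0..n} \<and> weight I \<le> r}"

definition hormander ::
  "nat \<Rightarrow> nat \<Rightarrow> 'a::real_normed_vector set \<Rightarrow> (nat \<Rightarrow> 'a \<Rightarrow> 'a) \<Rightarrow> bool" where
  "hormander n r \<Omega> X \<longleftrightarrow>
     (\<forall>x\<in>\<Omega>. span ((\<lambda>I. iter_bracket X I x) ` multiindices n r) = UNIV)"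

subsection \<open>Commutators of noncommuting indeterminates and freeness\<close>

text \<open>A polynomial \<open>\<Sum>\<^sub>J f(J) \<xi>\<^sub>J\<close> in noncommuting indeterminates is represented by its
  coefficient function \<open>f\<close> on words; the product is induced by concatenation of words.\<close>

definition nc_mult :: "(nat list \<Rightarrow> real) \<Rightarrow> (nat list \<Rightarrow> real) \<Rightarrow> nat list \<Rightarrow> real" where
  "nc_mult f g J = (\<Sum>k\<le>length J. f (take k J) * g (drop k J))"

definition nc_commutator :: "(nat list \<Rightarrow> real) \<Rightarrow> (nat list \<Rightarrow> real) \<Rightarrow> nat list \<Rightarrow> real" where
  "nc_commutator f g J = nc_mult f g J - nc_mult g f J"

definition nc_var :: "nat \<Rightarrow> nat list \<Rightarrow> real" where
  "nc_var i J = (if J = [i] then 1 else 0)"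

text \<open>\<open>nc_iter I J\<close> is the coefficient \<open>A\<^sub>I\<^sub>J\<close> of \<open>\<xi>\<^sub>J\<close> in \<open>\<xi>\<^bsub>[I]\<^esub>\<close>.\<close>

fun nc_iter :: "nat list \<Rightarrow> nat list \<Rightarrow> real" where
  "nc_iter [] = (\<lambda>J. 0)"
| "nc_iter [i] = nc_var i"
| "nc_iter (i # j # I) = nc_commutator (nc_var i) (nc_iter (j # I))"

definition free_up_to_weight ::
  "nat \<Rightarrow> nat \<Rightarrow> 'a::real_normed_vector set \<Rightarrow> (nat \<Rightarrow> 'a \<Rightarrow> 'a) \<Rightarrow> bool" where
  "free_up_to_weight n r \<Omega> X \<longleftrightarrow>
     (\<forall>x\<in>\<Omega>. \<forall>a :: nat list \<Rightarrow> real.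
        (\<Sum>I\<in>multiindices n r. a I *\<^sub>R iter_bracket X I x) = 0 \<longrightarrow>
        (\<forall>J. (\<Sum>I\<in>multiindices n r. a I * nc_iter I J) = 0))"

subsection \<open>The map \<open>\<Theta>\<close>\<close>

text \<open>The set \<open>B\<close> of \<open>p\<close> multiindices is given by an enumeration \<open>\<beta>\<close> indexed by the coordinate
  type of \<open>\<real>\<^sup>p\<close>, so that \<open>u = (u\<^sub>I)\<^bsub>I\<in>B\<^esub>\<close> is a vector of \<open>real ^ 'p\<close> with \<open>u $ k = u\<^bsub>\<beta> k\<^esub>\<close>.\<close>

definition bracket_basis ::
  "nat \<Rightarrow> nat \<Rightarrow> (real ^ 'p) set \<Rightarrow> (nat \<Rightarrow> real ^ 'p \<Rightarrow> real ^ 'p) \<Rightarrow> ('p::finite \<Rightarrow> nat list) \<Rightarrow> bool"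
  where
  "bracket_basis n r \<Omega> X \<beta> \<longleftrightarrow>
     inj \<beta> \<and> range \<beta> \<subseteq> multiindices n r \<and>
     (\<forall>x\<in>\<Omega>. inj (\<lambda>k. iter_bracket X (\<beta> k) x) \<and>
            independent (range (\<lambda>k. iter_bracket X (\<beta> k) x)) \<and>
            span (range (\<lambda>k. iter_bracket X (\<beta> k) x)) = UNIV)"

definition integral_curve ::
  "'a::real_normed_vector set \<Rightarrow> ('a \<Rightarrow> 'a) \<Rightarrow> 'a \<Rightarrow> (real \<Rightarrow> 'a) \<Rightarrow> bool" where
  "integral_curve \<Omega> Z \<eta> \<phi> \<longleftrightarrow>
     \<phi> 0 = \<eta> \<and>
     (\<forall>t\<in>{0..1}. \<phi> t \<in> \<Omega> \<and> (\<phi> has_vector_derivative Z (\<phi> t)) (at t within {0..1}))"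

text \<open>Meaningful only if the solution exists up to time 1 inside \<open>\<Omega>\<close>; it is then unique for
  smooth \<open>Z\<close>.\<close>

definition exp_field ::
  "'a::real_normed_vector set \<Rightarrow> ('a \<Rightarrow> 'a) \<Rightarrow> 'a \<Rightarrow> 'a" where
  "exp_field \<Omega> Z \<eta> = (THE \<xi>. \<exists>\<phi>. integral_curve \<Omega> Z \<eta> \<phi> \<and> \<phi> 1 = \<xi>)"

definition comb_field ::
  "(nat \<Rightarrow> real ^ 'p \<Rightarrow> real ^ 'p) \<Rightarrow> ('p::finite \<Rightarrow> nat list) \<Rightarrow> real ^ 'p \<Rightarrow> real ^ 'p \<Rightarrow> real ^ 'p"
  where
  "comb_field X \<beta> u x = (\<Sum>k\<in>UNIV. (u $ k) *\<^sub>R iter_bracket X (\<beta> k) x)"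

text \<open>\<open>\<Theta>\<close> is determined only as a germ along the diagonal. The predicate says that it is a version
  of the map, defined on the open neighbourhood \<open>N\<close> of the diagonal of \<open>\<Omega> \<times> \<Omega>\<close>. One \<open>N\<close> has to
  serve all base points: requiring \<open>\<Theta> \<eta>\<close> to be the local inverse merely near each single \<open>\<eta>\<close>,
  with no uniformity in \<open>\<eta>\<close>, would not determine \<open>\<Theta>\<close> on any neighbourhood of the diagonal.\<close>

definition is_Theta ::
  "(real ^ 'p) set \<Rightarrow> (nat \<Rightarrow> real ^ 'p \<Rightarrow> real ^ 'p) \<Rightarrow> ('p::finite \<Rightarrow> nat list) \<Rightarrow>
   ((real ^ 'p) \<times> (real ^ 'p)) set \<Rightarrow> (real ^ 'p \<Rightarrow> real ^ 'p \<Rightarrow> real ^ 'p) \<Rightarrow> bool" where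
  "is_Theta \<Omega> X \<beta> N \<Theta> \<longleftrightarrow>
     open N \<and> N \<subseteq> \<Omega> \<times> \<Omega> \<and> (\<forall>\<eta>\<in>\<Omega>. (\<eta>, \<eta>) \<in> N) \<and>
     smooth_on (\<lambda>(\<eta>, \<xi>). \<Theta> \<eta> \<xi>) N \<and>
     (\<forall>\<eta>\<in>\<Omega>. \<exists>U. 0 \<in> U \<and>
        (\<forall>u\<in>U. \<exists>\<phi>. integral_curve \<Omega> (comb_field X \<beta> u) \<eta> \<phi>) \<and>
        diffeomorphism U {\<xi>. (\<eta>, \<xi>) \<in> N} (\<lambda>u. exp_field \<Omega> (comb_field X \<beta> u) \<eta>) (\<Theta> \<eta>))"

subsection \<open>The homogeneous norm and the quasidistance\<close>

definition layer_norm :: "('p::finite \<Rightarrow> nat list) \<Rightarrow> nat \<Rightarrow> real ^ 'p \<Rightarrow> real" where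
  "layer_norm \<beta> k u = (\<Sum>j | weight (\<beta> j) = k. \<bar>u $ j\<bar>)"

definition hom_norm :: "('p::finite \<Rightarrow> nat list) \<Rightarrow> nat \<Rightarrow> real ^ 'p \<Rightarrow> real" where
  "hom_norm \<beta> r u = (\<Sum>k=1..r. layer_norm \<beta> k u powr (1 / real k))"

definition rho ::
  "('p::finite \<Rightarrow> nat list) \<Rightarrow> nat \<Rightarrow> (real ^ 'p \<Rightarrow> real ^ 'p \<Rightarrow> real ^ 'p) \<Rightarrow>
   real ^ 'p \<Rightarrow> real ^ 'p \<Rightarrow> real" where
  "rho \<beta> r \<Theta> \<xi> \<eta> = hom_norm \<beta> r (\<Theta> \<xi> \<eta>)"

subsection \<open>The distance induced by the vector fields\<close>

definition abs_continuous_on_interval ::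
  "real \<Rightarrow> real \<Rightarrow> (real \<Rightarrow> 'a::real_normed_vector) \<Rightarrow> bool" where
  "abs_continuous_on_interval a b f \<longleftrightarrow>
     (\<forall>\<epsilon>>0. \<exists>\<delta>>0. \<forall>P :: (real \<times> real) set.
        finite P \<and> (\<forall>(s, t)\<in>P. a \<le> s \<and> s \<le> t \<and> t \<le> b) \<and>
        disjoint_family_on (\<lambda>(s, t). {s<..<t}) P \<and> (\<Sum>(s, t)\<in>P. t - s) < \<delta>
        \<longrightarrow> (\<Sum>(s, t)\<in>P. norm (f t - f s)) < \<epsilon>)"

definition admissible_curves ::
  "nat \<Rightarrow> nat \<Rightarrow> 'a::real_normed_vector set \<Rightarrow> (nat \<Rightarrow> 'a \<Rightarrow> 'a) \<Rightarrow> real \<Rightarrow> (real \<Rightarrow> 'a) set" where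
  "admissible_curves n r \<Omega> X \<delta> =
     {\<phi>. abs_continuous_on_interval 0 1 \<phi> \<and> \<phi> ` {0..1} \<subseteq> \<Omega> \<and>
         (\<exists>a :: nat list \<Rightarrow> real \<Rightarrow> real.
            (\<forall>I\<in>multiindices n r. \<forall>t\<in>{0..1}. \<bar>a I t\<bar> \<le> \<delta> ^ weight I) \<and>
            (AE t in lebesgue_on {0..1}.
               (\<phi> has_vector_derivative
                  (\<Sum>I\<in>multiindices n r. a I t *\<^sub>R iter_bracket X I (\<phi> t))) (at t within {0..1})))}"

text \<open>Extended-real valued, so that the infimum over the empty set is \<open>\<infinity>\<close>.\<close>

definition cc_dist ::
  "nat \<Rightarrow> nat \<Rightarrow> 'a::real_normed_vector set \<Rightarrow> (nat \<Rightarrow> 'a \<Rightarrow> 'a) \<Rightarrow> 'a \<Rightarrow> 'a \<Rightarrow> ereal" where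
  "cc_dist n r \<Omega> X x y =
     (INF \<delta>\<in>{\<delta>. 0 < \<delta> \<and> (\<exists>\<phi>\<in>admissible_curves n r \<Omega> X \<delta>. \<phi> 0 = x \<and> \<phi> 1 = y)}. ereal \<delta>)"

end

theory Submission
  imports Defs
begin

text \<open>The crux is that \<open>\<rho> \<le> C \<delta>\<close> along curves of class \<open>C(\<delta>)\<close>. Fix a base point \<open>\<xi>\<close> and use the
  coordinates \<open>u = \<Theta> \<xi> \<zeta>\<close>, in which the curves \<open>t \<mapsto> exp (t Z) \<xi>\<close> are the rays \<open>t u\<close>. Freeness implies that at
  every point \<open>X\<^bsub>[I]\<^esub>\<close> is a combination of basis fields of weight at most \<open>|I|\<close>, and \<open>[Y\<^sub>j, Y\<^sub>k]\<close> of basis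
  fields of weight at most \<open>w\<^sub>j + w\<^sub>k\<close>. Hence the matrix of the frame \<open>Y\<close> in these coordinates satisfies a
  Riccati equation along rays whose solution deviates from the identity by at most
  \<open>O(\<mu> ^ (w\<^sub>m - w\<^sub>j))\<close> in the entry \<open>(j, m)\<close> on the box \<open>|u\<^sub>k| \<le> \<mu> ^ w\<^sub>k\<close>. A curve of class \<open>C(\<delta>)\<close> issued from
  \<open>\<xi>\<close> therefore moves so slowly that it cannot leave the box with \<open>\<mu> = K \<delta>\<close>, \<open>K\<close> large, before time 1.

  Rays are admissible curves, which gives \<open>d \<le> \<rho>\<close>; two consecutive rays at double speed are admissible as
  well, which gives the quasi-triangle inequality; and reversing a ray gives \<open>\<Theta> \<eta> \<xi> = - \<Theta> \<xi> \<eta>\<close>.\<close>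

subsection \<open>Smooth functions and Lie derivatives\<close>

text \<open>The obstacle is uniformity in the base point: the chart \<open>\<Theta> \<xi>\<close>
  changes with \<xi>, so no constant in the final estimates may come from the derivatives of one
  particular chart. The Riccati equation meets this, because it sees the frame only through the
  coefficients of the brackets \<open>[Y\<^sub>j, Y\<^sub>k]\<close>, and these are bounded on a
  compact ball around \<open>\<xi>\<^sub>0\<close>. It arises by differentiating the identity that
  the frame combination with coefficients u is, at the point with coordinates u, the radial field.
  The equation is singular at the start of the ray, so what gets estimated is t times the deviation.
  Constants are fixed in the order F, M, K. Coordinates of size \<open>\<mu> ^ w\<close> are
  measured against scales \<open>(M * \<mu>) ^ w\<close>; as every weight is at least 1, this gains
  a factor 1 / M in the inhomogeneous term. For the same reason a large K gains a factor 1 / K in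
  the speed relative to the sides of the box. All this concerns small \<delta> only; for large
  \<delta> the bound on \<rho> holds because \<rho> is small on the neighbourhood W.\<close>

lemma differentiable_has_frechet:
  "f differentiable (at x) \<Longrightarrow> (f has_derivative frechet_derivative f (at x)) (at x)"
  using frechet_derivative_works by blast

text \<open>\<open>Ck_on\<close> uses derivatives \<open>at x\<close>, not derivatives within S, so
  openness of S is what lets functions that agree only on S share them.\<close>

lemma Ck_on_cong:
  assumes "open S" "\<And>x. x \<in> S \<Longrightarrow> f x = g x" "Ck_on k f S"
  shows "Ck_on k g S"
  using assms(2,3)
proof (induction k arbitrary: f g)
  case 0
  then show ?case by (simp cong: continuous_on_cong)
next
  case (Suc k)
  have "g differentiable (at x)" if "x \<in> S" for x
    using Suc.prems that assms(1) differentiable_has_frechet[of f x]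
      has_derivative_transform_within_open[of f _ x UNIV S g]
    unfolding Ck_on.simps differentiable_def by blast
  moreover have "Ck_on k (\<lambda>x. frechet_derivative g (at x) v) S" for v
  proof (rule Suc.IH)
    show "Ck_on k (\<lambda>x. frechet_derivative f (at x) v) S" using Suc.prems by simp
    show "frechet_derivative f (at x) v = frechet_derivative g (at x) v" if "x \<in> S" for x
      using frechet_derivative_transform_within_open[of f x S g] Suc.prems that assms(1) by auto
  qed
  ultimately show ?case by simp
qed

lemma Ck_on_SucD:
  assumes "open S" "Ck_on (Suc k) f S"
  shows "Ck_on k f S"
  using assms(2)
proof (induction k arbitrary: f)
  case 0
  then show ?case
    by (simp add: differentiable_imp_continuous_within continuous_at_imp_continuous_on)
next
  case (Suc k)
  then show ?case by simp
qed

text \<open>\<open>frechet_derivative\<close> is a choice term; uniqueness of derivatives allows any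
  explicit formula in its place. The closure rules below feed their product and chain rules through
  this.\<close>

lemma Ck_on_SucI:
  assumes "open S" "\<And>x. x \<in> S \<Longrightarrow> (f has_derivative D x) (at x)" "\<And>v. Ck_on k (\<lambda>x. D x v) S"
  shows "Ck_on (Suc k) f S"
proof -
  have "Ck_on k (\<lambda>x. frechet_derivative f (at x) v) S" for v
    by (rule Ck_on_cong[OF assms(1) _ assms(3)]) (simp add: frechet_derivative_at[OF assms(2), symmetric])
  then show ?thesis using assms(2) unfolding Ck_on.simps differentiable_def by blast
qed

lemma Ck_on_const: "Ck_on k (\<lambda>x. c) S"
  by (induction k arbitrary: c) auto

lemma Ck_on_ident: "Ck_on k (\<lambda>x. x) S"
  by (cases k) (auto simp: Ck_on_const)

lemma Ck_on_bounded_linear: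
  assumes "open S" "bounded_linear L" "Ck_on k f S"
  shows "Ck_on k (\<lambda>x. L (f x)) S"
  using assms(3)
proof (induction k arbitrary: f)
  case 0
  then show ?case using assms(2) by (simp add: bounded_linear.continuous_on)
next
  case (Suc k)
  show ?case
    by (rule Ck_on_SucI[OF assms(1) bounded_linear.has_derivative[OF assms(2) differentiable_has_frechet]])
      (use Suc in simp_all)
qed

lemma Ck_on_add:
  assumes "open S" "Ck_on k f S" "Ck_on k g S"
  shows "Ck_on k (\<lambda>x. f x + g x) S"
  using assms(2,3)
proof (induction k arbitrary: f g)
  case 0
  then show ?case by (simp add: continuous_on_add)
next
  case (Suc k)
  show ?case
    by (rule Ck_on_SucI[OF assms(1) has_derivative_add[OF differentiable_has_frechet differentiable_has_frechet]])
      (use Suc in simp_all)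
qed

lemma Ck_on_scaleR:
  assumes "open S" "Ck_on k f S" "Ck_on k g S"
  shows "Ck_on k (\<lambda>x. f x *\<^sub>R g x) S"
  using assms(2,3)
proof (induction k arbitrary: f g)
  case 0
  then show ?case by (simp add: continuous_on_scaleR)
next
  case (Suc k)
  show ?case
  proof (rule Ck_on_SucI[OF assms(1) has_derivative_scaleR[OF differentiable_has_frechet differentiable_has_frechet]])
    \<comment> \<open>The product rule brings back f and g undifferentiated. They are assumed one
      order smoother than their derivatives, so their order is lowered to match.\<close>
    show "Ck_on k (\<lambda>x. f x *\<^sub>R frechet_derivative g (at x) v +
        frechet_derivative f (at x) v *\<^sub>R g x) S" for v
      using Suc Ck_on_SucD[OF assms(1), of k f] Ck_on_SucD[OF assms(1), of k g]
      by (intro Ck_on_add[OF assms(1)] Suc.IH) auto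
  qed (use Suc.prems in simp_all)
qed

lemma smooth_on_cong:
  "open S \<Longrightarrow> (\<And>x. x \<in> S \<Longrightarrow> f x = g x) \<Longrightarrow> smooth_on f S \<Longrightarrow> smooth_on g S"
  unfolding smooth_on_def using Ck_on_cong by blast

lemma smooth_on_const: "smooth_on (\<lambda>x. c) S"
  by (simp add: smooth_on_def Ck_on_const)

lemma smooth_on_ident: "smooth_on (\<lambda>x. x) S"
  by (simp add: smooth_on_def Ck_on_ident)

lemma smooth_on_bounded_linear:
  "open S \<Longrightarrow> bounded_linear L \<Longrightarrow> smooth_on f S \<Longrightarrow> smooth_on (\<lambda>x. L (f x)) S"
  by (simp add: smooth_on_def Ck_on_bounded_linear)

lemma smooth_on_add:
  "open S \<Longrightarrow> smooth_on f S \<Longrightarrow> smooth_on g S \<Longrightarrow> smooth_on (\<lambda>x. f x + g x) S"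
  by (simp add: smooth_on_def Ck_on_add)

lemma smooth_on_scaleR:
  "open S \<Longrightarrow> smooth_on f S \<Longrightarrow> smooth_on g S \<Longrightarrow> smooth_on (\<lambda>x. f x *\<^sub>R g x) S"
  by (simp add: smooth_on_def Ck_on_scaleR)

lemma smooth_on_diff:
  assumes "open S" "smooth_on f S" "smooth_on g S"
  shows "smooth_on (\<lambda>x. f x - g x) S"
  using smooth_on_add[OF assms(1,2) smooth_on_scaleR[OF assms(1) smooth_on_const[of "-1"] assms(3)]]
  by simp

lemma smooth_on_sum:
  "open S \<Longrightarrow> (\<And>i. i \<in> A \<Longrightarrow> smooth_on (f i) S) \<Longrightarrow> smooth_on (\<lambda>x. \<Sum>i\<in>A. f i x) S"
  by (induction A rule: infinite_finite_induct) (auto simp: smooth_on_const smooth_on_add)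

lemma smooth_on_subset:
  assumes "smooth_on f S" "T \<subseteq> S"
  shows "smooth_on f T"
proof -
  have "Ck_on k f S \<Longrightarrow> Ck_on k f T" for k
    by (induction k arbitrary: f) (use assms(2) continuous_on_subset in auto)
  then show ?thesis using assms(1) by (simp add: smooth_on_def)
qed

lemma smooth_on_continuous: "smooth_on f S \<Longrightarrow> continuous_on S f"
  unfolding smooth_on_def using Ck_on.simps(1) by blast

lemma smooth_on_differentiable: "smooth_on f S \<Longrightarrow> x \<in> S \<Longrightarrow> f differentiable (at x)"
  unfolding smooth_on_def using Ck_on.simps(2) by blast

lemma smooth_on_has_derivative:
  "smooth_on f S \<Longrightarrow> x \<in> S \<Longrightarrow> (f has_derivative frechet_derivative f (at x)) (at x)"
  using smooth_on_differentiable frechet_derivative_works by blast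

lemma smooth_on_frechet: "smooth_on f S \<Longrightarrow> smooth_on (\<lambda>x. frechet_derivative f (at x) v) S"
  unfolding smooth_on_def using Ck_on.simps(2) by blast

text \<open>Applied to a vector field in place of f, this differentiates the coefficients
  componentwise. It is then the flat derivative and not the Lie derivative of fields; the latter is
  \<open>lie_bracket\<close>, the difference of two such terms.\<close>

definition lie_deriv ::
  "('a::real_normed_vector \<Rightarrow> 'a) \<Rightarrow> ('a \<Rightarrow> 'b::real_normed_vector) \<Rightarrow> 'a \<Rightarrow> 'b" where
  "lie_deriv X f x = frechet_derivative f (at x) (X x)"

text \<open>Closure of \<open>smooth_on\<close> under differentiation concerns constant directions;
  expanding \<open>X x\<close> in the standard basis reduces a variable direction to that
  case.\<close>

lemma lie_deriv_basis:
  fixes f :: "'a::euclidean_space \<Rightarrow> 'b::real_normed_vector"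
  assumes "f differentiable (at x)"
  shows "lie_deriv X f x = (\<Sum>b\<in>Basis. (X x \<bullet> b) *\<^sub>R frechet_derivative f (at x) b)"
proof -
  have lin: "linear (frechet_derivative f (at x))"
    using assms frechet_derivative_works has_derivative_linear by blast
  have "lie_deriv X f x = frechet_derivative f (at x) (\<Sum>b\<in>Basis. (X x \<bullet> b) *\<^sub>R b)"
    by (simp add: lie_deriv_def euclidean_representation)
  also have "\<dots> = (\<Sum>b\<in>Basis. (X x \<bullet> b) *\<^sub>R frechet_derivative f (at x) b)"
    by (simp add: linear_sum[OF lin] linear_scale[OF lin])
  finally show ?thesis .
qed

lemma smooth_on_lie_deriv:
  fixes f :: "'a::euclidean_space \<Rightarrow> 'b::real_normed_vector"
  assumes "open S" "smooth_on X S" "smooth_on f S"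
  shows "smooth_on (lie_deriv X f) S"
proof (rule smooth_on_cong[OF assms(1)])
  show "smooth_on (\<lambda>x. \<Sum>b\<in>Basis. (X x \<bullet> b) *\<^sub>R frechet_derivative f (at x) b) S"
    by (intro smooth_on_sum smooth_on_scaleR smooth_on_frechet assms
        smooth_on_bounded_linear[OF _ bounded_linear_inner_left])
  show "(\<Sum>b\<in>Basis. (X x \<bullet> b) *\<^sub>R frechet_derivative f (at x) b) = lie_deriv X f x" if "x \<in> S" for x
    using lie_deriv_basis[OF smooth_on_differentiable[OF assms(3) that]] by simp
qed

lemma lie_deriv_cong:
  assumes "open S" "f differentiable (at x)" "x \<in> S" "\<And>y. y \<in> S \<Longrightarrow> f y = g y"
  shows "lie_deriv X f x = lie_deriv X g x"
  using frechet_derivative_transform_within_open[OF assms(2,1,3,4)] by (simp add: lie_deriv_def)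

lemma lie_deriv_eq: "(f has_derivative D) (at x) \<Longrightarrow> lie_deriv X f x = D (X x)"
  by (simp add: lie_deriv_def flip: frechet_derivative_at)

lemma lie_deriv_add:
  assumes "f differentiable (at x)" "g differentiable (at x)"
  shows "lie_deriv X (\<lambda>y. f y + g y) x = lie_deriv X f x + lie_deriv X g x"
  using lie_deriv_eq[OF has_derivative_add[OF assms[THEN differentiable_has_frechet]]]
  by (simp add: lie_deriv_def)

lemma lie_deriv_scaleR:
  assumes "f differentiable (at x)" "g differentiable (at x)"
  shows "lie_deriv X (\<lambda>y. f y *\<^sub>R g y) x = f x *\<^sub>R lie_deriv X g x + lie_deriv X f x *\<^sub>R g x"
  using lie_deriv_eq[OF has_derivative_scaleR[OF assms[THEN differentiable_has_frechet]]]
  by (simp add: lie_deriv_def)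

lemma lie_deriv_const: "lie_deriv X (\<lambda>y. c) x = 0"
  by (simp add: lie_deriv_def)

lemma lie_deriv_ident: "lie_deriv X (\<lambda>y. y) x = X x"
  by (simp add: lie_deriv_def)

lemma lie_deriv_scale:
  assumes "g differentiable (at x)"
  shows "lie_deriv X (\<lambda>y. c *\<^sub>R g y) x = c *\<^sub>R lie_deriv X g x"
  using lie_deriv_scaleR[of "\<lambda>_. c" x g X] assms by (simp add: lie_deriv_const)

lemma lie_deriv_diff:
  assumes "f differentiable (at x)" "g differentiable (at x)"
  shows "lie_deriv X (\<lambda>y. f y - g y) x = lie_deriv X f x - lie_deriv X g x"
  using lie_deriv_eq[OF has_derivative_diff[OF assms[THEN differentiable_has_frechet]]]
  by (simp add: lie_deriv_def)

lemma lie_deriv_sum: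
  assumes "\<And>i. i \<in> A \<Longrightarrow> f i differentiable (at x)"
  shows "lie_deriv X (\<lambda>y. \<Sum>i\<in>A. f i y) x = (\<Sum>i\<in>A. lie_deriv X (f i) x)"
  using assms
  by (induction A rule: infinite_finite_induct)
     (auto simp: lie_deriv_const lie_deriv_add differentiable_sum)

lemma lie_deriv_bounded_linear:
  assumes "bounded_linear L" "f differentiable (at x)"
  shows "lie_deriv X (\<lambda>y. L (f y)) x = L (lie_deriv X f x)"
  using lie_deriv_eq[OF bounded_linear.has_derivative[OF assms(1) differentiable_has_frechet[OF assms(2)]]]
  by (simp add: lie_deriv_def)

text \<open>Only the values of the fields at x enter a first derivative, so the coefficients may
  come from an expansion that holds at the single point x.\<close>

lemma lie_deriv_linear_field:
  assumes "f differentiable (at x)"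
  shows "frechet_derivative f (at x) (\<Sum>k\<in>A. c k *\<^sub>R Y k x) = (\<Sum>k\<in>A. c k *\<^sub>R lie_deriv (Y k) f x)"
proof -
  have lin: "linear (frechet_derivative f (at x))"
    using assms frechet_derivative_works has_derivative_linear by blast
  show ?thesis by (simp add: linear_sum[OF lin] linear_scale[OF lin] lie_deriv_def)
qed

lemma lie_bracket_lie_deriv: "lie_bracket X Y x = lie_deriv X Y x - lie_deriv Y X x"
  by (simp add: lie_bracket_def lie_deriv_def)

lemma smooth_on_lie_bracket:
  fixes X :: "'a::euclidean_space \<Rightarrow> 'a"
  assumes "open S" "smooth_on X S" "smooth_on Y S"
  shows "smooth_on (lie_bracket X Y) S"
proof (rule smooth_on_cong[OF assms(1)])
  show "smooth_on (\<lambda>x. lie_deriv X Y x - lie_deriv Y X x) S"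
    by (intro smooth_on_diff smooth_on_lie_deriv assms)
qed (simp add: lie_bracket_lie_deriv)

section \<open>Symmetry of second derivatives\<close>

lemma directional_derivative:
  fixes f :: "'a::real_normed_vector \<Rightarrow> real"
  assumes "f differentiable (at (y + t *\<^sub>R v))"
  shows "((\<lambda>t. f (y + t *\<^sub>R v)) has_real_derivative frechet_derivative f (at (y + t *\<^sub>R v)) v) (at t)"
proof -
  note F = differentiable_has_frechet[OF assms]
  have "((\<lambda>t. y + t *\<^sub>R v) has_derivative (\<lambda>h. h *\<^sub>R v)) (at t)"
    by (auto intro!: derivative_eq_intros)
  from has_derivative_compose[OF this F] show ?thesis
    unfolding has_field_derivative_def
    using linear_scale[OF has_derivative_linear[OF F]] by (simp add: mult_commute_abs)
qed

text \<open>Mean value theorem twice: in direction u for the increment along v, then in direction v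
  for the derivative along u. The second difference does not change when the two directions are
  exchanged, which forces the mixed derivatives to agree in the limit.\<close>

lemma second_difference_mean_value:
  fixes f :: "'a::real_normed_vector \<Rightarrow> real"
  assumes "0 < s" "0 < t"
    and inS: "\<And>\<sigma> \<tau>. 0 \<le> \<sigma> \<Longrightarrow> \<sigma> \<le> s \<Longrightarrow> 0 \<le> \<tau> \<Longrightarrow> \<tau> \<le> t \<Longrightarrow> x + \<sigma> *\<^sub>R u + \<tau> *\<^sub>R v \<in> S"
    and f: "\<And>y. y \<in> S \<Longrightarrow> f differentiable (at y)"
    and fu: "\<And>y. y \<in> S \<Longrightarrow> (\<lambda>z. frechet_derivative f (at z) u) differentiable (at y)"
  obtains \<sigma> \<tau> where "0 < \<sigma>" "\<sigma> < s" "0 < \<tau>" "\<tau> < t"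
    "f (x + s *\<^sub>R u + t *\<^sub>R v) - f (x + s *\<^sub>R u) - f (x + t *\<^sub>R v) + f x =
      s * t * frechet_derivative (\<lambda>z. frechet_derivative f (at z) u) (at (x + \<sigma> *\<^sub>R u + \<tau> *\<^sub>R v)) v"
proof -
  have D1: "((\<lambda>\<sigma>. f (x + \<sigma> *\<^sub>R u + \<tau> *\<^sub>R v)) has_real_derivative
      frechet_derivative f (at (x + \<sigma> *\<^sub>R u + \<tau> *\<^sub>R v)) u) (at \<sigma>)"
    if "0 \<le> \<sigma>" "\<sigma> \<le> s" "0 \<le> \<tau>" "\<tau> \<le> t" for \<sigma> \<tau>
    using directional_derivative[of f "x + \<tau> *\<^sub>R v" \<sigma> u] f[OF inS[OF that]] by (simp add: add_ac)
  have D2: "((\<lambda>\<tau>. frechet_derivative f (at (x + \<sigma> *\<^sub>R u + \<tau> *\<^sub>R v)) u) has_real_derivative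
      frechet_derivative (\<lambda>z. frechet_derivative f (at z) u) (at (x + \<sigma> *\<^sub>R u + \<tau> *\<^sub>R v)) v) (at \<tau>)"
    if "0 \<le> \<sigma>" "\<sigma> \<le> s" "0 \<le> \<tau>" "\<tau> \<le> t" for \<sigma> \<tau>
    by (rule directional_derivative[OF fu[OF inS[OF that]]])
  define g where "g \<sigma> = f (x + \<sigma> *\<^sub>R u + t *\<^sub>R v) - f (x + \<sigma> *\<^sub>R u)" for \<sigma>
  have "DERIV g \<sigma> :> frechet_derivative f (at (x + \<sigma> *\<^sub>R u + t *\<^sub>R v)) u -
      frechet_derivative f (at (x + \<sigma> *\<^sub>R u)) u" if "0 \<le> \<sigma>" "\<sigma> \<le> s" for \<sigma>
    unfolding g_def using D1[OF that, of t] D1[OF that, of 0] assms(2)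
    by (auto intro!: DERIV_diff)
  from MVT2[OF assms(1) this] obtain \<sigma> where \<sigma>: "0 < \<sigma>" "\<sigma> < s"
    "g s - g 0 = s * (frechet_derivative f (at (x + \<sigma> *\<^sub>R u + t *\<^sub>R v)) u -
      frechet_derivative f (at (x + \<sigma> *\<^sub>R u)) u)" by auto
  have "\<exists>\<tau>>0. \<tau> < t \<and> frechet_derivative f (at (x + \<sigma> *\<^sub>R u + t *\<^sub>R v)) u -
      frechet_derivative f (at (x + \<sigma> *\<^sub>R u + 0 *\<^sub>R v)) u = (t - 0) *
      frechet_derivative (\<lambda>z. frechet_derivative f (at z) u) (at (x + \<sigma> *\<^sub>R u + \<tau> *\<^sub>R v)) v"
    by (rule MVT2[OF assms(2)]) (use D2 \<sigma> in auto)
  then obtain \<tau> where "0 < \<tau>" "\<tau> < t" "frechet_derivative f (at (x + \<sigma> *\<^sub>R u + t *\<^sub>R v)) u -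
      frechet_derivative f (at (x + \<sigma> *\<^sub>R u)) u = t *
      frechet_derivative (\<lambda>z. frechet_derivative f (at z) u) (at (x + \<sigma> *\<^sub>R u + \<tau> *\<^sub>R v)) v"
    by auto
  with \<sigma> show thesis by (intro that[of \<sigma> \<tau>]) (auto simp: g_def)
qed

lemma second_derivative_symmetric_real:
  fixes f :: "'a::real_normed_vector \<Rightarrow> real"
  assumes "open S" "smooth_on f S" "x \<in> S"
  shows "frechet_derivative (\<lambda>z. frechet_derivative f (at z) u) (at x) v =
    frechet_derivative (\<lambda>z. frechet_derivative f (at z) v) (at x) u"
proof -
  let ?F = "\<lambda>u v y. frechet_derivative (\<lambda>z. frechet_derivative f (at z) u) (at y) v"
  have cont: "isCont (?F u v) x" for u v
    using smooth_on_continuous[OF smooth_on_frechet[OF smooth_on_frechet[OF assms(2)]]]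
      assms continuous_on_eq_continuous_at by blast
  have "\<bar>?F u v x - ?F v u x\<bar> \<le> e" if "0 < e" for e
  proof -
    obtain d1 where d1: "0 < d1" "\<And>y. dist y x < d1 \<Longrightarrow> dist (?F u v y) (?F u v x) < e / 2"
      using cont[of u v] \<open>0 < e\<close> unfolding continuous_at_eps_delta by (meson half_gt_zero)
    obtain d2 where d2: "0 < d2" "\<And>y. dist y x < d2 \<Longrightarrow> dist (?F v u y) (?F v u x) < e / 2"
      using cont[of v u] \<open>0 < e\<close> unfolding continuous_at_eps_delta by (meson half_gt_zero)
    obtain d3 where d3: "0 < d3" "ball x d3 \<subseteq> S"
      using assms openE by blast
    define d where "d = min d1 (min d2 d3)"
    have "0 < d" using d1 d2 d3 by (simp add: d_def)
    \<comment> \<open>Side of a parallelogram that fits into the ball of radius d; the summand 1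
      keeps the denominator positive when u = v = 0.\<close>
    define s where "s = d / (2 * (norm u + norm v + 1))"
    have n: "0 < norm u + norm v + 1" by (simp add: add_nonneg_pos)
    have "0 < s" using \<open>0 < d\<close> n by (simp add: s_def)
    have near: "dist (x + \<sigma> *\<^sub>R u + \<tau> *\<^sub>R v) x < d"
      if "0 \<le> \<sigma>" "\<sigma> \<le> s" "0 \<le> \<tau>" "\<tau> \<le> s" for \<sigma> \<tau>
    proof -
      have "dist (x + \<sigma> *\<^sub>R u + \<tau> *\<^sub>R v) x = norm (\<sigma> *\<^sub>R u + \<tau> *\<^sub>R v)"
        by (simp add: dist_norm add.assoc)
      also have "\<dots> \<le> \<sigma> * norm u + \<tau> * norm v"
        using norm_triangle_ineq[of "\<sigma> *\<^sub>R u" "\<tau> *\<^sub>R v"] that by simp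
      also have "\<dots> \<le> s * norm u + s * norm v"
        using that by (intro add_mono mult_right_mono) auto
      also have "\<dots> < s * (2 * (norm u + norm v + 1))"
      proof -
        have "norm u + norm v < 2 * (norm u + norm v + 1)" using norm_ge_zero[of u] norm_ge_zero[of v] unfolding distrib_left by linarith
        then have "s * (norm u + norm v) < s * (2 * (norm u + norm v + 1))"
          using \<open>0 < s\<close> by (rule mult_strict_left_mono)
        then show ?thesis by (simp add: distrib_left)
      qed
      also have "\<dots> = d" using n by (simp add: s_def)
      finally show ?thesis .
    qed
    have inS: "x + \<sigma> *\<^sub>R u + \<tau> *\<^sub>R v \<in> S" if "0 \<le> \<sigma>" "\<sigma> \<le> s" "0 \<le> \<tau>" "\<tau> \<le> s" for \<sigma> \<tau>
      using near[OF that] d3 by (auto simp: d_def dist_commute)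
    have inS': "x + \<sigma> *\<^sub>R v + \<tau> *\<^sub>R u \<in> S" if "0 \<le> \<sigma>" "\<sigma> \<le> s" "0 \<le> \<tau>" "\<tau> \<le> s" for \<sigma> \<tau>
      using inS[of \<tau> \<sigma>] that by (simp add: algebra_simps)
    obtain \<sigma> \<tau> where 1: "0 < \<sigma>" "\<sigma> < s" "0 < \<tau>" "\<tau> < s"
      "f (x + s *\<^sub>R u + s *\<^sub>R v) - f (x + s *\<^sub>R u) - f (x + s *\<^sub>R v) + f x =
        s * s * ?F u v (x + \<sigma> *\<^sub>R u + \<tau> *\<^sub>R v)"
      using second_difference_mean_value[OF \<open>0 < s\<close> \<open>0 < s\<close> inS
          smooth_on_differentiable[OF assms(2)]
          smooth_on_differentiable[OF smooth_on_frechet[OF assms(2)]]] by blast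
    obtain \<sigma>' \<tau>' where 2: "0 < \<sigma>'" "\<sigma>' < s" "0 < \<tau>'" "\<tau>' < s"
      "f (x + s *\<^sub>R v + s *\<^sub>R u) - f (x + s *\<^sub>R v) - f (x + s *\<^sub>R u) + f x =
        s * s * ?F v u (x + \<sigma>' *\<^sub>R v + \<tau>' *\<^sub>R u)"
      using second_difference_mean_value[OF \<open>0 < s\<close> \<open>0 < s\<close> inS'
          smooth_on_differentiable[OF assms(2)]
          smooth_on_differentiable[OF smooth_on_frechet[OF assms(2)]]] by blast
    have "x + s *\<^sub>R u + s *\<^sub>R v = x + s *\<^sub>R v + s *\<^sub>R u" by (simp add: algebra_simps)
    from 1(5)[unfolded this] 2(5)
    have "s * s * ?F u v (x + \<sigma> *\<^sub>R u + \<tau> *\<^sub>R v) = s * s * ?F v u (x + \<sigma>' *\<^sub>R v + \<tau>' *\<^sub>R u)"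
      by linarith
    then have eq: "?F u v (x + \<sigma> *\<^sub>R u + \<tau> *\<^sub>R v) = ?F v u (x + \<sigma>' *\<^sub>R v + \<tau>' *\<^sub>R u)"
      using \<open>0 < s\<close> by simp
    have "dist (x + \<sigma> *\<^sub>R u + \<tau> *\<^sub>R v) x < d1" "dist (x + \<sigma>' *\<^sub>R v + \<tau>' *\<^sub>R u) x < d2"
      using near[of \<sigma> \<tau>] near[of \<tau>' \<sigma>'] 1 2
      by (auto simp: d_def add.assoc add.commute[of "\<tau>' *\<^sub>R u"])
    with d1 d2 have "\<bar>?F u v (x + \<sigma> *\<^sub>R u + \<tau> *\<^sub>R v) - ?F u v x\<bar> < e / 2"
      "\<bar>?F v u (x + \<sigma>' *\<^sub>R v + \<tau>' *\<^sub>R u) - ?F v u x\<bar> < e / 2"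
      by (auto simp: dist_real_def)
    with eq show ?thesis by linarith
  qed
  then have "\<bar>?F u v x - ?F v u x\<bar> \<le> 0" by (rule field_le_epsilon[of _ 0, simplified])
  then show ?thesis by simp
qed

lemma second_derivative_symmetric:
  fixes f :: "'a::real_normed_vector \<Rightarrow> 'b::euclidean_space"
  assumes "open S" "smooth_on f S" "x \<in> S"
  shows "frechet_derivative (\<lambda>z. frechet_derivative f (at z) u) (at x) v =
    frechet_derivative (\<lambda>z. frechet_derivative f (at z) v) (at x) u"
proof (rule euclidean_eqI)
  fix b :: 'b assume "b \<in> Basis"
  have I: "frechet_derivative (\<lambda>z. g z \<bullet> b) (at y) w = frechet_derivative g (at y) w \<bullet> b"
    if "smooth_on g S" "y \<in> S" for g :: "'a \<Rightarrow> 'b" and y w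
    using lie_deriv_bounded_linear[OF bounded_linear_inner_left
        smooth_on_differentiable[OF that], of "\<lambda>_. w" b] by (simp add: lie_deriv_def)
  have s: "smooth_on (\<lambda>z. f z \<bullet> b) S"
    by (rule smooth_on_bounded_linear[OF assms(1) bounded_linear_inner_left assms(2)])
  have J: "frechet_derivative (\<lambda>z. frechet_derivative (\<lambda>z. f z \<bullet> b) (at z) u) (at x) v =
      frechet_derivative (\<lambda>z. frechet_derivative f (at z) u) (at x) v \<bullet> b" for u v
  proof -
    have "frechet_derivative (\<lambda>z. frechet_derivative (\<lambda>z. f z \<bullet> b) (at z) u) (at x) =
      frechet_derivative (\<lambda>z. frechet_derivative f (at z) u \<bullet> b) (at x)"
      by (rule frechet_derivative_transform_within_open[of _ _ S])
        (use smooth_on_differentiable[OF smooth_on_frechet[OF s]] assms I in auto)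
    then show ?thesis using I[OF smooth_on_frechet[OF assms(2)] assms(3)] by simp
  qed
  show "frechet_derivative (\<lambda>z. frechet_derivative f (at z) u) (at x) v \<bullet> b =
    frechet_derivative (\<lambda>z. frechet_derivative f (at z) v) (at x) u \<bullet> b"
    using second_derivative_symmetric_real[OF assms(1) s assms(3), of u v] by (simp add: J)
qed

text \<open>X Y f is the differential of f applied to the derivative of Y along X, plus a Hessian
  term. In the commutator the Hessian terms cancel by symmetry, and the rest is the differential of
  f applied to the bracket.\<close>

lemma lie_deriv_lie_bracket:
  fixes f :: "'a::euclidean_space \<Rightarrow> 'b::euclidean_space"
  assumes "open S" "smooth_on X S" "smooth_on Y S" "smooth_on f S" "x \<in> S"
  shows "lie_deriv (lie_bracket X Y) f x =
    lie_deriv X (lie_deriv Y f) x - lie_deriv Y (lie_deriv X f) x"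
proof -
  let ?D = "\<lambda>b y. frechet_derivative f (at y) b"
  have lin: "linear (frechet_derivative f (at x))"
    using smooth_on_has_derivative[OF assms(4,5)] has_derivative_linear by blast
  have key: "lie_deriv X (lie_deriv Y f) x = frechet_derivative f (at x) (lie_deriv X Y x) +
      (\<Sum>b\<in>Basis. \<Sum>c\<in>Basis. ((Y x \<bullet> b) * (X x \<bullet> c)) *\<^sub>R frechet_derivative (?D b) (at x) c)"
    if s: "smooth_on X S" "smooth_on Y S" for X Y
  proof -
    have dY: "(\<lambda>y. Y y \<bullet> b) differentiable (at x)" for b
      by (rule smooth_on_differentiable[OF smooth_on_bounded_linear
            [OF assms(1) bounded_linear_inner_left s(2)] assms(5)])
    have dD: "?D b differentiable (at x)" for b
      by (rule smooth_on_differentiable[OF smooth_on_frechet[OF assms(4)] assms(5)])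
    have "lie_deriv X (lie_deriv Y f) x = lie_deriv X (\<lambda>y. \<Sum>b\<in>Basis. (Y y \<bullet> b) *\<^sub>R ?D b y) x"
      by (rule lie_deriv_cong[OF assms(1) smooth_on_differentiable
            [OF smooth_on_lie_deriv[OF assms(1) s(2) assms(4)] assms(5)] assms(5)])
        (rule lie_deriv_basis[OF smooth_on_differentiable[OF assms(4)]])
    also have "\<dots> = (\<Sum>b\<in>Basis. lie_deriv X (\<lambda>y. (Y y \<bullet> b) *\<^sub>R ?D b y) x)"
      by (rule lie_deriv_sum) (intro differentiable_scaleR dY dD)
    also have "\<dots> = (\<Sum>b\<in>Basis. (Y x \<bullet> b) *\<^sub>R lie_deriv X (?D b) x + (lie_deriv X Y x \<bullet> b) *\<^sub>R ?D b x)"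
    proof (rule sum.cong[OF refl])
      fix b :: 'a
      show "lie_deriv X (\<lambda>y. (Y y \<bullet> b) *\<^sub>R ?D b y) x =
          (Y x \<bullet> b) *\<^sub>R lie_deriv X (?D b) x + (lie_deriv X Y x \<bullet> b) *\<^sub>R ?D b x"
        by (simp only: lie_deriv_scaleR[OF dY dD] lie_deriv_bounded_linear
              [OF bounded_linear_inner_left smooth_on_differentiable[OF s(2) assms(5)]])
    qed
    also have "\<dots> = (\<Sum>b\<in>Basis. (Y x \<bullet> b) *\<^sub>R lie_deriv X (?D b) x) +
        frechet_derivative f (at x) (\<Sum>b\<in>Basis. (lie_deriv X Y x \<bullet> b) *\<^sub>R b)"
      by (simp add: sum.distrib linear_sum[OF lin] linear_scale[OF lin])
    also have "\<dots> = (\<Sum>b\<in>Basis. \<Sum>c\<in>Basis. ((Y x \<bullet> b) * (X x \<bullet> c)) *\<^sub>R frechet_derivative (?D b) (at x) c) +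
        frechet_derivative f (at x) (lie_deriv X Y x)"
      by (simp add: lie_deriv_basis[OF dD] scaleR_sum_right euclidean_representation)
    finally show ?thesis by simp
  qed
  have "(\<Sum>b\<in>Basis. \<Sum>c\<in>Basis. ((Y x \<bullet> b) * (X x \<bullet> c)) *\<^sub>R frechet_derivative (?D b) (at x) c) =
    (\<Sum>c\<in>Basis. \<Sum>b\<in>Basis. ((Y x \<bullet> b) * (X x \<bullet> c)) *\<^sub>R frechet_derivative (?D b) (at x) c)"
    by (rule sum.swap)
  also have "\<dots> = (\<Sum>c\<in>Basis. \<Sum>b\<in>Basis. ((X x \<bullet> c) * (Y x \<bullet> b)) *\<^sub>R frechet_derivative (?D c) (at x) b)"
    by (intro sum.cong refl)
      (simp add: second_derivative_symmetric[OF assms(1,4,5)] mult.commute)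
  finally show ?thesis
    unfolding key[OF assms(2,3)] key[OF assms(3,2)]
    by (simp add: lie_deriv_def[of "lie_bracket X Y"] lie_bracket_lie_deriv linear_diff[OF lin])
qed

lemma lie_deriv_lie_bracket_right:
  fixes X :: "'a::euclidean_space \<Rightarrow> 'a"
  assumes "open S" "smooth_on X S" "smooth_on Y S" "smooth_on Z S" "x \<in> S"
  shows "lie_deriv X (lie_bracket Y Z) x =
    lie_deriv X (lie_deriv Y Z) x - lie_deriv X (lie_deriv Z Y) x"
proof -
  have "lie_deriv X (lie_bracket Y Z) x = lie_deriv X (\<lambda>y. lie_deriv Y Z y - lie_deriv Z Y y) x"
    by (rule lie_deriv_cong[OF assms(1) smooth_on_differentiable
          [OF smooth_on_lie_bracket[OF assms(1,3,4)] assms(5)] assms(5)])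
      (rule lie_bracket_lie_deriv)
  also have "\<dots> = lie_deriv X (lie_deriv Y Z) x - lie_deriv X (lie_deriv Z Y) x"
    by (intro lie_deriv_diff smooth_on_differentiable[OF _ assms(5)] smooth_on_lie_deriv assms)
  finally show ?thesis .
qed

text \<open>After expansion into iterated derivatives of the coefficient maps the identity is
  formal. This shape pulls the outer letter out of a left factor, which is how arbitrary brackets
  become right-nested.\<close>

lemma lie_bracket_jacobi:
  fixes X :: "'a::euclidean_space \<Rightarrow> 'a"
  assumes "open S" "smooth_on X S" "smooth_on Y S" "smooth_on Z S" "x \<in> S"
  shows "lie_bracket (lie_bracket X Y) Z x =
    lie_bracket X (lie_bracket Y Z) x - lie_bracket Y (lie_bracket X Z) x"
  unfolding lie_bracket_lie_deriv[of "lie_bracket X Y"] lie_bracket_lie_deriv[of X "lie_bracket Y Z"]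
    lie_bracket_lie_deriv[of Y "lie_bracket X Z"]
    lie_deriv_lie_bracket[OF assms(1,2,3,4,5)] lie_deriv_lie_bracket[OF assms(1,3,4,2,5)]
    lie_deriv_lie_bracket[OF assms(1,2,4,3,5)] lie_deriv_lie_bracket_right[OF assms(1,2,3,4,5)]
    lie_deriv_lie_bracket_right[OF assms(1,3,2,4,5)] lie_deriv_lie_bracket_right[OF assms(1,4,2,3,5)]
  by (simp add: algebra_simps)

subsection \<open>Iterated commutators\<close>

lemma weight_Cons: "weight (i # J) = weight [i] + weight J"
  by (simp add: weight_def)

lemma length_le_weight: "length I \<le> weight I"
  by (induction I) (auto simp: weight_def)

lemma weight_mset_cong: "mset I = mset J \<Longrightarrow> weight I = weight J"
  unfolding weight_def by (metis mset_map sum_mset_sum_list)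

lemma finite_multiindices: "finite (multiindices n r)"
proof (rule finite_subset)
  show "multiindices n r \<subseteq> {I. set I \<subseteq> {0..n} \<and> length I \<le> r}"
    using length_le_weight order_trans unfolding multiindices_def by blast
qed (rule finite_lists_length_le, simp)

lemma weight_pos: "I \<noteq> [] \<Longrightarrow> 1 \<le> weight I"
  using length_le_weight[of I] by (cases I) auto

lemma iter_bracket_Cons: "J \<noteq> [] \<Longrightarrow> iter_bracket X (i # J) = lie_bracket (X i) (iter_bracket X J)"
  by (cases J) auto

lemma nc_iter_Cons: "J \<noteq> [] \<Longrightarrow> nc_iter (i # J) = nc_commutator (nc_var i) (nc_iter J)"
  by (cases J) auto

lemma smooth_on_iter_bracket:
  fixes X :: "nat \<Rightarrow> 'a::euclidean_space \<Rightarrow> 'a"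
  assumes "open S" "\<And>i. i \<le> n \<Longrightarrow> smooth_on (X i) S" "set I \<subseteq> {0..n}"
  shows "smooth_on (iter_bracket X I) S"
  using assms(3)
proof (induction I)
  case Nil
  then show ?case by (simp add: smooth_on_const)
next
  case (Cons i J)
  then show ?case
    using assms(1,2) by (cases "J = []") (auto simp: iter_bracket_Cons intro!: smooth_on_lie_bracket)
qed

text \<open>The coefficients are chosen before the point, hence constant: a further bracket then
  produces no derivatives of coefficients. As \<open>multiindices n m\<close> only bounds the weight
  by m, the part of exact weight m is cut out.\<close>

definition bracket_layer ::
  "nat \<Rightarrow> (nat \<Rightarrow> 'a::real_normed_vector \<Rightarrow> 'a) \<Rightarrow> 'a set \<Rightarrow> nat \<Rightarrow> ('a \<Rightarrow> 'a) \<Rightarrow> bool" where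
  "bracket_layer n X S m f \<longleftrightarrow>
     (\<exists>c. \<forall>x\<in>S. f x = (\<Sum>K\<in>{K \<in> multiindices n m. weight K = m}. c K *\<^sub>R iter_bracket X K x))"

lemma bracket_layer_iter_bracket:
  assumes "K \<noteq> []" "set K \<subseteq> {0..n}" "weight K = m"
  shows "bracket_layer n X S m (iter_bracket X K)"
  unfolding bracket_layer_def
proof (intro exI ballI)
  fix x assume "x \<in> S"
  have "K \<in> {K \<in> multiindices n m. weight K = m}"
    using assms by (simp add: multiindices_def)
  moreover have "finite {K \<in> multiindices n m. weight K = m}"
    using finite_multiindices[of n m] by simp
  ultimately show "iter_bracket X K x = (\<Sum>L\<in>{L \<in> multiindices n m. weight L = m}.
      (if L = K then 1 else 0) *\<^sub>R iter_bracket X L x)"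
    by (simp add: if_distrib[of "\<lambda>a. a *\<^sub>R _"] cong: if_cong)
qed

lemma bracket_layer_add:
  assumes "bracket_layer n X S m f" "bracket_layer n X S m g"
  shows "bracket_layer n X S m (\<lambda>x. f x + g x)"
proof -
  obtain c where c: "\<And>x. x \<in> S \<Longrightarrow>
      f x = (\<Sum>K\<in>{K \<in> multiindices n m. weight K = m}. c K *\<^sub>R iter_bracket X K x)"
    using assms(1) unfolding bracket_layer_def by blast
  obtain d where d: "\<And>x. x \<in> S \<Longrightarrow>
      g x = (\<Sum>K\<in>{K \<in> multiindices n m. weight K = m}. d K *\<^sub>R iter_bracket X K x)"
    using assms(2) unfolding bracket_layer_def by blast
  show ?thesis unfolding bracket_layer_def
  proof (intro exI ballI)
    fix x assume "x \<in> S"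
    show "f x + g x =
      (\<Sum>K\<in>{K \<in> multiindices n m. weight K = m}. (c K + d K) *\<^sub>R iter_bracket X K x)"
      unfolding c[OF \<open>x \<in> S\<close>] d[OF \<open>x \<in> S\<close>] scaleR_left_distrib sum.distrib ..
  qed
qed

lemma bracket_layer_scale:
  assumes "bracket_layer n X S m f"
  shows "bracket_layer n X S m (\<lambda>x. a *\<^sub>R f x)"
proof -
  obtain c where c: "\<And>x. x \<in> S \<Longrightarrow>
      f x = (\<Sum>K\<in>{K \<in> multiindices n m. weight K = m}. c K *\<^sub>R iter_bracket X K x)"
    using assms(1) unfolding bracket_layer_def by blast
  show ?thesis unfolding bracket_layer_def
  proof (intro exI ballI)
    fix x assume "x \<in> S"
    show "a *\<^sub>R f x =
      (\<Sum>K\<in>{K \<in> multiindices n m. weight K = m}. (a * c K) *\<^sub>R iter_bracket X K x)"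
      unfolding c[OF \<open>x \<in> S\<close>] scaleR_sum_right by simp
  qed
qed

lemma bracket_layer_sum:
  "(\<And>i. i \<in> A \<Longrightarrow> bracket_layer n X S m (f i)) \<Longrightarrow> bracket_layer n X S m (\<lambda>x. \<Sum>i\<in>A. f i x)"
proof (induction A rule: infinite_finite_induct)
  case (insert i A)
  then show ?case by (simp add: bracket_layer_add)
qed (auto simp: bracket_layer_def intro!: exI[of _ "\<lambda>_. 0"])

lemma bracket_layer_cong:
  "bracket_layer n X S m f \<Longrightarrow> (\<And>x. x \<in> S \<Longrightarrow> g x = f x) \<Longrightarrow> bracket_layer n X S m g"
  unfolding bracket_layer_def by metis

text \<open>With constant coefficients the bracket distributes over the combination, and bracketing
  with \<open>X i\<close> prefixes the letter i to each multiindex.\<close>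

lemma bracket_layer_lie_bracket:
  fixes X :: "nat \<Rightarrow> 'a::euclidean_space \<Rightarrow> 'a"
  assumes "open S" "\<And>i. i \<le> n \<Longrightarrow> smooth_on (X i) S" "i \<le> n"
    and "bracket_layer n X S m g" "smooth_on g S"
  shows "bracket_layer n X S (weight [i] + m) (lie_bracket (X i) g)"
proof -
  let ?A = "{K \<in> multiindices n m. weight K = m}"
  obtain c where c: "\<And>x. x \<in> S \<Longrightarrow> g x = (\<Sum>K\<in>?A. c K *\<^sub>R iter_bracket X K x)"
    using assms(4) unfolding bracket_layer_def by blast
  have "bracket_layer n X S (weight [i] + m) (\<lambda>x. \<Sum>K\<in>?A. c K *\<^sub>R iter_bracket X (i # K) x)"
    by (intro bracket_layer_sum bracket_layer_scale bracket_layer_iter_bracket)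
      (use assms(3) in \<open>auto simp: weight_def multiindices_def\<close>)
  then show ?thesis
  proof (rule bracket_layer_cong)
    fix x assume "x \<in> S"
    have sm: "iter_bracket X K differentiable (at x)" if "K \<in> ?A" for K
      using smooth_on_differentiable[OF smooth_on_iter_bracket[OF assms(1,2)] \<open>x \<in> S\<close>] that
      by (auto simp: multiindices_def)
    have "lie_deriv (X i) g x = lie_deriv (X i) (\<lambda>x. \<Sum>K\<in>?A. c K *\<^sub>R iter_bracket X K x) x"
      by (rule lie_deriv_cong[OF assms(1) smooth_on_differentiable[OF assms(5)] ])
        (use \<open>x \<in> S\<close> c in auto)
    also have "\<dots> = (\<Sum>K\<in>?A. lie_deriv (X i) (\<lambda>x. c K *\<^sub>R iter_bracket X K x) x)"
      by (rule lie_deriv_sum) (intro differentiable_scaleR differentiable_const sm)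
    also have "\<dots> = (\<Sum>K\<in>?A. c K *\<^sub>R lie_deriv (X i) (iter_bracket X K) x)"
      using sm by (intro sum.cong refl lie_deriv_scale)
    finally have 1: "lie_deriv (X i) g x = (\<Sum>K\<in>?A. c K *\<^sub>R lie_deriv (X i) (iter_bracket X K) x)" .
    have "lie_deriv g (X i) x = frechet_derivative (X i) (at x) (\<Sum>K\<in>?A. c K *\<^sub>R iter_bracket X K x)"
      using c[OF \<open>x \<in> S\<close>] by (simp add: lie_deriv_def)
    also have "\<dots> = (\<Sum>K\<in>?A. c K *\<^sub>R lie_deriv (iter_bracket X K) (X i) x)"
      by (rule lie_deriv_linear_field[OF smooth_on_differentiable[OF assms(2)[OF assms(3)] \<open>x \<in> S\<close>]])
    finally have 2: "lie_deriv g (X i) x = \<dots>" .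
    have "lie_bracket (X i) g x = (\<Sum>K\<in>?A. c K *\<^sub>R lie_bracket (X i) (iter_bracket X K) x)"
      by (simp add: lie_bracket_lie_deriv[of "X i"] 1 2 scaleR_diff_right sum_subtractf)
    also have "\<dots> = (\<Sum>K\<in>?A. c K *\<^sub>R iter_bracket X (i # K) x)"
      by (intro sum.cong refl) (auto simp: iter_bracket_Cons multiindices_def)
    finally show "lie_bracket (X i) g x = \<dots>" .
  qed
qed

text \<open>Jacobi peels off the outermost letter:
  \<open>[[X i, A], B] = [X i, [A, B]] - [A, [X i, B]]\<close>. In both terms the left factor is
  shorter, while in the second the right factor grows, hence the induction over I with J arbitrary.
  The total weight never changes.\<close>

lemma bracket_layer_lie_bracket_iter:
  fixes X :: "nat \<Rightarrow> 'a::euclidean_space \<Rightarrow> 'a"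
  assumes "open S" "\<And>i. i \<le> n \<Longrightarrow> smooth_on (X i) S"
    and "I \<noteq> []" "set I \<subseteq> {0..n}" "J \<noteq> []" "set J \<subseteq> {0..n}"
  shows "bracket_layer n X S (weight I + weight J) (lie_bracket (iter_bracket X I) (iter_bracket X J))"
  using assms(3-)
proof (induction I arbitrary: J)
  case Nil
  then show ?case by simp
next
  case (Cons i I)
  have sm: "smooth_on (iter_bracket X K) S" if "set K \<subseteq> {0..n}" for K
    using smooth_on_iter_bracket[OF assms(1,2) that] .
  show ?case
  proof (cases "I = []")
    case True
    then show ?thesis
      using Cons.prems bracket_layer_iter_bracket[of "i # J" n "weight [i] + weight J" X S]
      by (simp add: iter_bracket_Cons[of J, symmetric] weight_Cons[of i J])
  next
    case False
    have i: "i \<le> n" "set I \<subseteq> {0..n}" using Cons.prems by auto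
    have 1: "bracket_layer n X S (weight [i] + (weight I + weight J))
        (lie_bracket (X i) (lie_bracket (iter_bracket X I) (iter_bracket X J)))"
      by (intro bracket_layer_lie_bracket assms(1,2) i Cons.IH False Cons.prems
          smooth_on_lie_bracket sm)
    have 2: "bracket_layer n X S (weight I + weight (i # J))
        (lie_bracket (iter_bracket X I) (iter_bracket X (i # J)))"
      using i Cons.prems False by (intro Cons.IH) auto
    have w: "weight I + weight (i # J) = weight [i] + (weight I + weight J)"
      "weight (i # I) + weight J = weight [i] + (weight I + weight J)"
      using weight_Cons[of i I] weight_Cons[of i J] by auto
    show ?thesis
      unfolding w
    proof (rule bracket_layer_cong[OF bracket_layer_add[OF 1 bracket_layer_scale[OF 2[unfolded w], of "-1"]]])
      fix x assume "x \<in> S"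
      show "lie_bracket (iter_bracket X (i # I)) (iter_bracket X J) x =
        lie_bracket (X i) (lie_bracket (iter_bracket X I) (iter_bracket X J)) x +
        (-1) *\<^sub>R lie_bracket (iter_bracket X I) (iter_bracket X (i # J)) x"
        using lie_bracket_jacobi[OF assms(1) assms(2)[OF i(1)] sm[OF i(2)] sm[OF Cons.prems(4)] \<open>x \<in> S\<close>]
          False Cons.prems by (simp add: iter_bracket_Cons)
    qed
  qed
qed

subsection \<open>Iterated commutators as differential operators\<close>

text \<open>The operator obtained from the monomial \<open>\<xi>\<^sub>J\<close> by substituting the
  fields for the indeterminates; the last letter acts first.\<close>

primrec word_deriv ::
  "(nat \<Rightarrow> 'a::real_normed_vector \<Rightarrow> 'a) \<Rightarrow> nat list \<Rightarrow> ('a \<Rightarrow> 'b::real_normed_vector) \<Rightarrow> 'a \<Rightarrow> 'b" where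
  "word_deriv X [] f = f"
| "word_deriv X (j # J) f = lie_deriv (X j) (word_deriv X J f)"

lemma word_deriv_snoc: "word_deriv X (J @ [i]) f = word_deriv X J (lie_deriv (X i) f)"
  by (induction J) auto

lemma smooth_on_word_deriv:
  fixes f :: "'a::euclidean_space \<Rightarrow> 'b::euclidean_space"
  assumes "open S" "\<And>i. i \<le> n \<Longrightarrow> smooth_on (X i) S" "set J \<subseteq> {0..n}" "smooth_on f S"
  shows "smooth_on (word_deriv X J f) S"
  using assms(3) by (induction J) (auto intro!: assms smooth_on_lie_deriv)

section \<open>Multiplication by a single indeterminate\<close>

lemma nc_mult_var_Cons: "nc_mult (nc_var i) q (a # J) = (if a = i then q J else 0)"
proof -
  have "nc_mult (nc_var i) q (a # J) =
      (\<Sum>k\<in>{1}. nc_var i (take k (a # J)) * q (drop k (a # J)))"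
    unfolding nc_mult_def
  proof (rule sum.mono_neutral_right)
    show "\<forall>k\<in>{..length (a # J)} - {1}. nc_var i (take k (a # J)) * q (drop k (a # J)) = 0"
    proof
      fix k assume k: "k \<in> {..length (a # J)} - {1}"
      then have "length (take k (a # J)) \<noteq> length [i]" by auto
      then have "take k (a # J) \<noteq> [i]" by metis
      then show "nc_var i (take k (a # J)) * q (drop k (a # J)) = 0" by (simp add: nc_var_def)
    qed
  qed auto
  then show ?thesis by (simp add: nc_var_def)
qed

lemma nc_mult_var_snoc: "nc_mult q (nc_var i) (J @ [a]) = (if a = i then q J else 0)"
proof -
  have "nc_mult q (nc_var i) (J @ [a]) =
      (\<Sum>k\<in>{length J}. q (take k (J @ [a])) * nc_var i (drop k (J @ [a])))"
    unfolding nc_mult_def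
  proof (rule sum.mono_neutral_right)
    show "\<forall>k\<in>{..length (J @ [a])} - {length J}. q (take k (J @ [a])) * nc_var i (drop k (J @ [a])) = 0"
    proof
      fix k assume k: "k \<in> {..length (J @ [a])} - {length J}"
      then have "length (drop k (J @ [a])) \<noteq> length [i]" by auto
      then have "drop k (J @ [a]) \<noteq> [i]" by metis
      then show "q (take k (J @ [a])) * nc_var i (drop k (J @ [a])) = 0" by (simp add: nc_var_def)
    qed
  qed auto
  then show ?thesis by (simp add: nc_var_def)
qed

text \<open>All nonzero coefficients of \<open>nc_iter I\<close> sit on words as long as I, so such
  a finite set can carry the sum over J.\<close>

definition words_of_length :: "nat \<Rightarrow> nat \<Rightarrow> nat list set" where
  "words_of_length n L = {J. set J \<subseteq> {0..n} \<and> length J = L}"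

lemma finite_words_of_length: "finite (words_of_length n L)"
  unfolding words_of_length_def by (rule finite_lists_length_eq) simp

lemma words_of_length_Suc_Cons:
  "words_of_length n (Suc L) = (\<lambda>(a, J). a # J) ` ({0..n} \<times> words_of_length n L)"
  by (auto simp: words_of_length_def length_Suc_conv image_iff)

lemma words_of_length_Suc_snoc:
  "words_of_length n (Suc L) = (\<lambda>(a, J). J @ [a]) ` ({0..n} \<times> words_of_length n L)"
proof -
  have "K \<in> (\<lambda>(a, J). J @ [a]) ` ({0..n} \<times> words_of_length n L)"
    if "K \<in> words_of_length n (Suc L)" for K
    using that by (cases K rule: rev_cases) (auto simp: words_of_length_def image_iff)
  then show ?thesis by (auto simp: words_of_length_def)
qed

text \<open>Multiplying by an indeterminate on the left prefixes its letter, so the sum over the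
  longer words collapses to those that begin with i; in the mirror statement, to those that end with
  i.\<close>

lemma sum_nc_mult_var_left:
  assumes "i \<le> n"
  shows "(\<Sum>J\<in>words_of_length n (Suc L). nc_mult (nc_var i) q J *\<^sub>R g J) =
    (\<Sum>J\<in>words_of_length n L. q J *\<^sub>R (g (i # J) :: 'a::real_vector))"
proof -
  have "(\<Sum>J\<in>words_of_length n (Suc L). nc_mult (nc_var i) q J *\<^sub>R g J) =
      (\<Sum>(a, J)\<in>{0..n} \<times> words_of_length n L. if a = i then q J *\<^sub>R g (a # J) else 0)"
    unfolding words_of_length_Suc_Cons
    by (subst sum.reindex) (auto simp: inj_on_def nc_mult_var_Cons intro!: sum.cong)
  also have "\<dots> = (\<Sum>a\<in>{0..n}. if a = i then \<Sum>J\<in>words_of_length n L. q J *\<^sub>R g (a # J) else 0)"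
    by (subst sum.cartesian_product[symmetric], rule sum.cong[OF refl]) auto
  also have "\<dots> = (\<Sum>J\<in>words_of_length n L. q J *\<^sub>R g (i # J))"
    unfolding sum.delta[OF finite_atLeastAtMost] using assms by simp
  finally show ?thesis .
qed

lemma sum_nc_mult_var_right:
  assumes "i \<le> n"
  shows "(\<Sum>J\<in>words_of_length n (Suc L). nc_mult q (nc_var i) J *\<^sub>R g J) =
    (\<Sum>J\<in>words_of_length n L. q J *\<^sub>R (g (J @ [i]) :: 'a::real_vector))"
proof -
  have "(\<Sum>J\<in>words_of_length n (Suc L). nc_mult q (nc_var i) J *\<^sub>R g J) =
      (\<Sum>(a, J)\<in>{0..n} \<times> words_of_length n L. if a = i then q J *\<^sub>R g (J @ [a]) else 0)"
    unfolding words_of_length_Suc_snoc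
    by (subst sum.reindex) (auto simp: inj_on_def nc_mult_var_snoc intro!: sum.cong)
  also have "\<dots> = (\<Sum>a\<in>{0..n}. if a = i then \<Sum>J\<in>words_of_length n L. q J *\<^sub>R g (J @ [a]) else 0)"
    by (subst sum.cartesian_product[symmetric], rule sum.cong[OF refl]) auto
  also have "\<dots> = (\<Sum>J\<in>words_of_length n L. q J *\<^sub>R g (J @ [i]))"
    unfolding sum.delta[OF finite_atLeastAtMost] using assms by simp
  finally show ?thesis .
qed

text \<open>Substituting fields for indeterminates turns products into compositions of operators and
  commutators into brackets. The function f stays arbitrary because half of the commutator applies
  the induction hypothesis to the derivative of f along \<open>X i\<close>.\<close>

lemma lie_deriv_iter_bracket:
  fixes f :: "'a::euclidean_space \<Rightarrow> 'b::euclidean_space"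
  assumes "open S" "\<And>i. i \<le> n \<Longrightarrow> smooth_on (X i) S"
    and "I \<noteq> []" "set I \<subseteq> {0..n}" "smooth_on f S" "x \<in> S"
  shows "lie_deriv (iter_bracket X I) f x =
    (\<Sum>J\<in>words_of_length n (length I). nc_iter I J *\<^sub>R word_deriv X J f x)"
  using assms(3-)
proof (induction I arbitrary: f x)
  case Nil
  then show ?case by simp
next
  case (Cons i I)
  have i: "i \<le> n" "set I \<subseteq> {0..n}" using Cons.prems by auto
  show ?case
  proof (cases "I = []")
    case True
    have "(\<Sum>J\<in>words_of_length n 1. nc_iter [i] J *\<^sub>R word_deriv X J f x) =
      (\<Sum>J\<in>{[i]}. nc_iter [i] J *\<^sub>R word_deriv X J f x)"
      by (rule sum.mono_neutral_right)
        (use i finite_words_of_length in \<open>auto simp: nc_var_def words_of_length_def\<close>)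
    then show ?thesis using True by (simp add: nc_var_def)
  next
    case False
    let ?W = "words_of_length n (length I)"
    have wd: "word_deriv X J f differentiable (at x)" if "J \<in> ?W" for J
      using smooth_on_differentiable[OF smooth_on_word_deriv[OF assms(1,2)] \<open>x \<in> S\<close>] that
        \<open>smooth_on f S\<close> by (auto simp: words_of_length_def)
    have sI: "smooth_on (iter_bracket X I) S"
      using smooth_on_iter_bracket[OF assms(1,2) i(2)] .
    have "lie_deriv (X i) (lie_deriv (iter_bracket X I) f) x =
        lie_deriv (X i) (\<lambda>x. \<Sum>J\<in>?W. nc_iter I J *\<^sub>R word_deriv X J f x) x"
      by (rule lie_deriv_cong[OF assms(1) smooth_on_differentiable
            [OF smooth_on_lie_deriv[OF assms(1) sI \<open>smooth_on f S\<close>] \<open>x \<in> S\<close>] \<open>x \<in> S\<close>])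
        (rule Cons.IH[OF False i(2) \<open>smooth_on f S\<close>])
    also have "\<dots> = (\<Sum>J\<in>?W. lie_deriv (X i) (\<lambda>x. nc_iter I J *\<^sub>R word_deriv X J f x) x)"
      by (rule lie_deriv_sum) (intro differentiable_scaleR differentiable_const wd)
    also have "\<dots> = (\<Sum>J\<in>?W. nc_iter I J *\<^sub>R lie_deriv (X i) (word_deriv X J f) x)"
      using wd by (intro sum.cong refl lie_deriv_scale)
    also have "\<dots> = (\<Sum>J\<in>words_of_length n (Suc (length I)).
        nc_mult (nc_var i) (nc_iter I) J *\<^sub>R word_deriv X J f x)"
      by (simp add: sum_nc_mult_var_left[OF i(1)])
    finally have 1: "lie_deriv (X i) (lie_deriv (iter_bracket X I) f) x = \<dots>" .
    have "lie_deriv (iter_bracket X I) (lie_deriv (X i) f) x =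
        (\<Sum>J\<in>?W. nc_iter I J *\<^sub>R word_deriv X J (lie_deriv (X i) f) x)"
      using assms(1,2) i \<open>smooth_on f S\<close> \<open>x \<in> S\<close> False
      by (intro Cons.IH smooth_on_lie_deriv) auto
    also have "\<dots> = (\<Sum>J\<in>words_of_length n (Suc (length I)).
        nc_mult (nc_iter I) (nc_var i) J *\<^sub>R word_deriv X J f x)"
      by (simp add: sum_nc_mult_var_right[OF i(1)] word_deriv_snoc)
    finally have 2: "lie_deriv (iter_bracket X I) (lie_deriv (X i) f) x = \<dots>" .
    show ?thesis
      using lie_deriv_lie_bracket[OF assms(1) assms(2)[OF i(1)] sI \<open>smooth_on f S\<close> \<open>x \<in> S\<close>] False
      by (simp add: iter_bracket_Cons nc_iter_Cons 1 2 nc_commutator_def scaleR_diff_left sum_subtractf)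
  qed
qed

text \<open>The commutator is multihomogeneous: each of its monomials is a rearrangement of I.
  Homogeneity in length and in weight both follow from this.\<close>

lemma nc_iter_nonzero_mset: "nc_iter I J \<noteq> 0 \<Longrightarrow> mset J = mset I"
proof (induction I arbitrary: J)
  case Nil
  then show ?case by simp
next
  case (Cons i I)
  have split: "mset J = mset (i # I)"
    if "mset (take k J) = A" "mset (drop k J) = B" "A + B = mset (i # I)" for k A B
    using that by (metis append_take_drop_id mset_append)
  have var: "nc_var i K \<noteq> 0 \<Longrightarrow> mset K = {#i#}" for K
    by (auto simp: nc_var_def split: if_splits)
  show ?case
  proof (cases "I = []")
    case True
    then show ?thesis using Cons.prems var by simp
  next
    case False
    then have "nc_mult (nc_var i) (nc_iter I) J \<noteq> 0 \<or> nc_mult (nc_iter I) (nc_var i) J \<noteq> 0"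
      using Cons.prems by (auto simp: nc_iter_Cons nc_commutator_def)
    then show ?thesis
    proof
      assume "nc_mult (nc_var i) (nc_iter I) J \<noteq> 0"
      then obtain k where "nc_var i (take k J) * nc_iter I (drop k J) \<noteq> 0"
        unfolding nc_mult_def by (meson sum.not_neutral_contains_not_neutral)
      then show ?thesis using Cons.IH[of "drop k J"] var[of "take k J"]
        by (intro split[of k "{#i#}" "mset I"]) auto
    next
      assume "nc_mult (nc_iter I) (nc_var i) J \<noteq> 0"
      then obtain k where "nc_iter I (take k J) * nc_var i (drop k J) \<noteq> 0"
        unfolding nc_mult_def by (meson sum.not_neutral_contains_not_neutral)
      then show ?thesis using Cons.IH[of "take k J"] var[of "drop k J"]
        by (intro split[of k "mset I" "{#i#}"]) auto
    qed
  qed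
qed

subsection \<open>Coefficients with respect to the basis\<close>

text \<open>Independence is a property of the set of frame vectors, whereas the coefficients are
  indexed by coordinates; injectivity of the frame translates between the two.\<close>

lemma bracket_basis_coeff_zero:
  assumes "bracket_basis n r \<Omega> X \<beta>" "x \<in> \<Omega>"
    and "(\<Sum>k\<in>UNIV. c k *\<^sub>R iter_bracket X (\<beta> k) x) = 0"
  shows "c k = 0"
proof -
  let ?Y = "\<lambda>k. iter_bracket X (\<beta> k) x"
  have inj: "inj ?Y" and ind: "independent (range ?Y)"
    using assms(1,2) unfolding bracket_basis_def by auto
  have "(\<Sum>v\<in>range ?Y. c (inv ?Y v) *\<^sub>R v) = 0"
    using assms(3) by (simp add: sum.reindex[OF inj] inv_f_f[OF inj])
  from independentD[OF ind _ _ this, of "?Y k"] show ?thesis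
    by (simp add: inv_f_f[OF inj])
qed

lemma bracket_basis_coeff_exists:
  assumes "bracket_basis n r \<Omega> X \<beta>" "x \<in> \<Omega>"
  obtains c where "v = (\<Sum>k\<in>UNIV. c k *\<^sub>R iter_bracket X (\<beta> k) x)"
proof -
  let ?Y = "\<lambda>k. iter_bracket X (\<beta> k) x"
  have inj: "inj ?Y" and sp: "span (range ?Y) = UNIV"
    using assms(1,2) unfolding bracket_basis_def by auto
  have "v \<in> range (\<lambda>u. \<Sum>w\<in>range ?Y. u w *\<^sub>R w)"
    using sp span_finite[of "range ?Y"] by auto
  then obtain u where "v = (\<Sum>w\<in>range ?Y. u w *\<^sub>R w)" by auto
  then show thesis using that[of "\<lambda>k. u (?Y k)"] by (simp add: sum.reindex[OF inj])
qed

text \<open>The passage opposite to freeness: the operator formula, applied to the identity map,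
  recovers every bracket as a vector, so a relation among the indeterminates descends to each
  point.\<close>

lemma nc_relation_imp_bracket_relation:
  fixes X :: "nat \<Rightarrow> 'a::euclidean_space \<Rightarrow> 'a"
  assumes "open S" "\<And>i. i \<le> n \<Longrightarrow> smooth_on (X i) S" "x \<in> S" "finite A"
    and "\<And>k. k \<in> A \<Longrightarrow> B k \<noteq> [] \<and> set (B k) \<subseteq> {0..n}"
    and "\<And>J. (\<Sum>k\<in>A. c k * nc_iter (B k) J) = 0"
  shows "(\<Sum>k\<in>A. c k *\<^sub>R iter_bracket X (B k) x) = 0"
proof -
  \<comment> \<open>One finite set of words for all k; \<open>nc_iter (B k)\<close> vanishes on the
    words of other length.\<close>
  define W where "W = (\<Union>k\<in>A. words_of_length n (length (B k)))"
  have "finite W" using assms(4) finite_words_of_length by (simp add: W_def)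
  have "iter_bracket X (B k) x = (\<Sum>J\<in>W. nc_iter (B k) J *\<^sub>R word_deriv X J (\<lambda>y. y) x)"
    if "k \<in> A" for k
  proof -
    have "iter_bracket X (B k) x =
      (\<Sum>J\<in>words_of_length n (length (B k)). nc_iter (B k) J *\<^sub>R word_deriv X J (\<lambda>y. y) x)"
      using lie_deriv_iter_bracket[where X = X and n = n and I = "B k",
          OF assms(1,2) _ _ smooth_on_ident assms(3)] assms(5)[OF that]
      unfolding lie_deriv_ident by blast
    also have "\<dots> = (\<Sum>J\<in>W. nc_iter (B k) J *\<^sub>R word_deriv X J (\<lambda>y. y) x)"
    proof (rule sum.mono_neutral_left[OF \<open>finite W\<close>])
      show "words_of_length n (length (B k)) \<subseteq> W" using that by (auto simp: W_def)
      have "nc_iter (B k) J = 0" if J: "J \<in> W - words_of_length n (length (B k))" for J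
      proof (rule ccontr)
        assume "nc_iter (B k) J \<noteq> 0"
        then have "mset J = mset (B k)" by (rule nc_iter_nonzero_mset)
        then have "length J = length (B k)" by (metis size_mset)
        then show False using J by (auto simp: W_def words_of_length_def)
      qed
      then show "\<forall>J\<in>W - words_of_length n (length (B k)).
          nc_iter (B k) J *\<^sub>R word_deriv X J (\<lambda>y. y) x = 0" by simp
    qed
    finally show ?thesis .
  qed
  then have "(\<Sum>k\<in>A. c k *\<^sub>R iter_bracket X (B k) x) =
      (\<Sum>k\<in>A. \<Sum>J\<in>W. (c k * nc_iter (B k) J) *\<^sub>R word_deriv X J (\<lambda>y. y) x)"
    by (simp add: scaleR_sum_right)
  also have "\<dots> = (\<Sum>J\<in>W. (\<Sum>k\<in>A. c k * nc_iter (B k) J) *\<^sub>R word_deriv X J (\<lambda>y. y) x)"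
    by (subst sum.swap) (simp add: scaleR_sum_left)
  finally show ?thesis by (simp add: assms(6))
qed

text \<open>Freeness speaks of a single family of coefficients over all multiindices. The family
  built here encodes \<open>g I\<close> minus a combination of basis terms, also when I itself
  belongs to the basis.\<close>

lemma sum_unit_minus_combination:
  fixes \<beta> :: "'p::finite \<Rightarrow> 'i" and g :: "'i \<Rightarrow> 'b::real_vector"
  assumes "finite M" "I \<in> M" "\<And>k. \<beta> k \<in> M"
  shows "(\<Sum>K\<in>M. ((if K = I then 1 else 0) - (\<Sum>k\<in>UNIV. if \<beta> k = K then c k else 0)) *\<^sub>R g K) =
    g I - (\<Sum>k\<in>UNIV. c k *\<^sub>R g (\<beta> k))"
proof -
  have "(\<Sum>K\<in>M. (if K = I then 1 else 0) *\<^sub>R g K) = (\<Sum>K\<in>M. if K = I then g K else 0)"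
    by (rule sum.cong) auto
  then have 1: "(\<Sum>K\<in>M. (if K = I then 1 else 0) *\<^sub>R g K) = g I"
    using assms(1,2) by simp
  have "(\<Sum>K\<in>M. (\<Sum>k\<in>UNIV. if \<beta> k = K then c k else 0) *\<^sub>R g K) =
      (\<Sum>k\<in>UNIV. \<Sum>K\<in>M. (if \<beta> k = K then c k else 0) *\<^sub>R g K)"
    unfolding scaleR_sum_left by (rule sum.swap)
  also have "\<dots> = (\<Sum>k\<in>UNIV. \<Sum>K\<in>M. if K = \<beta> k then c k *\<^sub>R g K else 0)"
    by (intro sum.cong refl) auto
  also have "\<dots> = (\<Sum>k\<in>UNIV. c k *\<^sub>R g (\<beta> k))" using assms(1,3) by simp
  finally show ?thesis by (simp add: scaleR_diff_left sum_subtractf 1)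
qed

text \<open>Freeness lifts a pointwise relation to the indeterminates, where it splits into its
  homogeneous parts; the part of each weight above that of \<open>I\<close> involves only the basis, hence is
  trivial.\<close>

lemma free_coeff_zero:
  fixes X :: "nat \<Rightarrow> real ^ 'p \<Rightarrow> real ^ 'p" and \<beta> :: "'p::finite \<Rightarrow> nat list"
  assumes "open \<Omega>" "\<And>i. i \<le> n \<Longrightarrow> smooth_on (X i) \<Omega>"
    and "free_up_to_weight n r \<Omega> X" "bracket_basis n r \<Omega> X \<beta>"
    and "x \<in> \<Omega>" "I \<in> multiindices n r"
    and eq: "iter_bracket X I x = (\<Sum>k\<in>UNIV. c k *\<^sub>R iter_bracket X (\<beta> k) x)"
    and "weight I < weight (\<beta> k)"
  shows "c k = 0"
proof -
  let ?M = "multiindices n r"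
  note fin = finite_multiindices[of n r]
  have \<beta>: "\<beta> k \<in> ?M" for k using assms(4) unfolding bracket_basis_def by auto
  define a where "a K = (if K = I then 1 else 0) - (\<Sum>k\<in>UNIV. if \<beta> k = K then c k else 0)" for K
  have expand: "(\<Sum>K\<in>?M. a K *\<^sub>R g K) = g I - (\<Sum>k\<in>UNIV. c k *\<^sub>R g (\<beta> k))" for g :: "nat list \<Rightarrow> real ^ 'p"
    unfolding a_def by (rule sum_unit_minus_combination[OF fin assms(6) \<beta>])
  have expand': "(\<Sum>K\<in>?M. a K *\<^sub>R g K) = g I - (\<Sum>k\<in>UNIV. c k *\<^sub>R g (\<beta> k))" for g :: "nat list \<Rightarrow> real"
    unfolding a_def by (rule sum_unit_minus_combination[OF fin assms(6) \<beta>])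
  have "(\<Sum>K\<in>?M. a K *\<^sub>R iter_bracket X K x) = 0"
    unfolding expand using eq by simp
  then have "(\<Sum>K\<in>?M. a K * nc_iter K J) = 0" for J
    using assms(3,5) unfolding free_up_to_weight_def by blast
  then have rel: "nc_iter I J = (\<Sum>k\<in>UNIV. c k * nc_iter (\<beta> k) J)" for J
    using expand'[of "\<lambda>K. nc_iter K J"] by simp
  \<comment> \<open>The part of the expansion strictly above the weight of I. A word heavier than I
    does not occur in \<open>nc_iter I\<close>, and a word that is not heavier does not occur in the
    retained basis terms, so this part is a relation by itself.\<close>
  define c' where "c' k = (if weight I < weight (\<beta> k) then c k else 0)" for k
  have w: "weight J = weight K" if "nc_iter K J \<noteq> 0" for J K
    using nc_iter_nonzero_mset[OF that] weight_mset_cong by blast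
  have "(\<Sum>k\<in>UNIV. c' k * nc_iter (\<beta> k) J) = 0" for J
  proof (cases "weight I < weight J")
    case True
    have "(\<Sum>k\<in>UNIV. c' k * nc_iter (\<beta> k) J) = (\<Sum>k\<in>UNIV. c k * nc_iter (\<beta> k) J)"
    proof (rule sum.cong[OF refl])
      fix k show "c' k * nc_iter (\<beta> k) J = c k * nc_iter (\<beta> k) J"
        using True w[of "\<beta> k" J] by (cases "nc_iter (\<beta> k) J = 0") (auto simp: c'_def)
    qed
    then show ?thesis using rel[of J] w[of I J] True by fastforce
  next
    case False
    have "c' k * nc_iter (\<beta> k) J = 0" for k
      using False w[of "\<beta> k" J] by (cases "nc_iter (\<beta> k) J = 0") (auto simp: c'_def)
    then show ?thesis by (intro sum.neutral ballI)
  qed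
  then have "(\<Sum>k\<in>UNIV. c' k *\<^sub>R iter_bracket X (\<beta> k) x) = 0"
    using \<beta> by (intro nc_relation_imp_bracket_relation[OF assms(1,2,5)]) (auto simp: multiindices_def)
  from bracket_basis_coeff_zero[OF assms(4,5) this, of k] show ?thesis
    using assms(8) by (simp add: c'_def)
qed

section \<open>Uniform bounds for coefficients on compact sets\<close>

lemma comb_field_scale: "comb_field X \<beta> (a *\<^sub>R u) x = a *\<^sub>R comb_field X \<beta> u x"
  by (simp add: comb_field_def scaleR_sum_right)

text \<open>On the product of K with the unit sphere the norm of the combination is continuous and,
  by independence, nowhere zero; its minimum is the constant, and homogeneity in c does the rest.
  Coefficients get bounded without asking how they depend on x.\<close>

lemma bracket_basis_uniform_lower_bound:
  fixes X :: "nat \<Rightarrow> real ^ 'p \<Rightarrow> real ^ 'p" and \<beta> :: "'p::finite \<Rightarrow> nat list"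
  assumes "bracket_basis n r \<Omega> X \<beta>" "compact K" "K \<subseteq> \<Omega>"
    and "\<And>k. continuous_on \<Omega> (iter_bracket X (\<beta> k))"
  obtains m where "0 < m" "\<And>x c. x \<in> K \<Longrightarrow> m * norm c \<le> norm (comb_field X \<beta> c x)"
proof (cases "K = {}")
  case True
  then show thesis using that[of 1] by simp
next
  case False
  let ?P = "K \<times> sphere (0 :: real ^ 'p) 1"
  let ?f = "\<lambda>(x, c). norm (comb_field X \<beta> c x)"
  have "continuous_on ?P ?f"
    unfolding comb_field_def split_def
    by (intro continuous_intros continuous_on_compose2[OF assms(4) continuous_on_fst])
      (use assms(3) in auto)
  moreover have "compact ?P" "?P \<noteq> {}" using assms(2) False by (auto intro: compact_Times)
  ultimately obtain z where z: "z \<in> ?P" "\<And>y. y \<in> ?P \<Longrightarrow> ?f z \<le> ?f y"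
    using continuous_attains_inf by metis
  obtain x0 c0 where z0: "z = (x0, c0)" by force
  have "0 < ?f z"
  proof (rule ccontr)
    assume "\<not> 0 < ?f z"
    then have "(\<Sum>k\<in>UNIV. (c0 $ k) *\<^sub>R iter_bracket X (\<beta> k) x0) = 0"
      by (simp add: z0 comb_field_def)
    then have "c0 $ k = 0" for k
      using bracket_basis_coeff_zero[OF assms(1), of x0 "\<lambda>k. c0 $ k"] z z0 assms(3) by auto
    then have "c0 = 0" by (simp add: vec_eq_iff)
    then show False using z z0 by auto
  qed
  moreover have "?f z * norm c \<le> norm (comb_field X \<beta> c x)" if "x \<in> K" for x c
  proof (cases "c = 0")
    case True
    then show ?thesis by simp
  next
    case False
    have "comb_field X \<beta> c x = norm c *\<^sub>R comb_field X \<beta> (c /\<^sub>R norm c) x"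
      using False by (simp flip: comb_field_scale)
    moreover have "?f z \<le> norm (comb_field X \<beta> (c /\<^sub>R norm c) x)"
      using z(2)[of "(x, c /\<^sub>R norm c)"] that False by simp
    ultimately show ?thesis by (simp add: mult.commute mult_left_mono)
  qed
  ultimately show thesis by (rule that)
qed

lemma bounded_coefficients:
  fixes X :: "nat \<Rightarrow> real ^ 'p \<Rightarrow> real ^ 'p" and \<beta> :: "'p::finite \<Rightarrow> nat list"
  assumes "bracket_basis n r \<Omega> X \<beta>" "compact K" "K \<subseteq> \<Omega>"
    and "\<And>k. continuous_on \<Omega> (iter_bracket X (\<beta> k))"
    and "finite A" "\<And>v. v \<in> A \<Longrightarrow> continuous_on \<Omega> v"
  obtains H where "0 < H"
    "\<And>v x c. v \<in> A \<Longrightarrow> x \<in> K \<Longrightarrow> v x = comb_field X \<beta> c x \<Longrightarrow> norm c \<le> H"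
proof -
  obtain m where m: "0 < m" "\<And>x c. x \<in> K \<Longrightarrow> m * norm c \<le> norm (comb_field X \<beta> c x)"
    using bracket_basis_uniform_lower_bound[OF assms(1-4)] by blast
  have "\<exists>b. \<forall>x\<in>K. norm (v x) \<le> b" if "v \<in> A" for v
  proof -
    have "bounded (v ` K)"
      using compact_continuous_image[OF continuous_on_subset[OF assms(6)[OF that] assms(3)] assms(2)]
      by (rule compact_imp_bounded)
    then show ?thesis unfolding bounded_iff by auto
  qed
  then obtain b where b: "\<And>v x. v \<in> A \<Longrightarrow> x \<in> K \<Longrightarrow> norm (v x) \<le> b v" by metis
  \<comment> \<open>The summand 1 ensures that H is positive.\<close>
  define H where "H = (1 + (\<Sum>v\<in>A. \<bar>b v\<bar>)) / m"
  show thesis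
  proof
    show "0 < H" using m(1) by (simp add: H_def add_pos_nonneg sum_nonneg)
    fix v x c assume v: "v \<in> A" "x \<in> K" "v x = comb_field X \<beta> c x"
    have "m * norm c \<le> b v" using m(2)[OF v(2), of c] b[OF v(1,2)] v(3) by simp
    also have "b v \<le> (\<Sum>v\<in>A. \<bar>b v\<bar>)"
      using member_le_sum[OF v(1), of "\<lambda>v. \<bar>b v\<bar>"] assms(5) by auto
    finally show "norm c \<le> H" using m(1) by (simp add: H_def field_simps)
  qed
qed

subsection \<open>Mean value inequalities and integral curves\<close>

lemma vector_derivative_bound:
  fixes f :: "real \<Rightarrow> 'a::real_normed_vector"
  assumes "convex S" "\<And>t. t \<in> S \<Longrightarrow> (f has_vector_derivative D t) (at t within S)"
    and "\<And>t. t \<in> S \<Longrightarrow> norm (D t) \<le> B" "s \<in> S" "t \<in> S"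
  shows "norm (f s - f t) \<le> B * \<bar>s - t\<bar>"
proof -
  have "norm (f s - f t) \<le> B * norm (s - t)"
  proof (rule differentiable_bound[OF assms(1) _ _ assms(4,5)])
    show "(f has_derivative (\<lambda>h. h *\<^sub>R D x)) (at x within S)" if "x \<in> S" for x
      using assms(2)[OF that] by (simp add: has_vector_derivative_def)
    show "onorm (\<lambda>h. h *\<^sub>R D x) \<le> B" if "x \<in> S" for x
    proof (rule onorm_le)
      fix h :: real
      show "norm (h *\<^sub>R D x) \<le> B * norm h"
        using mult_right_mono[OF assms(3)[OF that], of "\<bar>h\<bar>"] by (simp add: mult.commute)
    qed
  qed
  then show ?thesis by simp
qed

lemma smooth_on_lipschitz:
  fixes f :: "'a::euclidean_space \<Rightarrow> 'b::real_normed_vector"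
  assumes "smooth_on f S" "compact K" "convex K" "K \<subseteq> S"
  obtains L where "0 \<le> L" "\<And>x y. x \<in> K \<Longrightarrow> y \<in> K \<Longrightarrow> norm (f x - f y) \<le> L * norm (x - y)"
proof -
  have "\<exists>b. \<forall>x\<in>K. norm (frechet_derivative f (at x) i) \<le> b" for i
  proof -
    have "bounded ((\<lambda>x. frechet_derivative f (at x) i) ` K)"
      using compact_continuous_image[OF continuous_on_subset
          [OF smooth_on_continuous[OF smooth_on_frechet[OF assms(1)]] assms(4)] assms(2)]
      by (rule compact_imp_bounded)
    then show ?thesis unfolding bounded_iff by auto
  qed
  then obtain b where b: "\<And>i x. x \<in> K \<Longrightarrow> norm (frechet_derivative f (at x) i) \<le> b i" by metis
  define L where "L = (\<Sum>i\<in>Basis. \<bar>b i\<bar>)"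
  show thesis
  proof
    show "0 \<le> L" by (simp add: L_def sum_nonneg)
    fix x y assume xy: "x \<in> K" "y \<in> K"
    show "norm (f x - f y) \<le> L * norm (x - y)"
    proof (rule differentiable_bound[OF assms(3) _ _ xy])
      fix z assume z: "z \<in> K"
      have F: "(f has_derivative frechet_derivative f (at z)) (at z)"
        using smooth_on_has_derivative[OF assms(1)] z assms(4) by blast
      then show "(f has_derivative frechet_derivative f (at z)) (at z within K)"
        by (rule has_derivative_at_withinI)
      show "onorm (frechet_derivative f (at z)) \<le> L"
      proof (rule onorm_le)
        fix v :: 'a
        have "frechet_derivative f (at z) v = (\<Sum>i\<in>Basis. (v \<bullet> i) *\<^sub>R frechet_derivative f (at z) i)"
          using lie_deriv_basis[of f z "\<lambda>_. v"] F by (auto simp: lie_deriv_def differentiable_def)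
        then have "norm (frechet_derivative f (at z) v) \<le>
            (\<Sum>i\<in>Basis. \<bar>v \<bullet> i\<bar> * norm (frechet_derivative f (at z) i))"
          using norm_sum[of "\<lambda>i. (v \<bullet> i) *\<^sub>R frechet_derivative f (at z) i" Basis] by simp
        also have "\<dots> \<le> (\<Sum>i\<in>Basis. norm v * \<bar>b i\<bar>)"
          by (intro sum_mono mult_mono Basis_le_norm order_trans[OF b[OF z] abs_ge_self]) auto
        finally show "norm (frechet_derivative f (at z) v) \<le> L * norm v"
          by (simp add: L_def sum_distrib_left[symmetric] mult.commute)
      qed
    qed
  qed
qed

text \<open>Bootstrap principle: the weak bound on [0, t] gives the strict bound at t, so there is
  no first time at which some \<open>h i\<close> reaches b.\<close>

lemma continuous_induction:
  fixes h :: "'i \<Rightarrow> real \<Rightarrow> real"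
  assumes "finite A" "\<And>i. i \<in> A \<Longrightarrow> continuous_on {0..1} (h i)" "\<And>i. i \<in> A \<Longrightarrow> h i 0 < b"
    and step: "\<And>t i. 0 \<le> t \<Longrightarrow> t \<le> 1 \<Longrightarrow>
      (\<And>s j. 0 \<le> s \<Longrightarrow> s \<le> t \<Longrightarrow> j \<in> A \<Longrightarrow> h j s \<le> b) \<Longrightarrow> i \<in> A \<Longrightarrow> h i t < b"
    and "0 \<le> t" "t \<le> 1" "i \<in> A"
  shows "h i t < b"
proof (rule ccontr)
  assume "\<not> h i t < b"
  define C where "C = (\<Union>i\<in>A. {0..1} \<inter> h i -` {b..})"
  have "compact ({0..1} \<inter> h i -` {b..})" if "i \<in> A" for i
    using continuous_closedin_preimage[OF assms(2)[OF that], of "{b..}"]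
    by (metis closed_atLeast closedin_compact compact_Icc)
  then have "compact C" unfolding C_def using assms(1) by (intro compact_UN)
  moreover have "t \<in> {0..1} \<inter> h i -` {b..}" using \<open>\<not> h i t < b\<close> assms(5,6) by auto
  then have "t \<in> C" using \<open>i \<in> A\<close> unfolding C_def by blast
  ultimately obtain m where m: "m \<in> C" "\<And>s. s \<in> C \<Longrightarrow> m \<le> s"
    using compact_attains_inf[of C] by blast
  have m01: "0 \<le> m" "m \<le> 1" using m by (auto simp: C_def)
  have before: "h j s < b" if "0 \<le> s" "s < m" "j \<in> A" for s j
    using m(2)[of s] that m01 by (force simp: C_def)
  \<comment> \<open>At the first time itself the weak bound still holds: exceeding b would force an
    earlier crossing.\<close>
  have "h j m \<le> b" if j: "j \<in> A" for j
  proof (rule ccontr)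
    assume "\<not> h j m \<le> b"
    have "continuous_on {0..m} (h j)"
      using assms(2)[OF j] m01 by (auto intro: continuous_on_subset)
    then obtain s where s: "0 \<le> s" "s \<le> m" "h j s = b"
      using IVT'[of "h j" 0 b m] assms(3)[OF j] \<open>\<not> h j m \<le> b\<close> m01 by auto
    moreover have "s \<noteq> m" using s \<open>\<not> h j m \<le> b\<close> by auto
    ultimately show False using before[of s j] j by simp
  qed
  then have "h j m < b" if "j \<in> A" for j
    using before that by (intro step m01) (metis less_eq_real_def)
  then show False using m(1) by (force simp: C_def)
qed

section \<open>Uniqueness of integral curves\<close>

lemma integral_curve_continuous: "integral_curve \<Omega> Z \<eta> \<phi> \<Longrightarrow> continuous_on {0..1} \<phi>"
  unfolding integral_curve_def continuous_on_eq_continuous_within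
  using has_vector_derivative_continuous by blast

text \<open>The times of agreement form a closed and open subset of the unit interval. Openness is a
  contraction argument: on a short interval around t the largest distance between the curves is at
  most half of itself.\<close>

lemma integral_curve_unique:
  fixes Z :: "'a::euclidean_space \<Rightarrow> 'a"
  assumes "open \<Omega>" "smooth_on Z \<Omega>" "integral_curve \<Omega> Z \<eta> \<phi>" "integral_curve \<Omega> Z \<eta> \<psi>"
    and "t \<in> {0..1}"
  shows "\<phi> t = \<psi> t"
proof -
  let ?S = "{0..1::real}"
  define E where "E = {t \<in> ?S. \<phi> t - \<psi> t = 0}"
  have cont: "continuous_on ?S \<phi>" "continuous_on ?S \<psi>"
    using assms(3,4) integral_curve_continuous by blast+
  have der: "(\<phi> has_vector_derivative Z (\<phi> s)) (at s within ?S)"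
    "(\<psi> has_vector_derivative Z (\<psi> s)) (at s within ?S)" if "s \<in> ?S" for s
    using assms(3,4) that unfolding integral_curve_def by blast+
  have clo: "closedin (top_of_set ?S) E"
    unfolding E_def by (intro continuous_closedin_preimage_constant continuous_on_diff cont)
  have "\<exists>e>0. \<forall>t'\<in>?S. dist t' t < e \<longrightarrow> t' \<in> E" if "t \<in> E" for t
  proof -
    have t: "t \<in> ?S" "\<phi> t = \<psi> t" using that by (auto simp: E_def)
    have "\<phi> t \<in> \<Omega>" using assms(3) t unfolding integral_curve_def by blast
    then obtain d where d: "0 < d" "cball (\<phi> t) d \<subseteq> \<Omega>"
      using assms(1) open_contains_cball by blast
    obtain L where L: "0 \<le> L"
      "\<And>x y. x \<in> cball (\<phi> t) d \<Longrightarrow> y \<in> cball (\<phi> t) d \<Longrightarrow> norm (Z x - Z y) \<le> L * norm (x - y)"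
      using smooth_on_lipschitz[OF assms(2) compact_cball convex_cball d(2)] by blast
    obtain e1 where e1: "0 < e1" "\<And>s. s \<in> ?S \<Longrightarrow> dist s t < e1 \<Longrightarrow> dist (\<phi> s) (\<phi> t) < d"
      using cont(1) t(1) d(1) unfolding continuous_on_iff by blast
    obtain e2 where e2: "0 < e2" "\<And>s. s \<in> ?S \<Longrightarrow> dist s t < e2 \<Longrightarrow> dist (\<psi> s) (\<psi> t) < d"
      using cont(2) t(1) d(1) unfolding continuous_on_iff by blast
    \<comment> \<open>Both curves stay in the ball where Z has Lipschitz constant L, and L times the
      length of the interval is at most 1/2.\<close>
    define e where "e = min (min e1 e2) (1 / (2 * (L + 1)))"
    have "0 < e" using e1 e2 L by (simp add: e_def)
    moreover have "t' \<in> E" if t': "t' \<in> ?S" "dist t' t < e" for t'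
    proof -
      define J where "J = ?S \<inter> cball t \<bar>t' - t\<bar>"
      have J: "compact J" "convex J" "t \<in> J" "t' \<in> J" "J \<subseteq> ?S"
      proof -
        show "compact J" unfolding J_def by (intro compact_Int compact_Icc compact_cball)
        show "convex J" unfolding J_def by (intro convex_Int convex_real_interval convex_cball)
      qed (use t t' in \<open>auto simp: J_def dist_real_def\<close>)
      have Je: "dist s t < e" if "s \<in> J" for s
        using that t' by (auto simp: J_def dist_real_def)
      have "continuous_on J (\<lambda>s. norm (\<phi> s - \<psi> s))"
        by (intro continuous_intros continuous_on_subset[OF cont(1) J(5)] continuous_on_subset[OF cont(2) J(5)])
      then obtain s where s: "s \<in> J" "\<And>s'. s' \<in> J \<Longrightarrow> norm (\<phi> s' - \<psi> s') \<le> norm (\<phi> s - \<psi> s)"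
        using continuous_attains_sup[OF J(1)] J(3) by blast
      let ?m = "norm (\<phi> s - \<psi> s)"
      have "norm ((\<phi> s - \<psi> s) - (\<phi> t - \<psi> t)) \<le> (L * ?m) * \<bar>s - t\<bar>"
      proof (rule vector_derivative_bound[OF J(2) _ _ s(1) J(3)])
        fix s' assume s': "s' \<in> J"
        show "((\<lambda>s. \<phi> s - \<psi> s) has_vector_derivative (Z (\<phi> s') - Z (\<psi> s'))) (at s' within J)"
          using s' J(5)
          by (intro has_vector_derivative_diff has_vector_derivative_within_subset[OF _ J(5)] der) auto
        have "\<phi> s' \<in> cball (\<phi> t) d" "\<psi> s' \<in> cball (\<phi> t) d"
          using e1(2)[of s'] e2(2)[of s'] Je[OF s'] s' J(5) t(2)
          by (auto simp: e_def dist_commute intro: less_imp_le)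
        then have "norm (Z (\<phi> s') - Z (\<psi> s')) \<le> L * norm (\<phi> s' - \<psi> s')" by (rule L(2))
        also have "\<dots> \<le> L * ?m" using s(2)[OF s'] L(1) by (rule mult_left_mono)
        finally show "norm (Z (\<phi> s') - Z (\<psi> s')) \<le> L * ?m" .
      qed
      then have "?m \<le> ?m * (L * \<bar>s - t\<bar>)" using t(2) by (simp add: mult.commute mult.left_commute)
      moreover have "L * \<bar>s - t\<bar> \<le> 1 / 2"
      proof -
        have "\<bar>s - t\<bar> \<le> 1 / (2 * (L + 1))" using Je[OF s(1)] by (simp add: e_def dist_real_def)
        then have "L * \<bar>s - t\<bar> \<le> L * (1 / (2 * (L + 1)))" using L(1) by (rule mult_left_mono)
        also have "\<dots> \<le> 1 / 2" using L(1) by (simp add: field_simps)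
        finally show ?thesis .
      qed
      ultimately have "?m \<le> ?m * (1 / 2)"
        using mult_left_mono[of "L * \<bar>s - t\<bar>" "1 / 2" ?m] by linarith
      then have "?m = 0" using norm_ge_zero[of "\<phi> s - \<psi> s"] by linarith
      then have "norm (\<phi> t' - \<psi> t') \<le> 0" using s(2)[OF J(4)] by simp
      then show "t' \<in> E" using t'(1) by (simp add: E_def)
    qed
    ultimately show ?thesis by blast
  qed
  then have ope: "openin (top_of_set ?S) E"
    unfolding openin_euclidean_subtopology_iff by (auto simp: E_def)
  have "0 \<in> E" using assms(3,4) by (simp add: E_def integral_curve_def)
  moreover have "E = {} \<or> E = ?S"
    by (rule iffD1[OF connected_clopen connected_Icc, rule_format]) (intro conjI ope clo)
  ultimately have "t \<in> E" using assms(5) by blast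
  then show ?thesis by (simp add: E_def)
qed

lemma exp_field_eq:
  fixes Z :: "'a::euclidean_space \<Rightarrow> 'a"
  assumes "open \<Omega>" "smooth_on Z \<Omega>" "integral_curve \<Omega> Z \<eta> \<phi>"
  shows "exp_field \<Omega> Z \<eta> = \<phi> 1"
  unfolding exp_field_def
proof (rule the_equality)
  show "\<exists>\<psi>. integral_curve \<Omega> Z \<eta> \<psi> \<and> \<psi> 1 = \<phi> 1" using assms(3) by blast
  show "\<xi> = \<phi> 1" if "\<exists>\<psi>. integral_curve \<Omega> Z \<eta> \<psi> \<and> \<psi> 1 = \<xi>" for \<xi>
    using that integral_curve_unique[OF assms, of _ 1] by force
qed

subsection \<open>Absolutely continuous functions\<close>

text \<open>The clause of absolute continuity for one fixed pair of tolerances, split off so that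
  the families of intervals can be handled apart from the outer quantifiers.\<close>

definition small_variation :: "real \<Rightarrow> real \<Rightarrow> (real \<Rightarrow> 'a::real_normed_vector) \<Rightarrow> real \<Rightarrow> real \<Rightarrow> bool" where
  "small_variation a b f \<delta> e \<longleftrightarrow> (\<forall>P. finite P \<and> (\<forall>(s, t)\<in>P. a \<le> s \<and> s \<le> t \<and> t \<le> b) \<and>
     disjoint_family_on (\<lambda>(s, t). {s<..<t}) P \<and> (\<Sum>(s, t)\<in>P. t - s) < \<delta> \<longrightarrow>
     (\<Sum>(s, t)\<in>P. norm (f t - f s)) < e)"

lemma abs_continuous_iff_small_variation:
  "abs_continuous_on_interval a b f \<longleftrightarrow> (\<forall>e>0. \<exists>\<delta>>0. small_variation a b f \<delta> e)"
  unfolding abs_continuous_on_interval_def small_variation_def by (rule refl)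

lemma small_variationD:
  "small_variation a b f \<delta> e \<Longrightarrow> finite P \<Longrightarrow> \<forall>(s, t)\<in>P. a \<le> s \<and> s \<le> t \<and> t \<le> b \<Longrightarrow>
    disjoint_family_on (\<lambda>(s, t). {s<..<t}) P \<Longrightarrow> (\<Sum>(s, t)\<in>P. t - s) < \<delta> \<Longrightarrow>
    (\<Sum>(s, t)\<in>P. norm (f t - f s)) < e"
  unfolding small_variation_def by blast

lemma small_variationI:
  assumes "\<And>P. finite P \<Longrightarrow> \<forall>(s, t)\<in>P. a \<le> s \<and> s \<le> t \<and> t \<le> b \<Longrightarrow>
    disjoint_family_on (\<lambda>(s, t). {s<..<t}) P \<Longrightarrow> (\<Sum>(s, t)\<in>P. t - s) < \<delta> \<Longrightarrow>
    (\<Sum>(s, t)\<in>P. norm (f t - f s)) < e"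
  shows "small_variation a b f \<delta> e"
  unfolding small_variation_def by (intro allI impI assms) auto

lemma abs_continuous_ident: "abs_continuous_on_interval a b (\<lambda>t::real. t)"
  unfolding abs_continuous_iff_small_variation
proof (intro allI impI)
  fix e :: real assume "0 < e"
  have "(\<Sum>(s, t)\<in>P. norm (t - s)) < e"
    if "\<forall>(s, t)\<in>P. a \<le> s \<and> s \<le> t \<and> t \<le> b" "(\<Sum>(s, t)\<in>P. t - s) < e" for P :: "(real \<times> real) set"
  proof -
    have "(\<Sum>(s, t)\<in>P. norm (t - s)) = (\<Sum>(s, t)\<in>P. t - s)"
      using that(1) by (intro sum.cong refl) auto
    then show ?thesis using that(2) by simp
  qed
  then have "small_variation a b (\<lambda>t. t) e e" by (rule small_variationI)
  then show "\<exists>\<delta>>0. small_variation a b (\<lambda>t::real. t) \<delta> e" using \<open>0 < e\<close> by blast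
qed

text \<open>Only increments are compared, so g need not be a function of the values of f. With the
  identity as f this covers Lipschitz curves; with a curve as f, its coordinates in a chart.\<close>

lemma abs_continuous_compose_lipschitz:
  assumes "abs_continuous_on_interval a b f" "0 \<le> L"
    and "\<And>s t. s \<in> {a..b} \<Longrightarrow> t \<in> {a..b} \<Longrightarrow> norm (g t - g s) \<le> L * norm (f t - f s)"
  shows "abs_continuous_on_interval a b g"
  unfolding abs_continuous_iff_small_variation
proof (intro allI impI)
  fix e :: real assume "0 < e"
  then have "0 < e / (L + 1)" using assms(2) by simp
  then obtain \<delta> where \<delta>: "0 < \<delta>" "small_variation a b f \<delta> (e / (L + 1))"
      using assms(1) unfolding abs_continuous_iff_small_variation by blast
  have "(\<Sum>(s, t)\<in>P. norm (g t - g s)) < e"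
    if P: "finite P" "\<forall>(s, t)\<in>P. a \<le> s \<and> s \<le> t \<and> t \<le> b"
      "disjoint_family_on (\<lambda>(s, t). {s<..<t}) P" "(\<Sum>(s, t)\<in>P. t - s) < \<delta>" for P
  proof -
    have "(\<Sum>(s, t)\<in>P. norm (g t - g s)) \<le> (\<Sum>(s, t)\<in>P. (L + 1) * norm (f t - f s))"
    proof (rule sum_mono, clarify)
      fix s t assume "(s, t) \<in> P"
      then have st: "a \<le> s" "s \<le> t" "t \<le> b" using P by auto
      have "norm (g t - g s) \<le> L * norm (f t - f s)" using st by (intro assms(3)) auto
      also have "\<dots> \<le> (L + 1) * norm (f t - f s)" by (intro mult_right_mono) auto
      finally show "norm (g t - g s) \<le> (L + 1) * norm (f t - f s)" .
    qed
    also have "\<dots> = (L + 1) * (\<Sum>(s, t)\<in>P. norm (f t - f s))"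
      by (simp add: sum_distrib_left split_def)
    also have "\<dots> < (L + 1) * (e / (L + 1))"
      using small_variationD[OF \<delta>(2) P] assms(2) by (intro mult_strict_left_mono) auto
    also have "\<dots> = e" using assms(2) by simp
    finally show ?thesis .
  qed
  then have "small_variation a b g \<delta> e" by (rule small_variationI)
  then show "\<exists>\<delta>>0. small_variation a b g \<delta> e" using \<delta>(1) by blast
qed

lemma abs_continuous_subinterval:
  assumes "abs_continuous_on_interval a b f" "a \<le> a'" "b' \<le> b"
  shows "abs_continuous_on_interval a' b' f"
  unfolding abs_continuous_iff_small_variation
proof (intro allI impI)
  fix e :: real assume "0 < e"
  then obtain \<delta> where \<delta>: "0 < \<delta>" "small_variation a b f \<delta> (e)"
      using assms(1) unfolding abs_continuous_iff_small_variation by blast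
  have "(\<Sum>(s, t)\<in>P. norm (f t - f s)) < e"
    if P: "finite P" "\<forall>(s, t)\<in>P. a' \<le> s \<and> s \<le> t \<and> t \<le> b'"
      "disjoint_family_on (\<lambda>(s, t). {s<..<t}) P" "(\<Sum>(s, t)\<in>P. t - s) < \<delta>" for P
    by (rule small_variationD[OF \<delta>(2) P(1) _ P(3,4)]) (use P(2) assms(2,3) in fastforce)
  then have "small_variation a' b' f \<delta> e" by (rule small_variationI)
  then show "\<exists>\<delta>>0. small_variation a' b' f \<delta> e" using \<delta>(1) by blast
qed

lemma abs_continuous_imp_continuous:
  assumes "abs_continuous_on_interval a b f"
  shows "continuous_on {a..b} f"
  unfolding continuous_on_iff
proof (intro ballI allI impI)
  fix t e :: real assume t: "t \<in> {a..b}" and "0 < e"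
  then obtain \<delta> where \<delta>: "0 < \<delta>" "small_variation a b f \<delta> (e)"
      using assms(1) unfolding abs_continuous_iff_small_variation by blast
  have "dist (f s) (f t) < e" if s: "s \<in> {a..b}" "dist s t < \<delta>" for s
  proof -
    have "norm (f (max s t) - f (min s t)) < e"
      using small_variationD[OF \<delta>(2), of "{(min s t, max s t)}"] s t
      by (auto simp: disjoint_family_on_def dist_real_def)
    then show ?thesis by (cases "s \<le> t") (auto simp: dist_norm norm_minus_commute)
  qed
  with \<delta>(1) show "\<exists>d>0. \<forall>s\<in>{a..b}. dist s t < d \<longrightarrow> dist (f s) (f t) < e" by blast
qed

text \<open>Off the null set \<open>N\<close> the derivative controls the increments over small tagged intervals; the
  intervals of a fine division tagged in \<open>N\<close> lie in an open set of small measure, where absolute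
  continuity applies.\<close>

lemma abs_continuous_mean_value:
  fixes f :: "real \<Rightarrow> 'a::real_normed_vector"
  assumes ac: "abs_continuous_on_interval a b f" and "a \<le> b" "0 \<le> B" "negligible N"
    and der: "\<And>t. t \<in> {a..b} - N \<Longrightarrow> \<exists>D. (f has_vector_derivative D) (at t within {a..b}) \<and> norm D \<le> B"
  shows "norm (f b - f a) \<le> B * (b - a)"
proof -
  have main: "norm (f b - f a) \<le> (B + e) * (b - a) + e" if "0 < e" for e
  proof -
    obtain \<delta> where \<delta>: "0 < \<delta>" "small_variation a b f \<delta> (e)"
      using ac \<open>0 < e\<close> unfolding abs_continuous_iff_small_variation by blast
    \<comment> \<open>Outer regularity: an open set around the null set, small enough for absolute
      continuity with tolerance e.\<close>
    obtain T where T: "open T" "N \<subseteq> T" "T - N \<in> lmeasurable" "emeasure lebesgue (T - N) < ennreal \<delta>"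
      using sets_lebesgue_outer_open[OF negligible_imp_sets[OF assms(4)] \<delta>(1)] by blast
    have "T = (T - N) \<union> N" using T(2) by blast
    then have Tm: "T \<in> lmeasurable"
      using fmeasurable.Un[OF T(3) negligible_imp_measurable[OF assms(4)]] by simp
    have "measure lebesgue T \<le> measure lebesgue (T - N) + measure lebesgue N"
      using measure_Un_le[of "T - N" lebesgue N] \<open>T = (T - N) \<union> N\<close> T(3) negligible_imp_sets[OF assms(4)]
      by (simp add: fmeasurableD)
    also have "\<dots> < \<delta>"
      using T(3,4) \<delta>(1) negligible_imp_measure0[OF assms(4)]
      by (simp add: emeasure_eq_measure2 ennreal_less_iff)
    finally have Td: "measure lebesgue T < \<delta>" .
    have "\<exists>d>0. \<forall>y\<in>{a..b}. \<bar>y - t\<bar> < d \<longrightarrow> norm (f y - f t) \<le> (B + e) * \<bar>y - t\<bar>"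
      if t: "t \<in> {a..b} - N" for t
    proof -
      obtain D where D: "(f has_vector_derivative D) (at t within {a..b})" "norm D \<le> B"
        using der[OF t] by blast
      then obtain d where d: "0 < d" "\<And>y. y \<in> {a..b} \<Longrightarrow> norm (y - t) < d \<Longrightarrow>
          norm (f y - f t - (y - t) *\<^sub>R D) \<le> e * norm (y - t)"
        using \<open>0 < e\<close> unfolding has_vector_derivative_def has_derivative_within_alt by blast
      have "norm (f y - f t) \<le> (B + e) * \<bar>y - t\<bar>" if y: "y \<in> {a..b}" "\<bar>y - t\<bar> < d" for y
      proof -
        have "norm (f y - f t) \<le> norm (f y - f t - (y - t) *\<^sub>R D) + norm ((y - t) *\<^sub>R D)"
          using norm_triangle_ineq[of "f y - f t - (y - t) *\<^sub>R D" "(y - t) *\<^sub>R D"] by simp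
        also have "\<dots> \<le> e * \<bar>y - t\<bar> + \<bar>y - t\<bar> * B"
          using d(2)[OF y(1)] y(2) mult_left_mono[OF D(2), of "\<bar>y - t\<bar>"] by (intro add_mono) auto
        finally show ?thesis by (simp add: algebra_simps)
      qed
      then show ?thesis using d(1) by blast
    qed
    then obtain d where d: "\<And>t. t \<in> {a..b} - N \<Longrightarrow> 0 < d t"
      "\<And>t y. t \<in> {a..b} - N \<Longrightarrow> y \<in> {a..b} \<Longrightarrow> \<bar>y - t\<bar> < d t \<Longrightarrow> norm (f y - f t) \<le> (B + e) * \<bar>y - t\<bar>"
      by metis
    \<comment> \<open>Intervals tagged in N are confined to T, those with other tags to balls in
      which the derivative governs the increments. Tags never lie outside [a, b].\<close>
    define \<gamma> where "\<gamma> t = (if t \<in> N then T else if t \<in> {a..b} then ball t (d t) else UNIV)" for t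
    have "gauge \<gamma>" unfolding gauge_def \<gamma>_def using T d(1) by auto
    then obtain p where p: "p tagged_division_of {a..b}" "\<gamma> fine p"
      using fine_division_exists_real by blast
    have fin: "finite p" using p(1) by blast
    have intv: "\<exists>u v. k = {u..v} \<and> u \<le> t \<and> t \<le> v \<and> a \<le> u \<and> v \<le> b" if tk: "(t, k) \<in> p" for t k
    proof -
      have "t \<in> k" "k \<subseteq> {a..b}" using tagged_division_ofD(2,3)[OF p(1) tk] by auto
      moreover obtain u v where "k = cbox u v" using tagged_division_ofD(4)[OF p(1) tk] by blast
      ultimately show ?thesis by (intro exI[of _ u] exI[of _ v]) auto
    qed
    let ?F = "\<lambda>k. f (Sup k) - f (Inf k)"
    define p1 where "p1 = {z \<in> p. fst z \<notin> N}"
    \<comment> \<open>Degenerate intervals contribute nothing and are dropped. Absolute continuity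
      is stated for a set of endpoint pairs, and distinct tagged intervals are sure to give distinct
      pairs once their interiors are nonempty.\<close>
    define p2 where "p2 = {z \<in> p. fst z \<in> N \<and> Inf (snd z) < Sup (snd z)}"
    have fin12: "finite p1" "finite p2" using fin by (auto simp: p1_def p2_def)
    have "f b - f a = (\<Sum>(t, k)\<in>p. ?F k)"
      using additive_tagged_division_1[OF assms(2) p(1), of f] by simp
    also have "\<dots> = (\<Sum>(t, k)\<in>p1 \<union> p2. ?F k)"
    proof (rule sum.mono_neutral_right[OF fin])
      show "\<forall>z\<in>p - (p1 \<union> p2). (case z of (t, k) \<Rightarrow> ?F k) = 0"
      proof
        fix z assume z: "z \<in> p - (p1 \<union> p2)"
        obtain t k where zk: "z = (t, k)" by (cases z)
        with z have tk: "(t, k) \<in> p" "(t, k) \<notin> p1" "(t, k) \<notin> p2" by auto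
        obtain u v where uv: "k = {u..v}" "u \<le> t" "t \<le> v" using intv[OF tk(1)] by blast
        then have "\<not> u < v" using tk by (auto simp: p1_def p2_def)
        then have "u = v" using uv by linarith
        then show "(case z of (t, k) \<Rightarrow> ?F k) = 0" using uv zk by simp
      qed
    qed (auto simp: p1_def p2_def)
    also have "\<dots> = (\<Sum>(t, k)\<in>p1. ?F k) + (\<Sum>(t, k)\<in>p2. ?F k)"
      by (rule sum.union_disjoint[OF fin12]) (auto simp: p1_def p2_def)
    finally have split: "f b - f a = \<dots>" .
    have b1: "norm (\<Sum>(t, k)\<in>p1. ?F k) \<le> (B + e) * (b - a)"
    proof -
      have "norm (\<Sum>(t, k)\<in>p1. ?F k) \<le> (\<Sum>(t, k)\<in>p1. (B + e) * measure lborel k)"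
      proof (rule sum_norm_le, clarify)
        fix t k assume "(t, k) \<in> p1"
        then have tk: "(t, k) \<in> p" "t \<notin> N" by (auto simp: p1_def)
        obtain u v where uv: "k = {u..v}" "u \<le> t" "t \<le> v" "a \<le> u" "v \<le> b"
          using intv[OF tk(1)] by blast
        have t: "t \<in> {a..b} - N" using uv tk by auto
        have "k \<subseteq> \<gamma> t" using fineD[OF p(2) tk(1)] .
        then have "{u..v} \<subseteq> ball t (d t)" using t uv(1) by (auto simp: \<gamma>_def)
        moreover have "u \<in> {u..v}" "v \<in> {u..v}" using uv by auto
        ultimately have "u \<in> ball t (d t)" "v \<in> ball t (d t)" by blast+
        then have "\<bar>u - t\<bar> < d t" "\<bar>v - t\<bar> < d t"
          by (auto simp: dist_real_def)
        then have "norm (f u - f t) \<le> (B + e) * (t - u)" "norm (f v - f t) \<le> (B + e) * (v - t)"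
          using d(2)[OF t, of u] d(2)[OF t, of v] uv by auto
        then have "norm (f v - f u) \<le> (B + e) * (v - t) + (B + e) * (t - u)"
          using norm_triangle_ineq4[of "f v - f t" "f u - f t"] by simp
        also have "\<dots> = (B + e) * measure lborel k" using uv by (simp add: algebra_simps)
        finally show "norm (?F k) \<le> (B + e) * measure lborel k" using uv by simp
      qed
      also have "\<dots> \<le> (\<Sum>(t, k)\<in>p. (B + e) * measure lborel k)"
        by (rule sum_mono2[OF fin]) (use assms(3) \<open>0 < e\<close> in \<open>auto simp: p1_def\<close>)
      also have "\<dots> = (B + e) * (\<Sum>(t, k)\<in>p. measure lborel k)" by (simp add: sum_distrib_left split_def)
      also have "(\<Sum>(t, k)\<in>p. measure lborel k) = b - a"
        using additive_content_tagged_division[of p a b] p(1) assms(2) by simp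
      finally show ?thesis .
    qed
    have b2: "norm (\<Sum>(t, k)\<in>p2. ?F k) \<le> e"
    proof -
      define g where "g z = (Inf (snd z), Sup (snd z))" for z :: "real \<times> real set"
      let ?I = "\<lambda>(s, t). {s<..<t::real}"
      have int: "?I (g z) = interior (snd z)" if "z \<in> p" for z
        using intv[of "fst z" "snd z"] that by (auto simp: g_def interior_atLeastAtMost_real)
      have ne: "?I (g z) \<noteq> {}" if "z \<in> p2" for z
        using that by (auto simp: g_def p2_def)
      have dis: "?I (g z) \<inter> ?I (g z') = {}" if "z \<in> p2" "z' \<in> p2" "z \<noteq> z'" for z z'
      proof -
        have zp: "z \<in> p" "z' \<in> p" using that by (auto simp: p2_def)
        then show ?thesis
          unfolding int[OF zp(1)] int[OF zp(2)]
          using tagged_division_ofD(5)[OF p(1), of "fst z" "snd z" "fst z'" "snd z'"] that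
          by (auto simp: prod_eq_iff)
      qed
      have inj: "inj_on g p2"
      proof (rule inj_onI, rule ccontr)
        fix z z' assume "z \<in> p2" "z' \<in> p2" "g z = g z'" "z \<noteq> z'"
        then show False using dis[of z z'] ne[of z] by simp
      qed
      have disj: "disjoint_family_on ?I (g ` p2)"
        unfolding disjoint_family_on_def
      proof (intro ballI impI)
        fix y y' assume "y \<in> g ` p2" "y' \<in> g ` p2" "y \<noteq> y'"
        then obtain z z' where "z \<in> p2" "z' \<in> p2" "z \<noteq> z'" "y = g z" "y' = g z'" by blast
        then show "?I y \<inter> ?I y' = {}" using dis by simp
      qed
      have "(\<Sum>(s, t)\<in>g ` p2. t - s) = (\<Sum>z\<in>g ` p2. measure lebesgue (?I z))"
      proof (rule sum.cong[OF refl])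
        fix z assume "z \<in> g ` p2"
        then have "fst z < snd z" by (auto simp: g_def p2_def)
        then show "(case z of (s, t) \<Rightarrow> t - s) = measure lebesgue (?I z)"
          by (cases z) simp
      qed
      also have "\<dots> = measure lebesgue (\<Union>z\<in>g ` p2. ?I z)"
      proof (rule measure_finite_Union[symmetric, OF _ _ disj])
        show "finite (g ` p2)" using fin12 by simp
        show "?I ` g ` p2 \<subseteq> sets lebesgue" by auto
        show "emeasure lebesgue (?I z) \<noteq> \<infinity>" if "z \<in> g ` p2" for z
          using fmeasurableD2[of "?I z" lebesgue] by (cases z) simp
      qed
      also have "\<dots> \<le> measure lebesgue T"
      proof (rule measure_mono_fmeasurable[OF _ _ Tm])
        have "?I (g z) \<subseteq> T" if "z \<in> p2" for z
        proof -
          have zp: "z \<in> p" "fst z \<in> N" using that by (auto simp: p2_def)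
          have "snd z \<subseteq> \<gamma> (fst z)" using fineD[OF p(2), of "fst z" "snd z"] zp by simp
          then show ?thesis unfolding int[OF zp(1)]
            using zp(2) interior_subset[of "snd z"] by (auto simp: \<gamma>_def)
        qed
        then show "(\<Union>z\<in>g ` p2. ?I z) \<subseteq> T"
          unfolding image_image by (rule UN_least)
        have "open (?I z)" for z by (cases z) simp
        then have "open (\<Union>z\<in>g ` p2. ?I z)" by (intro open_UN ballI)
        then show "(\<Union>z\<in>g ` p2. ?I z) \<in> sets lebesgue"
          by (simp add: sets_completionI_sets)
      qed
      also have "\<dots> < \<delta>" by (rule Td)
      finally have len: "(\<Sum>(s, t)\<in>g ` p2. t - s) < \<delta>" .
      have "norm (\<Sum>(t, k)\<in>p2. ?F k) \<le> (\<Sum>(t, k)\<in>p2. norm (?F k))"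
        using norm_sum[of "\<lambda>z. ?F (snd z)" p2] by (simp add: split_def)
      also have "\<dots> = (\<Sum>(s, t)\<in>g ` p2. norm (f t - f s))"
        by (subst sum.reindex[OF inj]) (simp add: split_def g_def)
      also have "\<dots> < e"
      proof (rule small_variationD[OF \<delta>(2) _ _ disj len])
        show "finite (g ` p2)" using fin12 by simp
        have "a \<le> fst (g z) \<and> fst (g z) \<le> snd (g z) \<and> snd (g z) \<le> b" if "z \<in> p2" for z
        proof -
          have "(fst z, snd z) \<in> p" using that by (simp add: p2_def)
          from intv[OF this] obtain u v where
            "snd z = {u..v}" "u \<le> fst z" "fst z \<le> v" "a \<le> u" "v \<le> b" by blast
          then show ?thesis by (simp add: g_def)
        qed
        then show "\<forall>(s, t)\<in>g ` p2. a \<le> s \<and> s \<le> t \<and> t \<le> b" by (auto simp: split_def)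
      qed
      finally show ?thesis by simp
    qed
    show ?thesis unfolding split
      using norm_triangle_ineq[of "\<Sum>(t, k)\<in>p1. ?F k" "\<Sum>(t, k)\<in>p2. ?F k"] b1 b2 by linarith
  qed
  have "norm (f b - f a) \<le> B * (b - a) + e" if "0 < e" for e
  proof -
    \<comment> \<open>This tolerance absorbs both error terms, the one proportional to b - a and the
      constant one.\<close>
    have "0 < e / (b - a + 1)" using that assms(2) by simp
    from main[OF this] have "norm (f b - f a) \<le> B * (b - a) + (e / (b - a + 1)) * (b - a + 1)"
      by (simp only: distrib_left distrib_right mult_1_right)
    then show ?thesis using assms(2) by simp
  qed
  then show ?thesis by (rule field_le_epsilon)
qed

subsection \<open>Canonical coordinates\<close>

text \<open>The coordinate lies in a box of size \<mu>, while the scales are powers of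
  \<open>M * \<mu>\<close>. Enlarging \<open>\<mu> ^ k\<close> to \<open>(M * \<mu>) ^ k\<close>
  costs at least a factor M because k is at least 1, and that factor is the gain.\<close>

lemma scaled_power_le:
  fixes \<mu> M :: real
  assumes "0 < \<mu>" "1 \<le> M" "M * \<mu> \<le> 1" "l \<le> j + k" "1 \<le> k"
  shows "\<mu> ^ k * (M * \<mu>) ^ j / (M * \<mu>) ^ l \<le> 1 / M"
proof -
  have "M * (\<mu> ^ k * (M * \<mu>) ^ j) \<le> M ^ k * (\<mu> ^ k * (M * \<mu>) ^ j)"
    using assms self_le_power[of M k] by (intro mult_right_mono) auto
  also have "\<dots> = (M * \<mu>) ^ (j + k)" by (simp add: power_add power_mult_distrib)
  also have "\<dots> \<le> (M * \<mu>) ^ l" using assms by (intro power_decreasing) auto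
  finally show ?thesis using assms by (simp add: field_simps)
qed

text \<open>\<open>\<theta>\<close> is the chart given by canonical coordinates of the first kind at \<open>\<xi>\<close> for the frame \<open>Y\<close>, and
  \<open>\<phi> \<zeta>\<close> is the ray from \<open>\<xi>\<close> to \<open>\<zeta>\<close>.\<close>

locale canonical_coordinates =
  fixes Y :: "'p::finite \<Rightarrow> real ^ 'p \<Rightarrow> real ^ 'p" and G :: "(real ^ 'p) set"
    and \<theta> :: "real ^ 'p \<Rightarrow> real ^ 'p" and \<xi> :: "real ^ 'p" and e :: real
    and \<phi> :: "real ^ 'p \<Rightarrow> real \<Rightarrow> real ^ 'p"
  assumes open_G: "open G" and smooth_Y: "\<And>k. smooth_on (Y k) G" and smooth_\<theta>: "smooth_on \<theta> G"
    and e: "0 < e" "ball 0 e \<subseteq> \<theta> ` G"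
    and ray_0: "\<And>\<zeta>. \<zeta> \<in> G \<Longrightarrow> \<phi> \<zeta> 0 = \<xi>" and ray_1: "\<And>\<zeta>. \<zeta> \<in> G \<Longrightarrow> \<phi> \<zeta> 1 = \<zeta>"
    and ray_in: "\<And>\<zeta> t. \<zeta> \<in> G \<Longrightarrow> t \<in> {0..1} \<Longrightarrow> \<phi> \<zeta> t \<in> G"
    and ray_der: "\<And>\<zeta> t. \<zeta> \<in> G \<Longrightarrow> t \<in> {0..1} \<Longrightarrow>
      (\<phi> \<zeta> has_vector_derivative (\<Sum>k\<in>UNIV. (\<theta> \<zeta> $ k) *\<^sub>R Y k (\<phi> \<zeta> t))) (at t within {0..1})"
    and ray_coord: "\<And>\<zeta> t. \<zeta> \<in> G \<Longrightarrow> t \<in> {0..1} \<Longrightarrow> \<theta> (\<phi> \<zeta> t) = t *\<^sub>R \<theta> \<zeta>"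
begin

text \<open>Component m is the derivative of the m-th coordinate along \<open>Y j\<close>: this is
  row j of the matrix of the frame in the chart.\<close>

definition "\<alpha> j = lie_deriv (Y j) \<theta>"

lemma smooth_\<alpha>: "smooth_on (\<alpha> j) G"
  unfolding \<alpha>_def by (intro smooth_on_lie_deriv open_G smooth_Y smooth_\<theta>)

lemma ray_compose_der:
  assumes "\<zeta> \<in> G" "t \<in> {0..1}" "smooth_on f G"
  shows "((\<lambda>t. f (\<phi> \<zeta> t)) has_vector_derivative
    (\<Sum>k\<in>UNIV. (\<theta> \<zeta> $ k) *\<^sub>R lie_deriv (Y k) f (\<phi> \<zeta> t))) (at t within {0..1})"
proof -
  have F: "(f has_derivative frechet_derivative f (at (\<phi> \<zeta> t))) (at (\<phi> \<zeta> t))"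
    by (rule smooth_on_has_derivative[OF assms(3) ray_in[OF assms(1,2)]])
  have "((f \<circ> \<phi> \<zeta>) has_vector_derivative
      frechet_derivative f (at (\<phi> \<zeta> t)) (\<Sum>k\<in>UNIV. (\<theta> \<zeta> $ k) *\<^sub>R Y k (\<phi> \<zeta> t))) (at t within {0..1})"
    by (rule vector_derivative_diff_chain_within[OF ray_der[OF assms(1,2)] has_derivative_at_withinI[OF F]])
  then show ?thesis
    using lie_deriv_linear_field[of f "\<phi> \<zeta> t" "\<lambda>k. \<theta> \<zeta> $ k" Y UNIV]
      smooth_on_differentiable[OF assms(3) ray_in[OF assms(1,2)]] by (simp add: o_def)
qed

text \<open>The curve \<open>\<theta> (\<phi> \<zeta> t) = t *\<^sub>R \<theta> \<zeta>\<close> is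
  differentiated in two ways, by the chain rule and directly.\<close>

lemma ray_identity:
  assumes "\<zeta> \<in> G" "t \<in> {0..1}"
  shows "(\<Sum>k\<in>UNIV. (\<theta> \<zeta> $ k) *\<^sub>R \<alpha> k (\<phi> \<zeta> t)) = \<theta> \<zeta>"
proof -
  have 1: "((\<lambda>t. \<theta> (\<phi> \<zeta> t)) has_vector_derivative
      (\<Sum>k\<in>UNIV. (\<theta> \<zeta> $ k) *\<^sub>R \<alpha> k (\<phi> \<zeta> t))) (at t within {0..1})"
    unfolding \<alpha>_def by (rule ray_compose_der[OF assms smooth_\<theta>])
  have "((\<lambda>t. t *\<^sub>R \<theta> \<zeta>) has_vector_derivative \<theta> \<zeta>) (at t within {0..1})"
    by (auto intro!: derivative_eq_intros)
  then have 2: "((\<lambda>t. \<theta> (\<phi> \<zeta> t)) has_vector_derivative \<theta> \<zeta>) (at t within {0..1})"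
    by (rule has_vector_derivative_transform[OF assms(2), rotated]) (simp add: ray_coord[OF assms(1)])
  show ?thesis
    by (rule vector_derivative_unique_within_closed_interval[of 0 1 t, OF _ _ 1[folded cbox_interval] 2[folded cbox_interval]])
      (use assms(2) in auto)
qed

text \<open>Euler identity of the chart: the frame combination with coefficients
  \<open>\<theta> \<zeta>\<close> is the radial field. Being valid on the open set G and not just
  along one ray, it can be differentiated in every direction.\<close>

lemma radial_identity: "\<zeta> \<in> G \<Longrightarrow> (\<Sum>k\<in>UNIV. (\<theta> \<zeta> $ k) *\<^sub>R \<alpha> k \<zeta>) = \<theta> \<zeta>"
  using ray_identity[of \<zeta> 1] by (simp add: ray_1)

lemma \<alpha>_center: "\<alpha> j \<xi> = axis j 1"
proof -
  \<comment> \<open>The ball of coordinates supplies a ray in the direction of axis j; at its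
    starting point the ray identity reads off row j.\<close>
  have "(e / 2) *\<^sub>R axis j (1::real) \<in> ball 0 e" using e(1) by simp
  then obtain \<zeta> where \<zeta>: "\<zeta> \<in> G" "\<theta> \<zeta> = (e / 2) *\<^sub>R axis j 1" using e(2) by (metis imageE subsetD)
  have eq: "(\<Sum>k\<in>UNIV. (\<theta> \<zeta> $ k) *\<^sub>R \<alpha> k \<xi>) = \<theta> \<zeta>"
    using ray_identity[OF \<zeta>(1), of 0] ray_0[OF \<zeta>(1)] by simp
  have "(\<Sum>k\<in>UNIV. (\<theta> \<zeta> $ k) *\<^sub>R \<alpha> k \<xi>) = (\<Sum>k\<in>UNIV. if k = j then (e / 2) *\<^sub>R \<alpha> k \<xi> else 0)"
    by (rule sum.cong) (auto simp: \<zeta>(2) axis_def)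
  also have "\<dots> = (e / 2) *\<^sub>R \<alpha> j \<xi>" by simp
  finally have "(e / 2) *\<^sub>R \<alpha> j \<xi> = \<theta> \<zeta>" using eq by simp
  then have "(e / 2) *\<^sub>R \<alpha> j \<xi> = (e / 2) *\<^sub>R axis j 1" unfolding \<zeta>(2) .
  then show ?thesis using e(1) by (simp add: scaleR_cancel_left)
qed

text \<open>Differentiate the radial identity along \<open>Y j\<close> and commute the two derivatives.\<close>

lemma radial_derivative_\<alpha>:
  assumes "\<zeta> \<in> G"
  shows "(\<Sum>k\<in>UNIV. (\<theta> \<zeta> $ k) *\<^sub>R lie_deriv (Y k) (\<alpha> j) \<zeta>) =
    \<alpha> j \<zeta> - (\<Sum>k\<in>UNIV. (\<alpha> j \<zeta> $ k) *\<^sub>R \<alpha> k \<zeta>)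
    - (\<Sum>k\<in>UNIV. (\<theta> \<zeta> $ k) *\<^sub>R lie_deriv (lie_bracket (Y j) (Y k)) \<theta> \<zeta>)"
proof -
  have d\<theta>: "\<theta> differentiable (at \<zeta>)" by (rule smooth_on_differentiable[OF smooth_\<theta> assms])
  have d\<alpha>: "\<alpha> k differentiable (at \<zeta>)" for k by (rule smooth_on_differentiable[OF smooth_\<alpha> assms])
  have sc: "smooth_on (\<lambda>\<zeta>. \<theta> \<zeta> $ k) G" for k
    by (rule smooth_on_bounded_linear[OF open_G bounded_linear_vec_nth smooth_\<theta>])
  have dc: "(\<lambda>\<zeta>. \<theta> \<zeta> $ k) differentiable (at \<zeta>)" for k
    by (rule smooth_on_differentiable[OF sc assms])
  have ss: "smooth_on (\<lambda>\<zeta>. \<Sum>k\<in>UNIV. (\<theta> \<zeta> $ k) *\<^sub>R \<alpha> k \<zeta>) G"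
    by (intro smooth_on_sum open_G smooth_on_scaleR sc smooth_\<alpha>)
  have comp: "lie_deriv (Y j) (\<lambda>\<zeta>. \<theta> \<zeta> $ k) \<zeta> = \<alpha> j \<zeta> $ k" for k
    using lie_deriv_bounded_linear[OF bounded_linear_vec_nth d\<theta>] by (simp add: \<alpha>_def)
  have comm: "lie_deriv (Y j) (\<alpha> k) \<zeta> =
      lie_deriv (Y k) (\<alpha> j) \<zeta> + lie_deriv (lie_bracket (Y j) (Y k)) \<theta> \<zeta>" for k
    using lie_deriv_lie_bracket[OF open_G smooth_Y smooth_Y smooth_\<theta> assms, of j k]
    by (simp add: \<alpha>_def)
  have "\<alpha> j \<zeta> = lie_deriv (Y j) (\<lambda>\<zeta>. \<Sum>k\<in>UNIV. (\<theta> \<zeta> $ k) *\<^sub>R \<alpha> k \<zeta>) \<zeta>"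
    unfolding \<alpha>_def[of j]
    by (rule lie_deriv_cong[OF open_G d\<theta> assms]) (rule radial_identity[symmetric])
  also have "\<dots> = (\<Sum>k\<in>UNIV. lie_deriv (Y j) (\<lambda>\<zeta>. (\<theta> \<zeta> $ k) *\<^sub>R \<alpha> k \<zeta>) \<zeta>)"
    by (rule lie_deriv_sum) (intro differentiable_scaleR dc d\<alpha>)
  also have "\<dots> = (\<Sum>k\<in>UNIV. (\<theta> \<zeta> $ k) *\<^sub>R lie_deriv (Y k) (\<alpha> j) \<zeta> +
      (\<theta> \<zeta> $ k) *\<^sub>R lie_deriv (lie_bracket (Y j) (Y k)) \<theta> \<zeta> + (\<alpha> j \<zeta> $ k) *\<^sub>R \<alpha> k \<zeta>)"
    by (simp only: lie_deriv_scaleR[OF dc d\<alpha>] comp comm scaleR_right_distrib)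
  also have "\<dots> = (\<Sum>k\<in>UNIV. (\<theta> \<zeta> $ k) *\<^sub>R lie_deriv (Y k) (\<alpha> j) \<zeta>) +
      (\<Sum>k\<in>UNIV. (\<theta> \<zeta> $ k) *\<^sub>R lie_deriv (lie_bracket (Y j) (Y k)) \<theta> \<zeta>) +
      (\<Sum>k\<in>UNIV. (\<alpha> j \<zeta> $ k) *\<^sub>R \<alpha> k \<zeta>)"
    by (simp only: sum.distrib)
  finally have "\<alpha> j \<zeta> = \<dots>" .
  moreover have "a = x + y + z \<Longrightarrow> x = a - z - y" for a x y z :: "real ^ 'p" by simp
  ultimately show ?thesis by blast
qed

text \<open>The deviation of the matrix \<open>\<alpha>\<close> from the identity solves a Riccati equation along the ray.\<close>

lemma deviation_derivative:
  assumes "\<zeta> \<in> G" "t \<in> {0..1}"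
    and c: "\<And>k. lie_bracket (Y j) (Y k) (\<phi> \<zeta> t) = (\<Sum>l\<in>UNIV. c k l *\<^sub>R Y l (\<phi> \<zeta> t))"
  defines "D \<equiv> \<lambda>j m t. \<alpha> j (\<phi> \<zeta> t) $ m - (if j = m then 1 else 0)"
  shows "((\<lambda>t. t * D j m t) has_vector_derivative
    - (\<Sum>k\<in>UNIV. D j k t * D k m t)
    - t * (\<Sum>l\<in>UNIV. (\<Sum>k\<in>UNIV. (\<theta> \<zeta> $ k) * c k l) * ((if l = m then 1 else 0) + D l m t)))
    (at t within {0..1})"
proof -
  let ?z = "\<phi> \<zeta> t" and ?u = "\<theta> \<zeta>"
  have z: "?z \<in> G" using ray_in[OF assms(1,2)] .
  define R where "R = (\<Sum>k\<in>UNIV. (?u $ k) *\<^sub>R lie_deriv (Y k) (\<alpha> j) ?z)"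
  have "((\<lambda>t. \<alpha> j (\<phi> \<zeta> t)) has_vector_derivative R) (at t within {0..1})"
    unfolding R_def by (rule ray_compose_der[OF assms(1,2) smooth_\<alpha>])
  then have 1: "((\<lambda>t. \<alpha> j (\<phi> \<zeta> t) $ m) has_vector_derivative R $ m) (at t within {0..1})"
    by (rule bounded_linear.has_vector_derivative[OF bounded_linear_vec_nth])
  have der: "((\<lambda>t. t * D j m t) has_vector_derivative t * R $ m + D j m t) (at t within {0..1})"
    unfolding D_def
    by (rule has_vector_derivative_eq_rhs[OF has_vector_derivative_mult
          [OF has_vector_derivative_id has_vector_derivative_diff[OF 1 has_vector_derivative_const]]])
      simp
  have "lie_deriv (lie_bracket (Y j) (Y k)) \<theta> ?z = (\<Sum>l\<in>UNIV. c k l *\<^sub>R \<alpha> l ?z)" for k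
    using lie_deriv_linear_field[OF smooth_on_differentiable[OF smooth_\<theta> z], of "c k" Y UNIV]
    unfolding lie_deriv_def[of "lie_bracket (Y j) (Y k)"] c \<alpha>_def .
  \<comment> \<open>The factor t turns the constant coefficients of the ray into the coordinates of
    the current point, where the formula for the radial derivative applies.\<close>
  moreover have "t *\<^sub>R R = (\<Sum>k\<in>UNIV. (\<theta> ?z $ k) *\<^sub>R lie_deriv (Y k) (\<alpha> j) ?z)"
    unfolding R_def ray_coord[OF assms(1,2)] by (simp add: scaleR_sum_right)
  ultimately have "t *\<^sub>R R = \<alpha> j ?z - (\<Sum>k\<in>UNIV. (\<alpha> j ?z $ k) *\<^sub>R \<alpha> k ?z)
      - (\<Sum>k\<in>UNIV. (t * ?u $ k) *\<^sub>R (\<Sum>l\<in>UNIV. c k l *\<^sub>R \<alpha> l ?z))"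
    unfolding radial_derivative_\<alpha>[OF z] by (simp add: ray_coord[OF assms(1,2)])
  then have "(t *\<^sub>R R) $ m = \<alpha> j ?z $ m - (\<Sum>k\<in>UNIV. \<alpha> j ?z $ k * \<alpha> k ?z $ m)
      - (\<Sum>k\<in>UNIV. (t * ?u $ k) * (\<Sum>l\<in>UNIV. c k l * \<alpha> l ?z $ m))"
    by (simp only: vector_minus_component sum_component vector_scaleR_component real_scaleR_def)
  also have "(\<Sum>k\<in>UNIV. (t * ?u $ k) * (\<Sum>l\<in>UNIV. c k l * \<alpha> l ?z $ m)) =
      t * (\<Sum>l\<in>UNIV. (\<Sum>k\<in>UNIV. (?u $ k) * c k l) * \<alpha> l ?z $ m)"
    unfolding sum_distrib_left sum_distrib_right
    by (subst sum.swap) (simp add: mult.assoc)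
  finally have R: "t * R $ m = \<alpha> j ?z $ m - (\<Sum>k\<in>UNIV. \<alpha> j ?z $ k * \<alpha> k ?z $ m)
      - t * (\<Sum>l\<in>UNIV. (\<Sum>k\<in>UNIV. (?u $ k) * c k l) * \<alpha> l ?z $ m)" by simp
  have A: "\<alpha> j ?z $ m = (if j = m then 1 else 0) + D j m t" for j m by (simp add: D_def)
  \<comment> \<open>The square of identity plus deviation. Its linear part 2 D cancels against one D
    from \<open>\<alpha> j\<close> and one from the product rule, so only the quadratic term
    survives.\<close>
  have "(\<Sum>k\<in>UNIV. \<alpha> j ?z $ k * \<alpha> k ?z $ m) =
      (\<Sum>k\<in>UNIV. (if j = k then (if k = m then 1 else 0) + D k m t else 0) +
        (if k = m then D j k t else 0) + D j k t * D k m t)"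
    by (rule sum.cong[OF refl]) (auto simp: A algebra_simps)
  also have "\<dots> = (if j = m then 1 else 0) + 2 * D j m t + (\<Sum>k\<in>UNIV. D j k t * D k m t)"
    by (simp add: sum.distrib)
  finally have "t * R $ m + D j m t = - (\<Sum>k\<in>UNIV. D j k t * D k m t)
    - t * (\<Sum>l\<in>UNIV. (\<Sum>k\<in>UNIV. (?u $ k) * c k l) * ((if l = m then 1 else 0) + D l m t))"
    unfolding R by (simp add: A)
  with der show ?thesis by simp
qed

text \<open>Conjugation with \<open>diag ((M \<mu>) ^ w j)\<close> makes the inhomogeneous term of the Riccati equation small,
  because \<open>w l \<le> w j + w k\<close> in all nonzero structure coefficients.\<close>

lemma \<alpha>_bound:
  fixes w :: "'p \<Rightarrow> nat"
  assumes "\<zeta> \<in> G" and w: "\<And>k. 1 \<le> w k"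
    and struct: "\<And>z j k. z \<in> G \<Longrightarrow> \<exists>c. lie_bracket (Y j) (Y k) z = (\<Sum>l\<in>UNIV. c l *\<^sub>R Y l z) \<and>
      (\<forall>l. \<bar>c l\<bar> \<le> F) \<and> (\<forall>l. w j + w k < w l \<longrightarrow> c l = 0)"
    and "0 < \<mu>" "1 \<le> M" "M * \<mu> \<le> 1" "16 * real CARD('p) * real CARD('p) * F \<le> M"
    and u: "\<And>k. \<bar>\<theta> \<zeta> $ k\<bar> \<le> \<mu> ^ w k"
  shows "\<bar>\<alpha> j \<zeta> $ m - (if j = m then 1 else 0)\<bar> \<le> (M * \<mu>) ^ w m / (M * \<mu>) ^ w j"
proof -
  define p where "p = real CARD('p)"
  have p: "1 \<le> p" by (simp add: p_def Suc_leI)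
  define s where "s k = (M * \<mu>) ^ w k" for k
  have s: "0 < s k" for k using assms(4,5) by (simp add: s_def)
  define D where "D = (\<lambda>j m t. \<alpha> j (\<phi> \<zeta> t) $ m - (if j = m then 1 else 0))"
  \<comment> \<open>The conjugated deviation; the claim amounts to its entries being at most 1 in
    absolute value at time 1.\<close>
  define E where "E j m t = s j / s m * D j m t" for j m t
  \<comment> \<open>For entries up to this b the quadratic term is at most b / 4 and the
    inhomogeneous term at most 5 b / 16, whence the factor 9 / 16. It has to be less than 1 for the
    bootstrap to close.\<close>
  define b where "b = 1 / (4 * p)"
  have b: "0 < b" "p * b = 1 / 4" using p by (auto simp: b_def)
  have cont: "continuous_on {0..1} (\<lambda>t. D j m t)" for j m
  proof -
    have "continuous_on {0..1} (\<lambda>t. \<alpha> j (\<phi> \<zeta> t))"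
      unfolding continuous_on_eq_continuous_within
      using ray_compose_der[OF assms(1) _ smooth_\<alpha>] has_vector_derivative_continuous by blast
    then show ?thesis unfolding D_def by (intro continuous_intros)
  qed
  have D0: "D j m 0 = 0" for j m
    by (simp add: D_def ray_0[OF assms(1)] \<alpha>_center axis_def)
  have deriv: "\<exists>d. ((\<lambda>t. t * E j m t) has_vector_derivative d) (at t within {0..1}) \<and> \<bar>d\<bar> \<le> 9 / 16 * b"
    if t: "t \<in> {0..1}" and Eb: "\<And>j m. \<bar>E j m t\<bar> \<le> b" for j m t
  proof -
    have z: "\<phi> \<zeta> t \<in> G" using ray_in[OF assms(1) t] .
    obtain c where c: "\<And>k. lie_bracket (Y j) (Y k) (\<phi> \<zeta> t) = (\<Sum>l\<in>UNIV. c k l *\<^sub>R Y l (\<phi> \<zeta> t))"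
      "\<And>k l. \<bar>c k l\<bar> \<le> F" "\<And>k l. w j + w k < w l \<Longrightarrow> c k l = 0"
      using struct[OF z, of j] by metis
    let ?C = "\<lambda>l. \<Sum>k\<in>UNIV. (\<theta> \<zeta> $ k) * c k l"
    let ?\<delta> = "\<lambda>l. if l = m then 1 else (0::real)"
    define d where "d = s j / s m * (- (\<Sum>k\<in>UNIV. D j k t * D k m t) - t * (\<Sum>l\<in>UNIV. ?C l * (?\<delta> l + D l m t)))"
    have der: "((\<lambda>t. t * E j m t) has_vector_derivative d) (at t within {0..1})"
      using has_vector_derivative_mult_right[OF deviation_derivative[OF assms(1) t c(1), of m], of "s j / s m"]
      unfolding d_def D_def E_def by (simp add: mult.left_commute)
    have F: "0 \<le> F" using c(2) abs_ge_zero order_trans by blast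
    have C: "\<bar>s j / s l * ?C l\<bar> \<le> 1 / (16 * p)" for l
    proof -
      have "\<bar>s j / s l * ?C l\<bar> = \<bar>\<Sum>k\<in>UNIV. (\<theta> \<zeta> $ k) * c k l * (s j / s l)\<bar>"
        by (simp add: sum_distrib_left mult_ac)
      also have "\<dots> \<le> (\<Sum>k\<in>(UNIV::'p set). F / M)"
      proof (rule order_trans[OF sum_abs sum_mono])
        fix k :: 'p
        show "\<bar>(\<theta> \<zeta> $ k) * c k l * (s j / s l)\<bar> \<le> F / M"
        proof (cases "w l \<le> w j + w k")
          case True
          have "\<bar>(\<theta> \<zeta> $ k) * c k l * (s j / s l)\<bar> = \<bar>\<theta> \<zeta> $ k\<bar> * \<bar>c k l\<bar> * (s j / s l)"
            using s[of j] s[of l] by (simp add: abs_mult)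
          also have "\<dots> \<le> \<mu> ^ w k * F * (s j / s l)"
            using u[of k] c(2)[of k l] s[of j] s[of l] assms(4) by (intro mult_right_mono mult_mono) auto
          also have "\<dots> = F * (\<mu> ^ w k * (M * \<mu>) ^ w j / (M * \<mu>) ^ w l)" by (simp add: s_def)
          also have "\<dots> \<le> F * (1 / M)"
            by (intro mult_left_mono scaled_power_le assms True w F)
          finally show ?thesis by simp
        next
          case False
          then show ?thesis using c(3)[of k l] F assms(5) by simp
        qed
      qed
      also have "\<dots> = p * F / M" by (simp add: p_def)
      also have "\<dots> \<le> 1 / (16 * p)"
        using assms(5,7) p by (simp add: p_def field_simps)
      finally show ?thesis .
    qed
    have "d = - (\<Sum>k\<in>UNIV. E j k t * E k m t) - t * (\<Sum>l\<in>UNIV. (s j / s l * ?C l) * (?\<delta> l + E l m t))"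
    proof -
      have "s j / s m * (D j k t * D k m t) = E j k t * E k m t" for k
        using s[of k] by (simp add: E_def)
      moreover have "s j / s m * (?C l * (?\<delta> l + D l m t)) = (s j / s l * ?C l) * (?\<delta> l + E l m t)" for l
        using s[of l] by (cases "l = m") (simp_all add: E_def field_simps)
      ultimately have "s j / s m * (\<Sum>k\<in>UNIV. D j k t * D k m t) = (\<Sum>k\<in>UNIV. E j k t * E k m t)"
        "s j / s m * (\<Sum>l\<in>UNIV. ?C l * (?\<delta> l + D l m t)) = (\<Sum>l\<in>UNIV. (s j / s l * ?C l) * (?\<delta> l + E l m t))"
        by (simp_all only: sum_distrib_left)
      moreover have "d = - (s j / s m * (\<Sum>k\<in>UNIV. D j k t * D k m t)) - t * (s j / s m * (\<Sum>l\<in>UNIV. ?C l * (?\<delta> l + D l m t)))"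
        unfolding d_def by (simp add: right_diff_distrib mult.left_commute)
      ultimately show ?thesis by simp
    qed
    moreover have "\<bar>\<Sum>k\<in>UNIV. E j k t * E k m t\<bar> \<le> p * (b * b)"
    proof -
      have "\<bar>\<Sum>k\<in>UNIV. E j k t * E k m t\<bar> \<le> (\<Sum>k\<in>(UNIV::'p set). b * b)"
        by (rule order_trans[OF sum_abs sum_mono]) (use Eb b in \<open>auto simp: abs_mult intro!: mult_mono\<close>)
      then show ?thesis by (simp add: p_def)
    qed
    moreover have "\<bar>t * (\<Sum>l\<in>UNIV. (s j / s l * ?C l) * (?\<delta> l + E l m t))\<bar> \<le> 1 / (16 * p) * (1 + p * b)"
    proof -
      have "\<bar>\<Sum>l\<in>UNIV. (s j / s l * ?C l) * (?\<delta> l + E l m t)\<bar> \<le> (\<Sum>l\<in>UNIV. 1 / (16 * p) * (?\<delta> l + b))"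
      proof (rule order_trans[OF sum_abs sum_mono])
        fix l
        have "\<bar>?\<delta> l + E l m t\<bar> \<le> ?\<delta> l + b" using Eb[of l m] by auto
        then show "\<bar>(s j / s l * ?C l) * (?\<delta> l + E l m t)\<bar> \<le> 1 / (16 * p) * (?\<delta> l + b)"
          unfolding abs_mult[of "s j / s l * ?C l"] using C[of l] p by (intro mult_mono) auto
      qed
      also have "\<dots> = 1 / (16 * p) * (1 + p * b)"
        by (simp only: sum_distrib_left[symmetric] sum.distrib) (simp add: p_def)
      finally have "\<bar>t\<bar> * \<bar>\<Sum>l\<in>UNIV. (s j / s l * ?C l) * (?\<delta> l + E l m t)\<bar> \<le> 1 * (1 / (16 * p) * (1 + p * b))"
        using t by (intro mult_mono) auto
      then show ?thesis by (simp add: abs_mult)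
    qed
    ultimately have "\<bar>d\<bar> \<le> p * (b * b) + 1 / (16 * p) * (1 + p * b)" by linarith
    also have "\<dots> = 9 / 16 * b"
      using p by (simp add: b_def field_simps)
    finally show ?thesis using der by blast
  qed
  have "\<bar>E (fst (j, m)) (snd (j, m)) 1\<bar> < b"
  proof (rule continuous_induction[where h = "\<lambda>i t. \<bar>E (fst i) (snd i) t\<bar>" and A = UNIV])
    show "continuous_on {0..1} (\<lambda>t. \<bar>E (fst i) (snd i) t\<bar>)" for i
      unfolding E_def using s[THEN less_imp_neq, symmetric]
      by (auto intro!: continuous_intros cont)
    show "\<bar>E (fst i) (snd i) 0\<bar> < b" for i
      using b by (simp add: E_def D0)
    fix t :: real and i :: "'p \<times> 'p"
    assume t: "0 \<le> t" "t \<le> 1"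
      and IH': "\<And>s' i. 0 \<le> s' \<Longrightarrow> s' \<le> t \<Longrightarrow> i \<in> UNIV \<Longrightarrow> \<bar>E (fst i) (snd i) s'\<bar> \<le> b"
    have IH: "\<bar>E j m s'\<bar> \<le> b" if "0 \<le> s'" "s' \<le> t" for j m s'
      using IH'[of s' "(j, m)"] that by simp
    obtain j m where i: "i = (j, m)" by (cases i)
    have "\<bar>E j m t\<bar> < b"
    proof (cases "t = 0")
      case True
      then show ?thesis using b by (simp add: E_def D0)
    next
      case False
      have "\<forall>t'\<in>{0..t}. \<exists>d. ((\<lambda>t. t * E j m t) has_vector_derivative d) (at t' within {0..1}) \<and> \<bar>d\<bar> \<le> 9 / 16 * b"
        using deriv IH t by auto
      then obtain d where d: "\<And>t'. t' \<in> {0..t} \<Longrightarrow>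
          ((\<lambda>t. t * E j m t) has_vector_derivative d t') (at t' within {0..1}) \<and> \<bar>d t'\<bar> \<le> 9 / 16 * b"
        by metis
      \<comment> \<open>The mean value inequality bounds t times E, and division by t bounds E
        itself; this is why t = 0 is treated apart.\<close>
      have "norm (t * E j m t - 0 * E j m 0) \<le> 9 / 16 * b * \<bar>t - 0\<bar>"
      proof (rule vector_derivative_bound[where S = "{0..t}" and D = d])
        show "((\<lambda>t. t * E j m t) has_vector_derivative d t') (at t' within {0..t})" if "t' \<in> {0..t}" for t'
          using d[OF that] t by (auto intro: has_vector_derivative_within_subset)
        show "norm (d t') \<le> 9 / 16 * b" if "t' \<in> {0..t}" for t' using d[OF that] by simp
      qed (use t in auto)
      then have "t * \<bar>E j m t\<bar> \<le> t * (9 / 16 * b)" using t by (simp add: abs_mult mult.commute)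
      then have "\<bar>E j m t\<bar> \<le> 9 / 16 * b" using t False by simp
      then show ?thesis using b by linarith
    qed
    then show "\<bar>E (fst i) (snd i) t\<bar> < b" using i by simp
  qed auto
  moreover have "b \<le> 1" using p by (simp add: b_def)
  ultimately have "\<bar>E j m 1\<bar> \<le> 1" unfolding fst_conv snd_conv by linarith
  then have "s j / s m * \<bar>D j m 1\<bar> \<le> 1" using s[of j] s[of m] by (simp add: E_def abs_mult)
  then have "\<bar>D j m 1\<bar> \<le> s m / s j" using s[of j] s[of m] by (simp add: field_simps)
  then show ?thesis by (simp add: D_def s_def ray_1[OF assms(1)])
qed

end

section \<open>Structure coefficients of a free frame\<close>

locale free_frame =
  fixes X :: "nat \<Rightarrow> real ^ 'p \<Rightarrow> real ^ 'p" and \<Omega> :: "(real ^ 'p) set" and n r :: nat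
    and \<beta> :: "'p::finite \<Rightarrow> nat list"
  assumes open_\<Omega>: "open \<Omega>" and smooth_X: "\<And>i. i \<le> n \<Longrightarrow> smooth_on (X i) \<Omega>"
    and free: "free_up_to_weight n r \<Omega> X" and basis: "bracket_basis n r \<Omega> X \<beta>"
begin

abbreviation "Y k \<equiv> iter_bracket X (\<beta> k)"
abbreviation "w k \<equiv> weight (\<beta> k)"

lemma \<beta>_multiindex: "\<beta> k \<in> multiindices n r"
  using basis unfolding bracket_basis_def by auto

lemma w_bounds: "1 \<le> w k" "w k \<le> r"
  using \<beta>_multiindex[of k] weight_pos by (auto simp: multiindices_def)

lemma smooth_bracket: "I \<in> multiindices n r \<Longrightarrow> smooth_on (iter_bracket X I) \<Omega>"
  by (rule smooth_on_iter_bracket[OF open_\<Omega> smooth_X]) (auto simp: multiindices_def)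

lemma smooth_comb_field: "smooth_on (comb_field X \<beta> u) \<Omega>"
  unfolding comb_field_def[abs_def]
  by (intro smooth_on_sum smooth_on_scaleR smooth_on_const open_\<Omega> smooth_bracket \<beta>_multiindex)

text \<open>The bracket is a combination of right-nested brackets of weight exactly
  \<open>w j + w k\<close>, and each of these expands at z into basis fields of no larger weight.
  Since \<open>w l\<close> is at most r, the nested brackets have weight below r, within the range
  of freeness.\<close>

lemma lie_bracket_coeff_zero:
  assumes "z \<in> \<Omega>" "lie_bracket (Y j) (Y k) z = (\<Sum>l\<in>UNIV. c l *\<^sub>R Y l z)" "w j + w k < w l"
  shows "c l = 0"
proof -
  let ?m = "w j + w k"
  let ?A = "{K \<in> multiindices n ?m. weight K = ?m}"
  have idx: "\<beta> i \<noteq> []" "set (\<beta> i) \<subseteq> {0..n}" for i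
    using \<beta>_multiindex[of i] by (auto simp: multiindices_def)
  have "bracket_layer n X \<Omega> ?m (lie_bracket (Y j) (Y k))"
    by (rule bracket_layer_lie_bracket_iter[OF open_\<Omega> smooth_X idx idx])
  then obtain a where "\<forall>z\<in>\<Omega>. lie_bracket (Y j) (Y k) z = (\<Sum>K\<in>?A. a K *\<^sub>R iter_bracket X K z)"
    unfolding bracket_layer_def by (rule exE)
  then have a: "lie_bracket (Y j) (Y k) z = (\<Sum>K\<in>?A. a K *\<^sub>R iter_bracket X K z)"
    using assms(1) by (rule bspec)
  have "\<forall>K. \<exists>d. iter_bracket X K z = (\<Sum>l\<in>UNIV. d l *\<^sub>R Y l z)"
    using bracket_basis_coeff_exists[OF basis assms(1)] by blast
  from choice[OF this] obtain d
    where d: "\<And>K. iter_bracket X K z = (\<Sum>l\<in>UNIV. d K l *\<^sub>R Y l z)" by auto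
  have "d K l = 0" if "K \<in> ?A" for K
  proof (rule free_coeff_zero[OF open_\<Omega> smooth_X free basis assms(1) _ d])
    show "K \<in> multiindices n r" "weight K < w l"
      using that assms(3) w_bounds[of l] by (auto simp: multiindices_def)
  qed
  moreover have "(\<Sum>l\<in>UNIV. (c l - (\<Sum>K\<in>?A. a K * d K l)) *\<^sub>R Y l z) = 0"
  proof -
    have "(\<Sum>K\<in>?A. a K *\<^sub>R iter_bracket X K z) = (\<Sum>l\<in>UNIV. (\<Sum>K\<in>?A. a K * d K l) *\<^sub>R Y l z)"
      unfolding scaleR_sum_left
      by (subst sum.swap) (simp add: d[symmetric] scaleR_sum_right[symmetric] scaleR_scaleR[symmetric] del: scaleR_scaleR)
    then show ?thesis using a assms(2) by (simp add: scaleR_diff_left sum_subtractf)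
  qed
  from bracket_basis_coeff_zero[OF basis assms(1) this, of l]
  have "c l = (\<Sum>K\<in>?A. a K * d K l)" by simp
  ultimately show ?thesis by simp
qed

text \<open>A single constant for both kinds of expansion. It depends on the compact set and not on
  a chart, and this makes the later estimates uniform in the base point.\<close>

lemma coefficient_bound:
  assumes "compact K" "K \<subseteq> \<Omega>"
  obtains F where "0 < F"
    "\<And>z I. z \<in> K \<Longrightarrow> I \<in> multiindices n r \<Longrightarrow> \<exists>c. iter_bracket X I z = (\<Sum>l\<in>UNIV. c l *\<^sub>R Y l z) \<and>
      (\<forall>l. \<bar>c l\<bar> \<le> F) \<and> (\<forall>l. weight I < w l \<longrightarrow> c l = 0)"
    "\<And>z j k. z \<in> K \<Longrightarrow> \<exists>c. lie_bracket (Y j) (Y k) z = (\<Sum>l\<in>UNIV. c l *\<^sub>R Y l z) \<and>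
      (\<forall>l. \<bar>c l\<bar> \<le> F) \<and> (\<forall>l. w j + w k < w l \<longrightarrow> c l = 0)"
proof -
  let ?A = "iter_bracket X ` multiindices n r \<union> (\<lambda>(j, k). lie_bracket (Y j) (Y k)) ` UNIV"
  have sm: "continuous_on \<Omega> v" if "v \<in> ?A" for v
    using that by (auto intro!: smooth_on_continuous smooth_bracket smooth_on_lie_bracket open_\<Omega> \<beta>_multiindex)
  have fin: "finite ?A" using finite_multiindices by simp
  obtain H where H: "0 < H"
    "\<And>v x c. v \<in> ?A \<Longrightarrow> x \<in> K \<Longrightarrow> v x = comb_field X \<beta> c x \<Longrightarrow> norm c \<le> H"
    using bounded_coefficients[OF basis assms _ fin sm]
      smooth_on_continuous[OF smooth_bracket[OF \<beta>_multiindex]] by blast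
  have ex: "\<exists>c. v z = (\<Sum>l\<in>UNIV. c l *\<^sub>R Y l z) \<and> (\<forall>l. \<bar>c l\<bar> \<le> H)" if v: "v \<in> ?A" "z \<in> K" for v z
  proof -
    obtain c where c: "v z = (\<Sum>l\<in>UNIV. c l *\<^sub>R Y l z)"
      using bracket_basis_coeff_exists[OF basis, of z "v z"] assms(2) v by blast
    have "norm (\<chi> l. c l) \<le> H" by (rule H(2)[OF v]) (simp add: c comb_field_def)
    then have "\<bar>c l\<bar> \<le> H" for l using component_le_norm_cart[of "\<chi> l. c l" l] by simp
    with c show ?thesis by blast
  qed
  show thesis
  proof (rule that[OF H(1)])
    fix z I assume z: "z \<in> K" "I \<in> multiindices n r"
    then obtain c where c: "iter_bracket X I z = (\<Sum>l\<in>UNIV. c l *\<^sub>R Y l z)" "\<forall>l. \<bar>c l\<bar> \<le> H"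
      using ex[of "iter_bracket X I" z] by blast
    have "c l = 0" if "weight I < w l" for l
      by (rule free_coeff_zero[OF open_\<Omega> smooth_X free basis _ z(2) c(1) that]) (use z assms in auto)
    with c show "\<exists>c. iter_bracket X I z = (\<Sum>l\<in>UNIV. c l *\<^sub>R Y l z) \<and>
      (\<forall>l. \<bar>c l\<bar> \<le> H) \<and> (\<forall>l. weight I < w l \<longrightarrow> c l = 0)" by blast
  next
    fix z j k assume z: "z \<in> K"
    have "lie_bracket (Y j) (Y k) \<in> ?A" by auto
    then obtain c where c: "lie_bracket (Y j) (Y k) z = (\<Sum>l\<in>UNIV. c l *\<^sub>R Y l z)" "\<forall>l. \<bar>c l\<bar> \<le> H"
      using ex[of "lie_bracket (Y j) (Y k)" z] z by blast
    have "c l = 0" if "w j + w k < w l" for l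
      by (rule lie_bracket_coeff_zero[OF _ c(1) that]) (use z assms in auto)
    with c show "\<exists>c. lie_bracket (Y j) (Y k) z = (\<Sum>l\<in>UNIV. c l *\<^sub>R Y l z) \<and>
      (\<forall>l. \<bar>c l\<bar> \<le> H) \<and> (\<forall>l. w j + w k < w l \<longrightarrow> c l = 0)" by blast
  qed
qed

subsection \<open>The homogeneous norm\<close>

lemma layer_norm_nonneg: "0 \<le> layer_norm \<beta> k u"
  by (simp add: layer_norm_def sum_nonneg)

lemma hom_norm_nonneg: "0 \<le> hom_norm \<beta> r u"
  by (simp add: hom_norm_def sum_nonneg)

lemma component_le_hom_norm: "\<bar>u $ l\<bar> \<le> hom_norm \<beta> r u ^ w l"
proof -
  have "\<bar>u $ l\<bar> \<le> layer_norm \<beta> (w l) u"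
    unfolding layer_norm_def by (rule member_le_sum) auto
  also have "\<dots> = (layer_norm \<beta> (w l) u powr (1 / real (w l))) ^ w l"
    using w_bounds(1)[of l] layer_norm_nonneg[of "w l" u]
    by (cases "layer_norm \<beta> (w l) u = 0") (simp_all add: powr_realpow[symmetric] powr_powr)
  also have "\<dots> \<le> hom_norm \<beta> r u ^ w l"
    unfolding hom_norm_def using w_bounds[of l]
    by (intro power_mono member_le_sum) auto
  finally show ?thesis .
qed

lemma hom_norm_eq_0_iff: "hom_norm \<beta> r u = 0 \<longleftrightarrow> u = 0"
proof
  assume "hom_norm \<beta> r u = 0"
  then have "u $ l = 0" for l
    using component_le_hom_norm[of u l] w_bounds(1)[of l] by (simp add: power_0_left split: if_splits)
  then show "u = 0" by (simp add: vec_eq_iff)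
qed (simp add: hom_norm_def layer_norm_def)

lemma hom_norm_uminus: "hom_norm \<beta> r (- u) = hom_norm \<beta> r u"
  by (simp add: hom_norm_def layer_norm_def)

lemma hom_norm_le:
  assumes "0 \<le> \<mu>" "\<And>l. \<bar>u $ l\<bar> \<le> \<mu> ^ w l"
  shows "hom_norm \<beta> r u \<le> real r * real CARD('p) * \<mu>"
proof -
  have "layer_norm \<beta> k u powr (1 / real k) \<le> real CARD('p) * \<mu>" if k: "k \<in> {1..r}" for k
  proof -
    have "layer_norm \<beta> k u \<le> (\<Sum>j | w j = k. \<mu> ^ k)"
      unfolding layer_norm_def by (rule sum_mono) (use assms(2) in auto)
    also have "\<dots> \<le> real CARD('p) * \<mu> ^ k"
      using assms(1) by (simp add: mult_right_mono card_mono)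
    \<comment> \<open>The number of coordinates is replaced by its k-th power so that the k-th root
      becomes linear in \<mu>.\<close>
    also have "\<dots> \<le> real CARD('p) ^ k * \<mu> ^ k"
      using self_le_power[of "real CARD('p)" k] k assms(1) by (intro mult_right_mono) (auto simp: Suc_le_eq)
    finally have "layer_norm \<beta> k u powr (1 / real k) \<le> ((real CARD('p) * \<mu>) ^ k) powr (1 / real k)"
      using layer_norm_nonneg by (intro powr_mono2) (auto simp: power_mult_distrib)
    also have "\<dots> = real CARD('p) * \<mu>"
      using k assms(1) by (cases "\<mu> = 0") (simp_all add: powr_realpow[symmetric] powr_powr)
    finally show ?thesis .
  qed
  then have "hom_norm \<beta> r u \<le> (\<Sum>k=1..r. real CARD('p) * \<mu>)"
    unfolding hom_norm_def by (rule sum_mono)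
  then show ?thesis by simp
qed

lemma continuous_on_hom_norm: "continuous_on UNIV (hom_norm \<beta> r)"
  unfolding hom_norm_def[abs_def] layer_norm_def
  by (intro continuous_on_sum continuous_on_powr' continuous_intros) (auto intro!: sum_nonneg)

end

text \<open>Chain rule and linearity of the field in u. The case a = t, b = 0 gives initial pieces
  of a ray, the case a = -1, b = 1 its reversal.\<close>

lemma integral_curve_affine:
  assumes "integral_curve \<Omega> (comb_field X \<beta> u) \<xi> \<phi>" "\<And>s. s \<in> {0..1} \<Longrightarrow> a * s + b \<in> {0..1}"
  shows "integral_curve \<Omega> (comb_field X \<beta> (a *\<^sub>R u)) (\<phi> b) (\<lambda>s. \<phi> (a * s + b))"
  unfolding integral_curve_def
proof (intro conjI ballI)
  show "\<phi> (a * 0 + b) = \<phi> b" by simp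
  fix s :: real assume s: "s \<in> {0..1}"
  let ?h = "\<lambda>s. a * s + b"
  show "\<phi> (?h s) \<in> \<Omega>" using assms(1) assms(2)[OF s] unfolding integral_curve_def by blast
  have "(\<phi> has_vector_derivative comb_field X \<beta> u (\<phi> (?h s))) (at (?h s) within ?h ` {0..1})"
    by (rule has_vector_derivative_within_subset[of _ _ _ "{0..1}"])
      (use assms s in \<open>auto simp: integral_curve_def\<close>)
  moreover have "(?h has_vector_derivative a) (at s within {0..1})"
    by (auto intro!: derivative_eq_intros)
  ultimately have "(\<phi> \<circ> ?h has_vector_derivative a *\<^sub>R comb_field X \<beta> u (\<phi> (?h s))) (at s within {0..1})"
    by (rule vector_diff_chain_within[rotated])
  then show "((\<lambda>s. \<phi> (?h s)) has_vector_derivative comb_field X \<beta> (a *\<^sub>R u) (\<phi> (?h s))) (at s within {0..1})"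
    by (simp add: comb_field_scale o_def)
qed

section \<open>The map \<Theta> and a chart of uniform size\<close>

locale canonical_map = free_frame X \<Omega> n r \<beta>
  for X :: "nat \<Rightarrow> real ^ 'p \<Rightarrow> real ^ 'p" and \<Omega> :: "(real ^ 'p) set" and n r :: nat
    and \<beta> :: "'p::finite \<Rightarrow> nat list" +
  fixes N :: "((real ^ 'p) \<times> (real ^ 'p)) set" and \<Theta> :: "real ^ 'p \<Rightarrow> real ^ 'p \<Rightarrow> real ^ 'p"
  assumes Theta: "is_Theta \<Omega> X \<beta> N \<Theta>"
begin

lemma open_N: "open N" and N_sub: "N \<subseteq> \<Omega> \<times> \<Omega>" and diagonal_N: "\<xi> \<in> \<Omega> \<Longrightarrow> (\<xi>, \<xi>) \<in> N"
  and continuous_Theta: "continuous_on N (\<lambda>(\<xi>, \<zeta>). \<Theta> \<xi> \<zeta>)"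
  using Theta smooth_on_continuous unfolding is_Theta_def by auto

text \<open>Unpacks \<open>is_Theta\<close> at one base point and replaces the definite description
  of the exponential by an actual integral curve with the right endpoint.\<close>

lemma Theta_slice:
  assumes "\<xi> \<in> \<Omega>"
  shows "0 \<in> \<Theta> \<xi> ` {\<zeta>. (\<xi>, \<zeta>) \<in> N}" "smooth_on (\<Theta> \<xi>) {\<zeta>. (\<xi>, \<zeta>) \<in> N}"
    and "(\<xi>, \<zeta>) \<in> N \<Longrightarrow> \<exists>\<phi>. integral_curve \<Omega> (comb_field X \<beta> (\<Theta> \<xi> \<zeta>)) \<xi> \<phi> \<and> \<phi> 1 = \<zeta>"
proof -
  let ?N = "{\<zeta>. (\<xi>, \<zeta>) \<in> N}"
  obtain U where U: "0 \<in> U" "\<And>u. u \<in> U \<Longrightarrow> \<exists>\<phi>. integral_curve \<Omega> (comb_field X \<beta> u) \<xi> \<phi>"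
    "diffeomorphism U ?N (\<lambda>u. exp_field \<Omega> (comb_field X \<beta> u) \<xi>) (\<Theta> \<xi>)"
    using Theta assms unfolding is_Theta_def by blast
  have im: "\<Theta> \<xi> ` ?N = U" and inv: "\<And>\<zeta>. \<zeta> \<in> ?N \<Longrightarrow> exp_field \<Omega> (comb_field X \<beta> (\<Theta> \<xi> \<zeta>)) \<xi> = \<zeta>"
    using U(3) unfolding diffeomorphism_def homeomorphism_def by auto
  show "0 \<in> \<Theta> \<xi> ` ?N" using U(1) im by simp
  show "smooth_on (\<Theta> \<xi>) ?N" using U(3) unfolding diffeomorphism_def by blast
  assume \<zeta>: "(\<xi>, \<zeta>) \<in> N"
  then obtain \<phi> where "integral_curve \<Omega> (comb_field X \<beta> (\<Theta> \<xi> \<zeta>)) \<xi> \<phi>" using U(2) im by blast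
  moreover from exp_field_eq[OF open_\<Omega> smooth_comb_field this] have "\<phi> 1 = \<zeta>" using inv \<zeta> by simp
  ultimately show "\<exists>\<phi>. integral_curve \<Omega> (comb_field X \<beta> (\<Theta> \<xi> \<zeta>)) \<xi> \<phi> \<and> \<phi> 1 = \<zeta>" by blast
qed

lemma Theta_curve:
  assumes "(\<xi>, \<zeta>) \<in> N"
  obtains \<phi> where "integral_curve \<Omega> (comb_field X \<beta> (\<Theta> \<xi> \<zeta>)) \<xi> \<phi>" "\<phi> 1 = \<zeta>"
  using Theta_slice(3)[of \<xi> \<zeta>] assms N_sub by blast

lemma endpoint_eq:
  assumes "(\<xi>, \<zeta>) \<in> N" "integral_curve \<Omega> (comb_field X \<beta> (\<Theta> \<xi> \<zeta>)) \<xi> \<phi>"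
  shows "\<phi> 1 = \<zeta>"
  using Theta_curve[OF assms(1)] integral_curve_unique[OF open_\<Omega> smooth_comb_field assms(2), of _ 1]
  by (metis atLeastAtMost_iff order_refl zero_le_one)

lemma Theta_inj:
  assumes "(\<xi>, \<zeta>) \<in> N" "(\<xi>, \<zeta>') \<in> N" "\<Theta> \<xi> \<zeta> = \<Theta> \<xi> \<zeta>'"
  shows "\<zeta> = \<zeta>'"
  using Theta_curve[OF assms(1)] endpoint_eq[OF assms(2)] assms(3) by metis

lemma integral_curve_zero: "\<xi> \<in> \<Omega> \<Longrightarrow> integral_curve \<Omega> (comb_field X \<beta> 0) \<xi> (\<lambda>t. \<xi>)"
  by (simp add: integral_curve_def comb_field_def)

text \<open>The value 0 is attained somewhere on the slice, and the integral curve for the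
  coefficient vector 0 is constant, so the point in question is \<xi>.\<close>

lemma Theta_self:
  assumes "\<xi> \<in> \<Omega>"
  shows "\<Theta> \<xi> \<xi> = 0"
proof -
  obtain \<zeta> where \<zeta>: "(\<xi>, \<zeta>) \<in> N" "\<Theta> \<xi> \<zeta> = 0" using Theta_slice(1)[OF assms] by auto
  with endpoint_eq[OF \<zeta>(1)] integral_curve_zero[OF assms] show ?thesis by force
qed

text \<open>Invariance of domain for \<open>(\<xi>, \<zeta>) \<mapsto> (\<xi>, \<Theta> \<xi> \<zeta>)\<close> gives a ball of coordinates that serves all
  base points near \<open>\<xi>\<^sub>0\<close>.\<close>

lemma uniform_coordinate_ball:
  assumes "\<xi>\<^sub>0 \<in> \<Omega>"
  obtains R R\<^sub>1 \<epsilon> where "0 < R" "0 < R\<^sub>1" "R\<^sub>1 \<le> R" "0 < \<epsilon>" "cball \<xi>\<^sub>0 R \<times> cball \<xi>\<^sub>0 R \<subseteq> N"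
    "\<And>\<xi> u. \<xi> \<in> ball \<xi>\<^sub>0 R\<^sub>1 \<Longrightarrow> u \<in> ball 0 \<epsilon> \<Longrightarrow> \<exists>\<zeta>\<in>ball \<xi>\<^sub>0 R. \<Theta> \<xi> \<zeta> = u"
proof -
  obtain A B where AB: "open A" "open B" "(\<xi>\<^sub>0, \<xi>\<^sub>0) \<in> A \<times> B" "A \<times> B \<subseteq> N"
    using open_prod_elim[OF open_N diagonal_N[OF assms]] by blast
  then obtain R where R: "0 < R" "cball \<xi>\<^sub>0 R \<subseteq> A \<inter> B"
    using open_contains_cball[of "A \<inter> B"] by blast
  have RN: "cball \<xi>\<^sub>0 R \<times> cball \<xi>\<^sub>0 R \<subseteq> N" using R(2) AB(4) by blast
  define S where "S = ball \<xi>\<^sub>0 R \<times> ball \<xi>\<^sub>0 R"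
  \<comment> \<open>Keeping the base point as a component makes the dimensions of source and target
    equal and yields openness in both variables at once.\<close>
  define F where "F = (\<lambda>z. (fst z, (\<lambda>(\<xi>, \<zeta>). \<Theta> \<xi> \<zeta>) z))"
  have SN: "S \<subseteq> N" using RN ball_subset_cball[of \<xi>\<^sub>0 R] unfolding S_def by blast
  have "open (F ` S)"
  proof (rule invariance_of_domain)
    show "continuous_on S F"
      unfolding F_def by (intro continuous_intros continuous_on_subset[OF continuous_Theta SN])
    show "open S" by (simp add: S_def open_Times)
    show "inj_on F S"
    proof (rule inj_onI)
      fix x y assume xy: "x \<in> S" "y \<in> S" "F x = F y"
      obtain \<xi> \<zeta> where x: "x = (\<xi>, \<zeta>)" by (cases x)
      obtain \<xi>' \<zeta>' where y: "y = (\<xi>', \<zeta>')" by (cases y)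
      have "\<xi> = \<xi>'" "\<Theta> \<xi> \<zeta> = \<Theta> \<xi> \<zeta>'" using xy(3) by (auto simp: F_def x y)
      moreover have "(\<xi>, \<zeta>) \<in> N" "(\<xi>', \<zeta>') \<in> N" using xy SN x y by auto
      ultimately show "x = y" using Theta_inj[of \<xi> \<zeta> \<zeta>'] x y by simp
    qed
  qed
  moreover have "(\<xi>\<^sub>0, \<xi>\<^sub>0) \<in> S" using R(1) by (simp add: S_def)
  then have "(\<xi>\<^sub>0, 0) \<in> F ` S"
    using Theta_self[OF assms] by (auto simp: F_def image_iff intro!: bexI[of _ "(\<xi>\<^sub>0, \<xi>\<^sub>0)"])
  ultimately obtain A' B' where AB': "open A'" "open B'" "(\<xi>\<^sub>0, 0) \<in> A' \<times> B'" "A' \<times> B' \<subseteq> F ` S"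
    using open_prod_elim by metis
  obtain R\<^sub>1 where R1: "0 < R\<^sub>1" "ball \<xi>\<^sub>0 R\<^sub>1 \<subseteq> A'" using AB' openE by blast
  obtain \<epsilon> where \<epsilon>: "0 < \<epsilon>" "ball 0 \<epsilon> \<subseteq> B'" using AB' openE by blast
  show thesis
  proof (rule that[of R "min R R\<^sub>1" \<epsilon>])
    fix \<xi> u :: "real ^ 'p" assume "\<xi> \<in> ball \<xi>\<^sub>0 (min R R\<^sub>1)" "u \<in> ball 0 \<epsilon>"
    then have "\<xi> \<in> A'" "u \<in> B'" using R1(2) \<epsilon>(2) by auto
    then have "(\<xi>, u) \<in> F ` S" using AB'(4) by blast
    then show "\<exists>\<zeta>\<in>ball \<xi>\<^sub>0 R. \<Theta> \<xi> \<zeta> = u" by (auto simp: F_def S_def)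
  qed (use R R1 \<epsilon> RN in auto)
qed

end

locale uniform_chart = canonical_map X \<Omega> n r \<beta> N \<Theta>
  for X :: "nat \<Rightarrow> real ^ 'p \<Rightarrow> real ^ 'p" and \<Omega> :: "(real ^ 'p) set" and n r :: nat
    and \<beta> :: "'p::finite \<Rightarrow> nat list"
    and N :: "((real ^ 'p) \<times> (real ^ 'p)) set" and \<Theta> :: "real ^ 'p \<Rightarrow> real ^ 'p \<Rightarrow> real ^ 'p" +
  fixes \<xi>\<^sub>0 :: "real ^ 'p" and R R\<^sub>1 \<epsilon> :: real
  assumes radii: "0 < R" "0 < R\<^sub>1" "R\<^sub>1 \<le> R" "0 < \<epsilon>" and cball_N: "cball \<xi>\<^sub>0 R \<times> cball \<xi>\<^sub>0 R \<subseteq> N"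
    and Theta_onto: "\<And>\<xi> u. \<xi> \<in> ball \<xi>\<^sub>0 R\<^sub>1 \<Longrightarrow> u \<in> ball 0 \<epsilon> \<Longrightarrow> \<exists>\<zeta>\<in>ball \<xi>\<^sub>0 R. \<Theta> \<xi> \<zeta> = u"
begin

text \<open>For base points in the smaller ball its image is the full ball of radius \<epsilon>. A
  ball of coordinates is star-shaped around 0, so rays stay inside.\<close>

definition "chart_domain \<xi> = {\<zeta> \<in> ball \<xi>\<^sub>0 R. norm (\<Theta> \<xi> \<zeta>) < \<epsilon>}"

lemma ball_N: "\<xi> \<in> ball \<xi>\<^sub>0 R\<^sub>1 \<Longrightarrow> \<zeta> \<in> cball \<xi>\<^sub>0 R \<Longrightarrow> (\<xi>, \<zeta>) \<in> N"
  using cball_N radii by auto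

lemma ball_\<Omega>: "\<xi> \<in> ball \<xi>\<^sub>0 R\<^sub>1 \<Longrightarrow> \<xi> \<in> \<Omega>" and cball_\<Omega>: "cball \<xi>\<^sub>0 R \<subseteq> \<Omega>"
proof -
  have sub: "\<xi> \<in> \<Omega>" if "\<xi> \<in> cball \<xi>\<^sub>0 R" for \<xi> using cball_N N_sub that by blast
  then show "cball \<xi>\<^sub>0 R \<subseteq> \<Omega>" by blast
  show "\<xi> \<in> ball \<xi>\<^sub>0 R\<^sub>1 \<Longrightarrow> \<xi> \<in> \<Omega>" using sub[of \<xi>] radii by auto
qed

lemma smooth_Theta: "\<xi> \<in> ball \<xi>\<^sub>0 R\<^sub>1 \<Longrightarrow> smooth_on (\<Theta> \<xi>) (ball \<xi>\<^sub>0 R)"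
  by (rule smooth_on_subset[OF Theta_slice(2)]) (auto intro: ball_\<Omega> ball_N)

text \<open>\<open>\<Theta> \<xi>\<close> inverts the exponential on the values that it takes. That
  every small u is such a value, uniformly in \<xi>, is \<open>Theta_onto\<close>; uniqueness of
  integral curves then identifies the endpoint.\<close>

lemma endpoint_coordinates:
  assumes "\<xi> \<in> ball \<xi>\<^sub>0 R\<^sub>1" "norm u < \<epsilon>" "integral_curve \<Omega> (comb_field X \<beta> u) \<xi> \<phi>"
  shows "\<phi> 1 \<in> chart_domain \<xi>" "\<Theta> \<xi> (\<phi> 1) = u"
proof -
  obtain \<zeta> where \<zeta>: "\<zeta> \<in> ball \<xi>\<^sub>0 R" "\<Theta> \<xi> \<zeta> = u" using Theta_onto[OF assms(1), of u] assms(2) by auto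
  have "\<phi> 1 = \<zeta>" using endpoint_eq[of \<xi> \<zeta> \<phi>] ball_N[OF assms(1), of \<zeta>] \<zeta> assms(3) by auto
  then show "\<phi> 1 \<in> chart_domain \<xi>" "\<Theta> \<xi> (\<phi> 1) = u" using \<zeta> assms(2) by (auto simp: chart_domain_def)
qed

lemma canonical_coordinates_chart:
  assumes "\<xi> \<in> ball \<xi>\<^sub>0 R\<^sub>1"
  obtains \<phi> where "canonical_coordinates (\<lambda>k. iter_bracket X (\<beta> k)) (chart_domain \<xi>) (\<Theta> \<xi>) \<xi> \<epsilon> \<phi>"
proof -
  let ?G = "chart_domain \<xi>"
  have sub: "?G \<subseteq> ball \<xi>\<^sub>0 R" by (auto simp: chart_domain_def)
  have GN: "(\<xi>, \<zeta>) \<in> N" if "\<zeta> \<in> ?G" for \<zeta> using ball_N[OF assms] sub that ball_subset_cball by blast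
  have "\<exists>\<phi>. integral_curve \<Omega> (comb_field X \<beta> (\<Theta> \<xi> \<zeta>)) \<xi> \<phi> \<and> \<phi> 1 = \<zeta>" if "\<zeta> \<in> ?G" for \<zeta>
    using Theta_curve[OF GN[OF that]] by blast
  then obtain \<phi> where \<phi>: "\<And>\<zeta>. \<zeta> \<in> ?G \<Longrightarrow> integral_curve \<Omega> (comb_field X \<beta> (\<Theta> \<xi> \<zeta>)) \<xi> (\<phi> \<zeta>)"
    "\<And>\<zeta>. \<zeta> \<in> ?G \<Longrightarrow> \<phi> \<zeta> 1 = \<zeta>" by metis
  have ray: "\<phi> \<zeta> t \<in> ?G" "\<Theta> \<xi> (\<phi> \<zeta> t) = t *\<^sub>R \<Theta> \<xi> \<zeta>" if "\<zeta> \<in> ?G" "t \<in> {0..1}" for \<zeta> t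
  proof -
    have "t * norm (\<Theta> \<xi> \<zeta>) \<le> 1 * norm (\<Theta> \<xi> \<zeta>)" using that by (intro mult_right_mono) auto
    then have "norm (t *\<^sub>R \<Theta> \<xi> \<zeta>) < \<epsilon>" using that by (auto simp: chart_domain_def)
    \<comment> \<open>The point of the ray at time t is the endpoint at time 1 of the curve whose
      coefficients are t times those of the ray.\<close>
    moreover have "integral_curve \<Omega> (comb_field X \<beta> (t *\<^sub>R \<Theta> \<xi> \<zeta>)) \<xi> (\<lambda>s. \<phi> \<zeta> (t * s))"
      using integral_curve_affine[OF \<phi>(1)[OF that(1)], of t 0] \<phi>(1)[OF that(1)] that(2)
      by (simp add: mult_le_one integral_curve_def)
    ultimately show "\<phi> \<zeta> t \<in> ?G" "\<Theta> \<xi> (\<phi> \<zeta> t) = t *\<^sub>R \<Theta> \<xi> \<zeta>"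
      using endpoint_coordinates[OF assms] by force+
  qed
  show thesis
  proof (rule that[of \<phi>], unfold_locales)
    have "continuous_on (ball \<xi>\<^sub>0 R) (\<lambda>\<zeta>. norm (\<Theta> \<xi> \<zeta>))"
      by (intro continuous_on_norm smooth_on_continuous smooth_Theta assms)
    from continuous_open_preimage[OF this open_ball, of "{..<\<epsilon>}"]
    moreover have "?G = ball \<xi>\<^sub>0 R \<inter> (\<lambda>\<zeta>. norm (\<Theta> \<xi> \<zeta>)) -` {..<\<epsilon>}"
      by (auto simp: chart_domain_def)
    ultimately show "open ?G" by simp
    have G\<Omega>: "?G \<subseteq> \<Omega>" using sub cball_\<Omega> ball_subset_cball by blast
    show "smooth_on (Y k) ?G" for k
      by (rule smooth_on_subset[OF smooth_bracket[OF \<beta>_multiindex] G\<Omega>])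
    show "smooth_on (\<Theta> \<xi>) ?G" by (rule smooth_on_subset[OF smooth_Theta[OF assms] sub])
    show "0 < \<epsilon>" by (rule radii)
    show "ball 0 \<epsilon> \<subseteq> \<Theta> \<xi> ` ?G"
      using Theta_onto[OF assms] by (fastforce simp: chart_domain_def image_iff)
    fix \<zeta> assume \<zeta>: "\<zeta> \<in> ?G"
    show "\<phi> \<zeta> 0 = \<xi>" using \<phi>(1)[OF \<zeta>] by (simp add: integral_curve_def)
    show "\<phi> \<zeta> 1 = \<zeta>" by (rule \<phi>(2)[OF \<zeta>])
    fix t :: real assume t: "t \<in> {0..1}"
    show "\<phi> \<zeta> t \<in> ?G" "\<Theta> \<xi> (\<phi> \<zeta> t) = t *\<^sub>R \<Theta> \<xi> \<zeta>" using ray[OF \<zeta> t] by auto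
    show "(\<phi> \<zeta> has_vector_derivative (\<Sum>k\<in>UNIV. (\<Theta> \<xi> \<zeta> $ k) *\<^sub>R Y k (\<phi> \<zeta> t))) (at t within {0..1})"
      using \<phi>(1)[OF \<zeta>] t by (simp add: integral_curve_def comb_field_def)
  qed
qed

end

subsection \<open>Admissible curves in canonical coordinates\<close>

text \<open>First exit time: before it the curve is in U, hence up to and including it in the closed
  set C, and the step then puts it back into U.\<close>

lemma stays_in_open:
  fixes \<phi> :: "real \<Rightarrow> 'a::topological_space"
  assumes cont: "continuous_on {0..1} \<phi>" and "open U" "closed C" "U \<subseteq> C" "\<phi> 0 \<in> U"
    and step: "\<And>t. t \<in> {0..1} \<Longrightarrow> \<phi> ` {0..t} \<subseteq> C \<Longrightarrow> \<phi> t \<in> U"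
    and "t \<in> {0..1}"
  shows "\<phi> t \<in> U"
proof (rule ccontr)
  assume "\<phi> t \<notin> U"
  define D where "D = {0..1} \<inter> \<phi> -` (- U)"
  have "closed D" unfolding D_def
    by (rule continuous_closed_preimage[OF cont]) (use assms(2) in auto)
  then have "compact D" unfolding D_def using compact_Icc by (metis Int_absorb1 Int_lower1 compact_Int_closed)
  moreover have "t \<in> D" using \<open>\<phi> t \<notin> U\<close> assms(7) by (simp add: D_def)
  ultimately obtain m where m: "m \<in> D" "\<And>s. s \<in> D \<Longrightarrow> m \<le> s"
    using compact_attains_inf[of D] by blast
  have m01: "m \<in> {0..1}" "\<phi> m \<notin> U" using m(1) by (auto simp: D_def)
  then have "0 < m" using assms(5) by (cases "m = 0") auto
  have "closed ({0..1} \<inter> \<phi> -` C)"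
    by (rule continuous_closed_preimage[OF cont _ assms(3)]) simp
  moreover have "{0..<m} \<subseteq> {0..1} \<inter> \<phi> -` C"
  proof
    fix s assume s: "s \<in> {0..<m}"
    then have "s \<notin> D" using m(2) by force
    then show "s \<in> {0..1} \<inter> \<phi> -` C" using s m01 assms(4) by (auto simp: D_def)
  qed
  ultimately have "closure {0..<m} \<subseteq> {0..1} \<inter> \<phi> -` C" by (rule closure_minimal[rotated])
  then have "\<phi> ` {0..m} \<subseteq> C" using \<open>0 < m\<close> by auto
  then show False using step[OF m01(1)] m01(2) by blast
qed

lemma AE_lebesgue_on_negligible:
  fixes a b :: real
  assumes "AE t in lebesgue_on {a..b}. P t"
  obtains Z where "negligible Z" "\<And>t. t \<in> {a..b} - Z \<Longrightarrow> P t"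
proof -
  have "AE t in lebesgue. t \<in> {a..b} \<longrightarrow> P t"
    by (rule iffD1[OF AE_restrict_space_iff assms]) simp
  then obtain Z where Z: "Z \<in> null_sets lebesgue" "{t \<in> space lebesgue. \<not> (t \<in> {a..b} \<longrightarrow> P t)} \<subseteq> Z"
    unfolding eventually_ae_filter by blast
  show thesis by (rule that[of Z]) (use Z in \<open>auto simp: negligible_iff_null_sets\<close>)
qed

text \<open>As l is at most i, the power of \<delta> in front cancels the \<delta> in the
  denominator; as l is at least 1, a factor 1 / K survives. The power of M does no harm, because M
  is fixed before K.\<close>

lemma weighted_power_bound:
  fixes \<delta> M K :: real
  assumes "0 < \<delta>" "\<delta> \<le> 1" "1 \<le> M" "1 \<le> K" "1 \<le> l" "l \<le> i" "k \<le> r"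
  shows "\<delta> ^ i * ((M * (K * \<delta>)) ^ k / (M * (K * \<delta>)) ^ l) \<le> (K * \<delta>) ^ k * M ^ r / K"
proof -
  have "\<delta> ^ i * ((M * (K * \<delta>)) ^ k / (M * (K * \<delta>)) ^ l) \<le>
      \<delta> ^ l * ((M * (K * \<delta>)) ^ k / (M * (K * \<delta>)) ^ l)"
    using assms by (intro mult_right_mono power_decreasing) auto
  also have "\<dots> = (M * (K * \<delta>)) ^ k / (M * K) ^ l"
    using assms by (simp add: power_mult_distrib)
  also have "\<dots> \<le> (M * (K * \<delta>)) ^ k / K"
  proof (rule divide_left_mono)
    have "1 * K \<le> M * K" using assms by (intro mult_right_mono) auto
    also have "\<dots> \<le> (M * K) ^ l"
      using assms mult_mono[of 1 M 1 K] by (intro self_le_power) auto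
    finally show "K \<le> (M * K) ^ l" by simp
  qed (use assms in auto)
  also have "\<dots> = (K * \<delta>) ^ k * M ^ k / K" by (simp add: power_mult_distrib)
  also have "\<dots> \<le> (K * \<delta>) ^ k * M ^ r / K"
    using assms by (intro divide_right_mono mult_left_mono power_increasing) auto
  finally show ?thesis .
qed

context uniform_chart
begin

text \<open>A bracket of weight |I| involves only basis fields of weight at most |I|, and
  \<open>\<alpha>_bound\<close> controls these in the chart. Multiplied by
  \<open>\<delta> ^ weight I\<close> its components are of order 1 / K relative to the sides of the
  box, so a large K brings the total speed below half a side per unit time.\<close>

lemma coordinate_speed_bound:
  obtains M K where "1 \<le> M" "1 \<le> K"
    "\<And>\<xi> \<zeta> \<delta> a k. \<xi> \<in> ball \<xi>\<^sub>0 R\<^sub>1 \<Longrightarrow> \<zeta> \<in> chart_domain \<xi> \<Longrightarrow> 0 < \<delta> \<Longrightarrow> M * (K * \<delta>) \<le> 1 \<Longrightarrow>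
      (\<And>k. \<bar>\<Theta> \<xi> \<zeta> $ k\<bar> \<le> (K * \<delta>) ^ w k) \<Longrightarrow>
      (\<And>I. I \<in> multiindices n r \<Longrightarrow> \<bar>a I\<bar> \<le> \<delta> ^ weight I) \<Longrightarrow>
      \<bar>frechet_derivative (\<Theta> \<xi>) (at \<zeta>) (\<Sum>I\<in>multiindices n r. a I *\<^sub>R iter_bracket X I \<zeta>) $ k\<bar>
        \<le> (K * \<delta>) ^ w k / 2"
proof -
  let ?I = "multiindices n r"
  obtain F where F: "0 < F"
    "\<And>z I. z \<in> cball \<xi>\<^sub>0 R \<Longrightarrow> I \<in> ?I \<Longrightarrow> \<exists>c. iter_bracket X I z = (\<Sum>l\<in>UNIV. c l *\<^sub>R Y l z) \<and>
      (\<forall>l. \<bar>c l\<bar> \<le> F) \<and> (\<forall>l. weight I < w l \<longrightarrow> c l = 0)"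
    "\<And>z j k. z \<in> cball \<xi>\<^sub>0 R \<Longrightarrow> \<exists>c. lie_bracket (Y j) (Y k) z = (\<Sum>l\<in>UNIV. c l *\<^sub>R Y l z) \<and>
      (\<forall>l. \<bar>c l\<bar> \<le> F) \<and> (\<forall>l. w j + w k < w l \<longrightarrow> c l = 0)"
    using coefficient_bound[OF compact_cball cball_\<Omega>] by blast
  define p where "p = real CARD('p)"
  \<comment> \<open>M is what \<open>\<alpha>_bound\<close> asks for. Q collects the numbers of
    brackets and of basis fields with their bounds; it involves M but not K. The choice of K makes Q
    / K at most 1/2.\<close>
  define M where "M = max 1 (16 * p * p * F)"
  define Q where "Q = real (card ?I) * p * (2 * F * M ^ r)"
  define K where "K = 1 + 2 * Q"
  have M: "1 \<le> M" "16 * p * p * F \<le> M" by (auto simp: M_def)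
  have Q: "0 \<le> Q" using F(1) M(1) by (simp add: Q_def p_def)
  then have K: "1 \<le> K" by (simp add: K_def)
  show thesis
  proof (rule that[OF M(1) K])
    fix \<xi> \<zeta> :: "real ^ 'p" and \<delta> :: real and a :: "nat list \<Rightarrow> real" and k :: 'p
    assume \<xi>: "\<xi> \<in> ball \<xi>\<^sub>0 R\<^sub>1" and \<zeta>: "\<zeta> \<in> chart_domain \<xi>" and \<delta>: "0 < \<delta>" and small: "M * (K * \<delta>) \<le> 1"
      and u: "\<And>k. \<bar>\<Theta> \<xi> \<zeta> $ k\<bar> \<le> (K * \<delta>) ^ w k"
      and a: "\<And>I. I \<in> ?I \<Longrightarrow> \<bar>a I\<bar> \<le> \<delta> ^ weight I"
    obtain \<phi> where cc: "canonical_coordinates Y (chart_domain \<xi>) (\<Theta> \<xi>) \<xi> \<epsilon> \<phi>"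
      using canonical_coordinates_chart[OF \<xi>] by blast
    interpret cc: canonical_coordinates Y "chart_domain \<xi>" "\<Theta> \<xi>" \<xi> \<epsilon> \<phi> by (rule cc)
    have sub: "z \<in> cball \<xi>\<^sub>0 R" if "z \<in> chart_domain \<xi>" for z using that by (simp add: chart_domain_def)
    have "1 * \<delta> \<le> (M * K) * \<delta>" using M(1) K \<delta> mult_mono[of 1 M 1 K] by (intro mult_right_mono) auto
    then have \<delta>1: "\<delta> \<le> 1" using small by (simp add: mult.assoc)
    define \<mu> where "\<mu> = M * (K * \<delta>)"
    have \<mu>: "0 < \<mu>" using M(1) K \<delta> by (simp add: \<mu>_def)
    \<comment> \<open>The factor 2 absorbs the entry of the identity matrix, because on the diagonal
      the quotient of the scales is 1.\<close>
    have \<alpha>: "\<bar>cc.\<alpha> l \<zeta> $ k\<bar> \<le> 2 * (\<mu> ^ w k / \<mu> ^ w l)" for l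
    proof -
      have "\<bar>cc.\<alpha> l \<zeta> $ k - (if l = k then 1 else 0)\<bar> \<le> \<mu> ^ w k / \<mu> ^ w l"
        unfolding \<mu>_def
      proof (rule cc.\<alpha>_bound[OF \<zeta> _ F(3)])
        show "0 < K * \<delta>" using K \<delta> by simp
        show "16 * real CARD('p) * real CARD('p) * F \<le> M" using M(2) by (simp add: p_def)
      qed (use sub u M(1) small w_bounds in auto)
      moreover have "\<mu> ^ w k / \<mu> ^ w l = 1" if "l = k" using that \<mu> by simp
      moreover have "0 \<le> \<mu> ^ w k / \<mu> ^ w l" using \<mu> by simp
      ultimately show ?thesis by (cases "l = k") auto
    qed
    have summand: "\<bar>a I * (frechet_derivative (\<Theta> \<xi>) (at \<zeta>) (iter_bracket X I \<zeta>) $ k)\<bar> \<le>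
        p * (2 * F * M ^ r) * ((K * \<delta>) ^ w k / K)" if I: "I \<in> ?I" for I
    proof -
      obtain c where c: "iter_bracket X I \<zeta> = (\<Sum>l\<in>UNIV. c l *\<^sub>R Y l \<zeta>)"
        "\<And>l. \<bar>c l\<bar> \<le> F" "\<And>l. weight I < w l \<Longrightarrow> c l = 0"
        using F(2)[OF sub[OF \<zeta>] I] by blast
      have "frechet_derivative (\<Theta> \<xi>) (at \<zeta>) (iter_bracket X I \<zeta>) = (\<Sum>l\<in>UNIV. c l *\<^sub>R cc.\<alpha> l \<zeta>)"
        unfolding c(1) cc.\<alpha>_def
        by (rule lie_deriv_linear_field[OF smooth_on_differentiable[OF cc.smooth_\<theta> \<zeta>]])
      then have "\<bar>a I * (frechet_derivative (\<Theta> \<xi>) (at \<zeta>) (iter_bracket X I \<zeta>) $ k)\<bar> =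
          \<bar>\<Sum>l\<in>UNIV. a I * (c l * cc.\<alpha> l \<zeta> $ k)\<bar>"
        by (simp add: sum_distrib_left)
      also have "\<dots> \<le> (\<Sum>l\<in>(UNIV::'p set). 2 * F * ((K * \<delta>) ^ w k * M ^ r / K))"
      proof (rule order_trans[OF sum_abs sum_mono])
        fix l
        show "\<bar>a I * (c l * cc.\<alpha> l \<zeta> $ k)\<bar> \<le> 2 * F * ((K * \<delta>) ^ w k * M ^ r / K)"
        proof (cases "weight I < w l")
          case True
          then show ?thesis using c(3)[OF True] F(1) K M(1) \<delta> by simp
        next
          case False
          have "\<bar>a I * (c l * cc.\<alpha> l \<zeta> $ k)\<bar> \<le> \<delta> ^ weight I * (F * (2 * (\<mu> ^ w k / \<mu> ^ w l)))"
            unfolding abs_mult using \<delta> F(1) by (intro mult_mono a I c \<alpha>) auto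
          also have "\<dots> = 2 * F * (\<delta> ^ weight I * (\<mu> ^ w k / \<mu> ^ w l))" by simp
          also have "\<dots> \<le> 2 * F * ((K * \<delta>) ^ w k * M ^ r / K)"
            unfolding \<mu>_def using False F(1)
            by (intro mult_left_mono weighted_power_bound \<delta> \<delta>1 M(1) K w_bounds) auto
          finally show ?thesis .
        qed
      qed
      also have "\<dots> = p * (2 * F * M ^ r) * ((K * \<delta>) ^ w k / K)" by (simp add: p_def)
      finally show ?thesis .
    qed
    have lin: "linear (frechet_derivative (\<Theta> \<xi>) (at \<zeta>))"
      using smooth_on_has_derivative[OF cc.smooth_\<theta> \<zeta>] has_derivative_linear by blast
    have "\<bar>frechet_derivative (\<Theta> \<xi>) (at \<zeta>) (\<Sum>I\<in>?I. a I *\<^sub>R iter_bracket X I \<zeta>) $ k\<bar> =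
        \<bar>\<Sum>I\<in>?I. a I * (frechet_derivative (\<Theta> \<xi>) (at \<zeta>) (iter_bracket X I \<zeta>) $ k)\<bar>"
      by (simp add: linear_sum[OF lin] linear_scale[OF lin])
    also have "\<dots> \<le> (\<Sum>I\<in>?I. p * (2 * F * M ^ r) * ((K * \<delta>) ^ w k / K))"
      by (rule order_trans[OF sum_abs sum_mono[OF summand]])
    also have "\<dots> = Q / K * (K * \<delta>) ^ w k" by (simp add: Q_def)
    also have "\<dots> \<le> 1 / 2 * (K * \<delta>) ^ w k"
      using K \<delta> Q by (intro mult_right_mono) (auto simp: K_def field_simps)
    finally show "\<bar>frechet_derivative (\<Theta> \<xi>) (at \<zeta>) (\<Sum>I\<in>?I. a I *\<^sub>R iter_bracket X I \<zeta>) $ k\<bar>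
        \<le> (K * \<delta>) ^ w k / 2" by simp
  qed
qed

text \<open>Closed in the whole space and not merely in the chart domain: the box of coordinates is
  compact and lies inside the image, and the continuous inverse of the chart carries it over. A
  curve in the box thus cannot escape through the boundary of the chart.\<close>

lemma closed_coordinate_box:
  assumes "\<xi> \<in> ball \<xi>\<^sub>0 R\<^sub>1" "0 \<le> \<mu>" "\<mu> \<le> 1" "real CARD('p) * \<mu> < \<epsilon>"
  shows "closed {\<zeta> \<in> chart_domain \<xi>. \<forall>k. \<bar>\<Theta> \<xi> \<zeta> $ k\<bar> \<le> \<mu> ^ w k}"
proof -
  let ?G = "chart_domain \<xi>" and ?B = "{u::real ^ 'p. \<forall>k. \<bar>u $ k\<bar> \<le> \<mu> ^ w k}"
  obtain \<phi> where cc: "canonical_coordinates Y ?G (\<Theta> \<xi>) \<xi> \<epsilon> \<phi>"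
    using canonical_coordinates_chart[OF assms(1)] by blast
  interpret cc: canonical_coordinates Y ?G "\<Theta> \<xi>" \<xi> \<epsilon> \<phi> by (rule cc)
  have "inj_on (\<Theta> \<xi>) ?G"
    by (rule inj_onI, rule Theta_inj[of \<xi>]) (use ball_N[OF assms(1)] in \<open>auto simp: chart_domain_def\<close>)
  then obtain g where g: "homeomorphism ?G (\<Theta> \<xi> ` ?G) (\<Theta> \<xi>) g"
    using invariance_of_domain_homeomorphism[OF cc.open_G smooth_on_continuous[OF cc.smooth_\<theta>]] by auto
  have nB: "norm u \<le> real CARD('p) * \<mu>" if "u \<in> ?B" for u
  proof -
    have "norm u \<le> (\<Sum>k\<in>UNIV. \<bar>u $ k\<bar>)" by (rule norm_le_l1_cart)
    also have "\<dots> \<le> (\<Sum>k\<in>(UNIV::'p set). \<mu>)"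
    proof (rule sum_mono)
      fix k
      have "\<mu> ^ w k \<le> \<mu> ^ 1" using assms(2,3) w_bounds by (intro power_decreasing) auto
      then show "\<bar>u $ k\<bar> \<le> \<mu>" using that by (metis (mono_tags) mem_Collect_eq order_trans power_one_right)
    qed
    finally show ?thesis by simp
  qed
  have "closed ?B" by (intro closed_Collect_all closed_Collect_le continuous_intros)
  moreover have "bounded ?B" unfolding bounded_iff using nB by blast
  ultimately have "compact ?B" by (simp add: compact_eq_bounded_closed)
  have BG: "?B \<subseteq> \<Theta> \<xi> ` ?G"
  proof
    fix u assume "u \<in> ?B"
    then have "u \<in> ball 0 \<epsilon>" using nB[of u] assms(4) by simp
    then show "u \<in> \<Theta> \<xi> ` ?G" using cc.e(2) by blast
  qed
  have "continuous_on ?B g"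
    by (rule continuous_on_subset[OF _ BG]) (use g in \<open>simp add: homeomorphism_def\<close>)
  from compact_continuous_image[OF this \<open>compact ?B\<close>] have "compact (g ` ?B)" .
  moreover have "g ` ?B = {\<zeta> \<in> ?G. \<Theta> \<xi> \<zeta> \<in> ?B}"
  proof
    show "g ` ?B \<subseteq> {\<zeta> \<in> ?G. \<Theta> \<xi> \<zeta> \<in> ?B}"
    proof
      fix z assume "z \<in> g ` ?B"
      then obtain u where u: "u \<in> ?B" "z = g u" by blast
      then have "u \<in> \<Theta> \<xi> ` ?G" using BG by blast
      then have "z \<in> ?G" "\<Theta> \<xi> z = u" using g u(2) unfolding homeomorphism_def by auto
      then show "z \<in> {\<zeta> \<in> ?G. \<Theta> \<xi> \<zeta> \<in> ?B}" using u(1) by blast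
    qed
    show "{\<zeta> \<in> ?G. \<Theta> \<xi> \<zeta> \<in> ?B} \<subseteq> g ` ?B"
    proof
      fix z assume z: "z \<in> {\<zeta> \<in> ?G. \<Theta> \<xi> \<zeta> \<in> ?B}"
      then have "g (\<Theta> \<xi> z) = z" using g unfolding homeomorphism_def by auto
      then show "z \<in> g ` ?B" using z by (metis (mono_tags, lifting) imageI mem_Collect_eq)
    qed
  qed
  ultimately show ?thesis using compact_imp_closed by simp
qed

lemma admissible_coordinate_bound:
  obtains K \<delta>\<^sub>0 where "1 \<le> K" "0 < \<delta>\<^sub>0"
    "\<And>\<xi> \<phi> \<delta> k. \<xi> \<in> ball \<xi>\<^sub>0 R\<^sub>1 \<Longrightarrow> 0 < \<delta> \<Longrightarrow> \<delta> \<le> \<delta>\<^sub>0 \<Longrightarrow> \<phi> \<in> admissible_curves n r \<Omega> X \<delta> \<Longrightarrow>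
      \<phi> 0 = \<xi> \<Longrightarrow> \<bar>\<Theta> \<xi> (\<phi> 1) $ k\<bar> \<le> (K * \<delta>) ^ w k"
proof -
  obtain M K where MK: "1 \<le> M" "1 \<le> K" and speed:
    "\<And>\<xi> \<zeta> \<delta> a k. \<xi> \<in> ball \<xi>\<^sub>0 R\<^sub>1 \<Longrightarrow> \<zeta> \<in> chart_domain \<xi> \<Longrightarrow> 0 < \<delta> \<Longrightarrow> M * (K * \<delta>) \<le> 1 \<Longrightarrow>
      (\<And>k. \<bar>\<Theta> \<xi> \<zeta> $ k\<bar> \<le> (K * \<delta>) ^ w k) \<Longrightarrow>
      (\<And>I. I \<in> multiindices n r \<Longrightarrow> \<bar>a I\<bar> \<le> \<delta> ^ weight I) \<Longrightarrow>
      \<bar>frechet_derivative (\<Theta> \<xi>) (at \<zeta>) (\<Sum>I\<in>multiindices n r. a I *\<^sub>R iter_bracket X I \<zeta>) $ k\<bar>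
        \<le> (K * \<delta>) ^ w k / 2"
    using coordinate_speed_bound by blast
  define p where "p = real CARD('p)"
  have p: "0 < p" by (simp add: p_def)
  \<comment> \<open>The first bound gives \<open>M * \<mu> \<le> 1\<close> for the frame estimate,
    the second keeps the box of size \<mu> inside the ball of coordinates.\<close>
  define \<delta>\<^sub>0 where "\<delta>\<^sub>0 = min (1 / (M * K)) (\<epsilon> / (2 * p * K))"
  have \<delta>0: "0 < \<delta>\<^sub>0" using MK radii(4) p by (simp add: \<delta>\<^sub>0_def)
  show thesis
  proof (rule that[OF MK(2) \<delta>0])
    fix \<xi> \<phi> \<delta> k
    assume \<xi>: "\<xi> \<in> ball \<xi>\<^sub>0 R\<^sub>1" and \<delta>: "0 < \<delta>" "\<delta> \<le> \<delta>\<^sub>0"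
      and adm: "\<phi> \<in> admissible_curves n r \<Omega> X \<delta>" and \<phi>0: "\<phi> 0 = \<xi>"
    define \<mu> where "\<mu> = K * \<delta>"
    have \<mu>: "0 < \<mu>" using MK \<delta> by (simp add: \<mu>_def)
    have "\<delta> \<le> 1 / (M * K)" "\<delta> \<le> \<epsilon> / (2 * p * K)" using \<delta>(2) by (auto simp: \<delta>\<^sub>0_def)
    then have M\<mu>: "M * \<mu> \<le> 1" and p2: "2 * (p * \<mu>) \<le> \<epsilon>"
      using MK p by (auto simp: \<mu>_def field_simps)
    have p\<mu>: "p * \<mu> < \<epsilon>" using p2 p \<mu> mult_pos_pos[OF p \<mu>] by linarith
    have "1 * \<mu> \<le> M * \<mu>" using MK \<mu> by (intro mult_right_mono) auto
    then have \<mu>1: "\<mu> \<le> 1" using M\<mu> by simp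
    obtain a where ac: "abs_continuous_on_interval 0 1 \<phi>" and \<phi>\<Omega>: "\<phi> ` {0..1} \<subseteq> \<Omega>"
      and a: "\<forall>I\<in>multiindices n r. \<forall>t\<in>{0..1}. \<bar>a I t\<bar> \<le> \<delta> ^ weight I"
      and ae: "AE t in lebesgue_on {0..1}. (\<phi> has_vector_derivative
                  (\<Sum>I\<in>multiindices n r. a I t *\<^sub>R iter_bracket X I (\<phi> t))) (at t within {0..1})"
      using adm unfolding admissible_curves_def by blast
    obtain Z where Z: "negligible Z" "\<And>t. t \<in> {0..1} - Z \<Longrightarrow> (\<phi> has_vector_derivative
                  (\<Sum>I\<in>multiindices n r. a I t *\<^sub>R iter_bracket X I (\<phi> t))) (at t within {0..1})"
      using AE_lebesgue_on_negligible[OF ae] by blast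
    let ?G = "chart_domain \<xi>"
    let ?C = "{\<zeta> \<in> ?G. \<forall>k. \<bar>\<Theta> \<xi> \<zeta> $ k\<bar> \<le> \<mu> ^ w k}"
    let ?U = "{\<zeta> \<in> ?G. \<forall>k. \<bar>\<Theta> \<xi> \<zeta> $ k\<bar> < \<mu> ^ w k}"
    obtain \<psi> where cc: "canonical_coordinates Y ?G (\<Theta> \<xi>) \<xi> \<epsilon> \<psi>"
      using canonical_coordinates_chart[OF \<xi>] by blast
    interpret cc: canonical_coordinates Y ?G "\<Theta> \<xi>" \<xi> \<epsilon> \<psi> by (rule cc)
    have self: "\<Theta> \<xi> \<xi> = 0" by (rule Theta_self[OF ball_\<Omega>[OF \<xi>]])
    have "\<phi> 1 \<in> ?U"
    proof (rule stays_in_open[where C = ?C])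
      show "continuous_on {0..1} \<phi>" by (rule abs_continuous_imp_continuous[OF ac])
      have "open (\<Inter>k\<in>UNIV. {u::real ^ 'p. \<bar>u $ k\<bar> < \<mu> ^ w k})"
        by (intro open_INT ballI open_Collect_less continuous_intros) auto
      from continuous_open_preimage[OF smooth_on_continuous[OF cc.smooth_\<theta>] cc.open_G this]
      have "open (?G \<inter> \<Theta> \<xi> -` (\<Inter>k\<in>UNIV. {u. \<bar>u $ k\<bar> < \<mu> ^ w k}))" .
      moreover have "?U = ?G \<inter> \<Theta> \<xi> -` (\<Inter>k\<in>UNIV. {u. \<bar>u $ k\<bar> < \<mu> ^ w k})" by auto
      ultimately show "open ?U" by (rule ssubst[rotated])
      show "closed ?C"
        using closed_coordinate_box[OF \<xi>, of \<mu>] \<mu> \<mu>1 p\<mu> by (simp add: p_def)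
      show "?U \<subseteq> ?C" by (auto intro: less_imp_le)
      show "\<phi> 0 \<in> ?U" using \<xi> radii \<mu> by (auto simp: \<phi>0 self chart_domain_def)
      fix t :: real assume t: "t \<in> {0..1}" and C': "\<phi> ` {0..t} \<subseteq> ?C"
      have C: "\<phi> s \<in> ?C" if "s \<in> {0..t}" for s using C' that by blast
      have "\<bar>\<Theta> \<xi> (\<phi> t) $ k\<bar> < \<mu> ^ w k" for k
      proof -
        have "cball \<xi>\<^sub>0 R \<subseteq> {\<zeta>. (\<xi>, \<zeta>) \<in> N}" using ball_N[OF \<xi>] by blast
        \<comment> \<open>L may depend on \<xi>, since it serves only to pass absolute continuity on
          to the coordinates.\<close>
        then obtain L where L: "0 \<le> L" "\<And>x y. x \<in> cball \<xi>\<^sub>0 R \<Longrightarrow> y \<in> cball \<xi>\<^sub>0 R \<Longrightarrow>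
            norm (\<Theta> \<xi> x - \<Theta> \<xi> y) \<le> L * norm (x - y)"
          using smooth_on_lipschitz[OF Theta_slice(2)[OF ball_\<Omega>[OF \<xi>]] compact_cball convex_cball] by blast
        have acg: "abs_continuous_on_interval 0 t (\<lambda>s. \<Theta> \<xi> (\<phi> s) $ k)"
        proof (rule abs_continuous_compose_lipschitz[OF abs_continuous_subinterval[OF ac] L(1)])
          fix x y assume "x \<in> {0..t}" "y \<in> {0..t}"
          then have "\<phi> x \<in> cball \<xi>\<^sub>0 R" "\<phi> y \<in> cball \<xi>\<^sub>0 R"
            using C[of x] C[of y] by (auto simp: chart_domain_def)
          from L(2)[OF this(2,1)] component_le_norm_cart[of "\<Theta> \<xi> (\<phi> y) - \<Theta> \<xi> (\<phi> x)" k]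
          show "norm (\<Theta> \<xi> (\<phi> y) $ k - \<Theta> \<xi> (\<phi> x) $ k) \<le> L * norm (\<phi> y - \<phi> x)" by simp
        qed (use t in auto)
        \<comment> \<open>The coordinate starts at 0 and covers at most half the side within unit
          time; this is the strict inequality that keeps the curve in the open box.\<close>
        have "norm (\<Theta> \<xi> (\<phi> t) $ k - \<Theta> \<xi> (\<phi> 0) $ k) \<le> \<mu> ^ w k / 2 * (t - 0)"
        proof (rule abs_continuous_mean_value[OF acg _ _ Z(1)])
          fix s assume s: "s \<in> {0..t} - Z"
          let ?v = "\<Sum>I\<in>multiindices n r. a I s *\<^sub>R iter_bracket X I (\<phi> s)"
          let ?D = "frechet_derivative (\<Theta> \<xi>) (at (\<phi> s))"
          have \<phi>s: "\<phi> s \<in> ?G" "\<And>k. \<bar>\<Theta> \<xi> (\<phi> s) $ k\<bar> \<le> (K * \<delta>) ^ w k"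
            using C[of s] s by (auto simp: \<mu>_def)
          have "(\<phi> has_vector_derivative ?v) (at s within {0..t})"
            by (rule has_vector_derivative_within_subset[OF Z(2)]) (use s t in auto)
          from vector_derivative_diff_chain_within[OF this
              has_derivative_at_withinI[OF smooth_on_has_derivative[OF cc.smooth_\<theta> \<phi>s(1)]]]
          have "((\<lambda>s. \<Theta> \<xi> (\<phi> s)) has_vector_derivative ?D ?v) (at s within {0..t})"
            by (simp add: o_def)
          then have "((\<lambda>s. \<Theta> \<xi> (\<phi> s) $ k) has_vector_derivative ?D ?v $ k) (at s within {0..t})"
            by (rule bounded_linear.has_vector_derivative[OF bounded_linear_vec_nth])
          moreover have "\<bar>?D ?v $ k\<bar> \<le> \<mu> ^ w k / 2"
            unfolding \<mu>_def
            by (rule speed[OF \<xi> \<phi>s(1) \<delta>(1) _ \<phi>s(2)]) (use M\<mu> a s t in \<open>auto simp: \<mu>_def\<close>)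
          ultimately show "\<exists>D. ((\<lambda>s. \<Theta> \<xi> (\<phi> s) $ k) has_vector_derivative D) (at s within {0..t}) \<and>
              norm D \<le> \<mu> ^ w k / 2" by auto
        qed (use t \<mu> in auto)
        also have "\<dots> \<le> \<mu> ^ w k / 2" using t \<mu> mult_left_mono[of t 1 "\<mu> ^ w k / 2"] by simp
        also have "\<dots> < \<mu> ^ w k" using \<mu> by simp
        finally show ?thesis by (simp add: \<phi>0 self)
      qed
      moreover have "\<phi> t \<in> ?G" using C[of t] t by simp
      ultimately show "\<phi> t \<in> ?U" by blast
    qed simp
    then show "\<bar>\<Theta> \<xi> (\<phi> 1) $ k\<bar> \<le> (K * \<delta>) ^ w k" by (auto simp: \<mu>_def intro: less_imp_le)
  qed
qed

end

subsection \<open>The quasidistance\<close>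

context free_frame
begin

text \<open>The class demands the coefficient bounds at every time but the equation only almost
  everywhere. The coefficients are therefore set to 0 at the finitely many exceptional times, which
  permits corners, and on multiindices outside the basis.\<close>

lemma lipschitz_admissible:
  assumes lip: "L-lipschitz_on {0..1} \<phi>" and "\<phi> ` {0..1} \<subseteq> \<Omega>" "finite S" "0 \<le> \<delta>"
    and der: "\<And>t. t \<in> {0..1} - S \<Longrightarrow> \<exists>v. (\<phi> has_vector_derivative comb_field X \<beta> v (\<phi> t)) (at t within {0..1}) \<and>
      (\<forall>k. \<bar>v $ k\<bar> \<le> \<delta> ^ w k)"
  shows "\<phi> \<in> admissible_curves n r \<Omega> X \<delta>"
proof -
  have inj: "inj \<beta>" using basis unfolding bracket_basis_def by blast
  obtain v where v: "\<And>t. t \<in> {0..1} - S \<Longrightarrow> (\<phi> has_vector_derivative comb_field X \<beta> (v t) (\<phi> t)) (at t within {0..1})"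
    "\<And>t k. t \<in> {0..1} - S \<Longrightarrow> \<bar>v t $ k\<bar> \<le> \<delta> ^ w k"
    using der by metis
  define a where "a I t = (if t \<in> {0..1} - S \<and> I \<in> range \<beta> then v t $ inv \<beta> I else 0)" for I t
  have comb: "(\<Sum>I\<in>multiindices n r. a I t *\<^sub>R iter_bracket X I x) = comb_field X \<beta> (v t) x"
    if "t \<in> {0..1} - S" for t x
  proof -
    have "(\<Sum>I\<in>multiindices n r. a I t *\<^sub>R iter_bracket X I x) = (\<Sum>I\<in>range \<beta>. a I t *\<^sub>R iter_bracket X I x)"
      by (rule sum.mono_neutral_right) (use finite_multiindices \<beta>_multiindex in \<open>auto simp: a_def\<close>)
    also have "\<dots> = comb_field X \<beta> (v t) x"
      using that by (simp add: sum.reindex[OF inj] comb_field_def a_def inv_f_f[OF inj])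
    finally show ?thesis .
  qed
  have "abs_continuous_on_interval 0 1 \<phi>"
    by (rule abs_continuous_compose_lipschitz[OF abs_continuous_ident lipschitz_on_nonneg[OF lip]])
      (use lipschitz_onD[OF lip] in \<open>simp add: dist_norm\<close>)
  moreover have "\<bar>a I t\<bar> \<le> \<delta> ^ weight I" for I t
    using v(2)[of t "inv \<beta> I"] assms(4) by (auto simp: a_def inv_f_f[OF inj])
  moreover have "AE t in lebesgue_on {0..1}. (\<phi> has_vector_derivative
      (\<Sum>I\<in>multiindices n r. a I t *\<^sub>R iter_bracket X I (\<phi> t))) (at t within {0..1})"
  proof -
    have "AE t in lebesgue. t \<notin> S"
      using negligible_finite[OF assms(3)] by (auto simp: negligible_iff_null_sets intro: AE_not_in)
    then have "AE t in lebesgue. t \<in> {0..1} \<longrightarrow> (\<phi> has_vector_derivative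
      (\<Sum>I\<in>multiindices n r. a I t *\<^sub>R iter_bracket X I (\<phi> t))) (at t within {0..1})"
      by (rule AE_mp) (use v(1) comb in \<open>auto intro!: AE_I2\<close>)
    then show ?thesis by (rule iffD2[OF AE_restrict_space_iff, rotated]) simp
  qed
  ultimately show ?thesis
    unfolding admissible_curves_def using assms(2) by blast
qed

lemma integral_curve_lipschitz:
  assumes "integral_curve \<Omega> (comb_field X \<beta> u) \<xi> \<phi>"
  obtains L where "L-lipschitz_on {0..1} \<phi>"
proof -
  have "continuous_on {0..1} (\<lambda>t. comb_field X \<beta> u (\<phi> t))"
    by (rule continuous_on_compose2[OF smooth_on_continuous[OF smooth_comb_field]
          integral_curve_continuous[OF assms]]) (use assms in \<open>auto simp: integral_curve_def\<close>)
  then have "bounded ((\<lambda>t. comb_field X \<beta> u (\<phi> t)) ` {0..1})"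
    by (intro compact_imp_bounded compact_continuous_image compact_Icc)
  then obtain L where L: "\<And>t. t \<in> {0..1} \<Longrightarrow> norm (comb_field X \<beta> u (\<phi> t)) \<le> L"
    unfolding bounded_iff by blast
  show thesis
  proof (rule that[of L], rule lipschitz_onI)
    show "0 \<le> L" using order_trans[OF norm_ge_zero L[of 0]] by simp
    fix s t :: real assume "s \<in> {0..1}" "t \<in> {0..1}"
    then have "norm (\<phi> s - \<phi> t) \<le> L * \<bar>s - t\<bar>"
      using assms by (intro vector_derivative_bound[where D = "\<lambda>t. comb_field X \<beta> u (\<phi> t)", OF convex_real_interval(5) _ L])
        (auto simp: integral_curve_def)
    then show "dist (\<phi> s) (\<phi> t) \<le> L * dist s t" by (simp add: dist_norm)
  qed
qed

lemma integral_curve_admissible: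
  assumes "integral_curve \<Omega> (comb_field X \<beta> u) \<xi> \<phi>" "0 \<le> \<delta>" "\<And>k. \<bar>u $ k\<bar> \<le> \<delta> ^ w k"
  shows "\<phi> \<in> admissible_curves n r \<Omega> X \<delta>"
proof -
  obtain L where L: "L-lipschitz_on {0..1} \<phi>" using integral_curve_lipschitz[OF assms(1)] .
  show ?thesis
  proof (rule lipschitz_admissible[OF L _ finite.emptyI assms(2)])
    show "\<phi> ` {0..1} \<subseteq> \<Omega>" using assms(1) by (auto simp: integral_curve_def)
    show "\<exists>v. (\<phi> has_vector_derivative comb_field X \<beta> v (\<phi> t)) (at t within {0..1}) \<and> (\<forall>k. \<bar>v $ k\<bar> \<le> \<delta> ^ w k)"
      if "t \<in> {0..1} - {}" for t
      using assms(1,3) that unfolding integral_curve_def by blast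
  qed
qed

text \<open>Each half is run at double speed, which doubles its coefficients; hence the factor 2 in
  the hypotheses.\<close>

lemma concatenation_admissible:
  assumes \<phi>: "integral_curve \<Omega> (comb_field X \<beta> u) \<xi> \<phi>"
    and \<psi>: "integral_curve \<Omega> (comb_field X \<beta> v) (\<phi> 1) \<psi>"
    and "0 \<le> \<delta>" "\<And>k. 2 * \<bar>u $ k\<bar> \<le> \<delta> ^ w k" "\<And>k. 2 * \<bar>v $ k\<bar> \<le> \<delta> ^ w k"
  shows "(\<lambda>t. if t \<le> 1 / 2 then \<phi> (2 * t) else \<psi> (2 * t - 1)) \<in> admissible_curves n r \<Omega> X \<delta>"
    (is "?\<gamma> \<in> _")
proof -
  obtain L1 where L1: "L1-lipschitz_on {0..1} \<phi>" using integral_curve_lipschitz[OF \<phi>] .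
  obtain L2 where L2: "L2-lipschitz_on {0..1} \<psi>" using integral_curve_lipschitz[OF \<psi>] .
  define L where "L = 2 * max L1 L2"
  have L0: "0 \<le> L" using lipschitz_on_nonneg[OF L1] by (simp add: L_def)
  have le: "2 * L1 \<le> L" "2 * L2 \<le> L" by (auto simp: L_def)
  have half: "L-lipschitz_on {a..b} (\<lambda>t. \<eta> (2 * t + c))"
    if \<eta>: "H-lipschitz_on {0..1} \<eta>" and "2 * H \<le> L" "0 \<le> 2 * a + c" "2 * b + c \<le> 1"
    for H a b c and \<eta> :: "real \<Rightarrow> real ^ 'p"
  proof (rule lipschitz_onI[OF _ L0])
    fix s t assume "s \<in> {a..b}" "t \<in> {a..b}"
    then have "dist (\<eta> (2 * s + c)) (\<eta> (2 * t + c)) \<le> H * dist (2 * s + c) (2 * t + c)"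
      using that(3,4) by (intro lipschitz_onD[OF \<eta>]) auto
    also have "\<dots> = (2 * H) * dist s t" by (simp add: dist_real_def abs_if)
    also have "\<dots> \<le> L * dist s t" using that(2) by (intro mult_right_mono) auto
    finally show "dist (\<eta> (2 * s + c)) (\<eta> (2 * t + c)) \<le> L * dist s t" .
  qed
  have 1: "L-lipschitz_on {0..1/2} (\<lambda>t. \<phi> (2 * t))" using half[OF L1 le(1), of 0 0 "1/2"] by simp
  have 2: "L-lipschitz_on {1/2..1} (\<lambda>t. \<psi> (2 * t - 1))" using half[OF L2 le(2), of "1/2" "-1" 1] by simp
  have "L-lipschitz_on {0..1} ?\<gamma>"
    by (rule lipschitz_on_concat[OF 1 2]) (use \<psi> in \<open>simp add: integral_curve_def\<close>)
  moreover have "?\<gamma> ` {0..1} \<subseteq> \<Omega>"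
    using \<phi> \<psi> by (auto simp: integral_curve_def)
  ultimately show ?thesis
  \<comment> \<open>Besides the corner at 1/2 the endpoints are excepted as well, so that two-sided
    derivatives are available.\<close>
  proof (rule lipschitz_admissible[where S = "{0, 1/2, 1}"])
    fix t :: real assume t: "t \<in> {0..1} - {0, 1/2, 1}"
    have chain: "((\<lambda>t. \<eta> (2 * t + c)) has_vector_derivative comb_field X \<beta> (2 *\<^sub>R x) (\<eta> (2 * t + c))) (at t)"
      if "integral_curve \<Omega> (comb_field X \<beta> x) z \<eta>" "0 < 2 * t + c" "2 * t + c < 1" for \<eta> x z c
    proof -
      have "(\<eta> has_vector_derivative comb_field X \<beta> x (\<eta> (2 * t + c))) (at (2 * t + c) within {0..1})"
        using that unfolding integral_curve_def by auto
      then have "(\<eta> has_vector_derivative comb_field X \<beta> x (\<eta> (2 * t + c))) (at (2 * t + c))"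
        using that at_within_Icc_at[of 0 "2 * t + c" 1] by simp
      moreover have "((\<lambda>t. 2 * t + c) has_vector_derivative 2) (at t)"
        by (auto intro!: derivative_eq_intros)
      ultimately show ?thesis
        using vector_diff_chain_at[of "\<lambda>t. 2 * t + c" 2 t \<eta>] by (simp add: o_def comb_field_scale)
    qed
    have "\<exists>x. (?\<gamma> has_vector_derivative comb_field X \<beta> x (?\<gamma> t)) (at t) \<and> (\<forall>k. \<bar>x $ k\<bar> \<le> \<delta> ^ w k)"
    proof (cases "t < 1 / 2")
      case True
      have "(?\<gamma> has_vector_derivative comb_field X \<beta> (2 *\<^sub>R u) (\<phi> (2 * t))) (at t)"
        by (rule has_vector_derivative_transform_within_open[where S = "{..<1/2}" and f = "\<lambda>t. \<phi> (2 * t)"])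
          (use chain[OF \<phi>, of 0] t True in auto)
      then show ?thesis using assms(4) True by (intro exI[of _ "2 *\<^sub>R u"]) (auto simp: abs_mult)
    next
      case False
      have "(?\<gamma> has_vector_derivative comb_field X \<beta> (2 *\<^sub>R v) (\<psi> (2 * t - 1))) (at t)"
        by (rule has_vector_derivative_transform_within_open[where S = "{1/2<..}" and f = "\<lambda>t. \<psi> (2 * t - 1)"])
          (use chain[OF \<psi>, of "-1"] t False in auto)
      then show ?thesis using assms(5) t False by (intro exI[of _ "2 *\<^sub>R v"]) (auto simp: abs_mult)
    qed
    then show "\<exists>x. (?\<gamma> has_vector_derivative comb_field X \<beta> x (?\<gamma> t)) (at t within {0..1}) \<and>
        (\<forall>k. \<bar>x $ k\<bar> \<le> \<delta> ^ w k)"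
      using has_vector_derivative_at_within by blast
  qed (use assms(3) in auto)
qed

end

section \<open>Upper bound for \<rho> along admissible curves, and the symmetry of \<rho>\<close>

context uniform_chart
begin

text \<open>Continuity of \<Theta> in both variables at the diagonal point, where it
  vanishes.\<close>

lemma small_coordinates:
  assumes "\<xi>\<^sub>0 \<in> \<Omega>" "0 < m"
  obtains \<sigma> where "0 < \<sigma>" "\<sigma> \<le> R\<^sub>1"
    "\<And>\<xi> \<eta>. \<xi> \<in> ball \<xi>\<^sub>0 \<sigma> \<Longrightarrow> \<eta> \<in> ball \<xi>\<^sub>0 \<sigma> \<Longrightarrow> norm (\<Theta> \<xi> \<eta>) < \<epsilon> \<and> hom_norm \<beta> r (\<Theta> \<xi> \<eta>) < m"
proof -
  let ?V = "{u. norm u < \<epsilon>} \<inter> {u. hom_norm \<beta> r u < m}"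
  have "open ?V"
    by (intro open_Int open_Collect_less continuous_on_hom_norm continuous_intros)
  from continuous_open_preimage[OF continuous_Theta open_N this]
  have "open (N \<inter> (\<lambda>(\<xi>, \<zeta>). \<Theta> \<xi> \<zeta>) -` ?V)" .
  moreover have "(\<xi>\<^sub>0, \<xi>\<^sub>0) \<in> N \<inter> (\<lambda>(\<xi>, \<zeta>). \<Theta> \<xi> \<zeta>) -` ?V"
    using diagonal_N[OF assms(1)] Theta_self[OF assms(1)] radii assms(2) hom_norm_eq_0_iff[of 0] by simp
  ultimately obtain A B where AB: "open A" "open B" "(\<xi>\<^sub>0, \<xi>\<^sub>0) \<in> A \<times> B"
    "A \<times> B \<subseteq> N \<inter> (\<lambda>(\<xi>, \<zeta>). \<Theta> \<xi> \<zeta>) -` ?V"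
    by (rule open_prod_elim)
  then obtain \<sigma> where \<sigma>: "0 < \<sigma>" "ball \<xi>\<^sub>0 \<sigma> \<subseteq> A \<inter> B"
    using openE[of "A \<inter> B" \<xi>\<^sub>0] by blast
  show thesis
  proof (rule that[of "min \<sigma> R\<^sub>1"])
    fix \<xi> \<eta> assume "\<xi> \<in> ball \<xi>\<^sub>0 (min \<sigma> R\<^sub>1)" "\<eta> \<in> ball \<xi>\<^sub>0 (min \<sigma> R\<^sub>1)"
    then have "\<xi> \<in> A" "\<eta> \<in> B" using \<sigma>(2) by auto
    then have "(\<xi>, \<eta>) \<in> N \<inter> (\<lambda>(\<xi>, \<zeta>). \<Theta> \<xi> \<zeta>) -` ?V" using AB(4) by blast
    then show "norm (\<Theta> \<xi> \<eta>) < \<epsilon> \<and> hom_norm \<beta> r (\<Theta> \<xi> \<eta>) < m" by simp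
  qed (use \<sigma> radii in auto)
qed

lemma rho_le_admissible:
  assumes "\<xi>\<^sub>0 \<in> \<Omega>"
  obtains C \<sigma> where "0 < C" "0 < \<sigma>" "\<sigma> \<le> R\<^sub>1"
    "\<And>\<xi> \<eta>. \<xi> \<in> ball \<xi>\<^sub>0 \<sigma> \<Longrightarrow> \<eta> \<in> ball \<xi>\<^sub>0 \<sigma> \<Longrightarrow> norm (\<Theta> \<xi> \<eta>) < \<epsilon>"
    "\<And>\<delta> \<phi>. \<phi> \<in> admissible_curves n r \<Omega> X \<delta> \<Longrightarrow> 0 < \<delta> \<Longrightarrow> \<phi> 0 \<in> ball \<xi>\<^sub>0 \<sigma> \<Longrightarrow>
      \<phi> 1 \<in> ball \<xi>\<^sub>0 \<sigma> \<Longrightarrow> rho \<beta> r \<Theta> (\<phi> 0) (\<phi> 1) \<le> C * \<delta>"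
proof -
  obtain K \<delta>\<^sub>0 where K: "1 \<le> K" "0 < \<delta>\<^sub>0"
    "\<And>\<xi> \<phi> \<delta> k. \<xi> \<in> ball \<xi>\<^sub>0 R\<^sub>1 \<Longrightarrow> 0 < \<delta> \<Longrightarrow> \<delta> \<le> \<delta>\<^sub>0 \<Longrightarrow> \<phi> \<in> admissible_curves n r \<Omega> X \<delta> \<Longrightarrow>
      \<phi> 0 = \<xi> \<Longrightarrow> \<bar>\<Theta> \<xi> (\<phi> 1) $ k\<bar> \<le> (K * \<delta>) ^ w k"
    using admissible_coordinate_bound by blast
  define C where "C = real r * real CARD('p) * K"
  have "1 \<le> r" using w_bounds order_trans by blast
  then have C: "0 < C" using K(1) by (simp add: C_def)
  then have "0 < C * \<delta>\<^sub>0" using K(2) by simp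
  \<comment> \<open>On this ball \<rho> stays below \<open>C * \<delta>\<^sub>0\<close>. That
    settles curves with \<delta> above the threshold, which may run far outside the chart.\<close>
  from small_coordinates[OF assms this] obtain \<sigma> where \<sigma>: "0 < \<sigma>" "\<sigma> \<le> R\<^sub>1"
    "\<And>\<xi> \<eta>. \<xi> \<in> ball \<xi>\<^sub>0 \<sigma> \<Longrightarrow> \<eta> \<in> ball \<xi>\<^sub>0 \<sigma> \<Longrightarrow>
      norm (\<Theta> \<xi> \<eta>) < \<epsilon> \<and> hom_norm \<beta> r (\<Theta> \<xi> \<eta>) < C * \<delta>\<^sub>0" by metis
  show thesis
  proof (rule that[OF C \<sigma>(1,2)])
    show "\<xi> \<in> ball \<xi>\<^sub>0 \<sigma> \<Longrightarrow> \<eta> \<in> ball \<xi>\<^sub>0 \<sigma> \<Longrightarrow> norm (\<Theta> \<xi> \<eta>) < \<epsilon>" for \<xi> \<eta>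
      using \<sigma>(3) by blast
    fix \<delta> :: real and \<phi>
    assume \<phi>: "\<phi> \<in> admissible_curves n r \<Omega> X \<delta>" and \<delta>: "0 < \<delta>"
      and ends: "\<phi> 0 \<in> ball \<xi>\<^sub>0 \<sigma>" "\<phi> 1 \<in> ball \<xi>\<^sub>0 \<sigma>"
    show "rho \<beta> r \<Theta> (\<phi> 0) (\<phi> 1) \<le> C * \<delta>"
    proof (cases "\<delta> \<le> \<delta>\<^sub>0")
      case True
      have "\<phi> 0 \<in> ball \<xi>\<^sub>0 R\<^sub>1" using ends(1) \<sigma>(2) by simp
      from K(3)[OF this \<delta> True \<phi> refl]
      have "hom_norm \<beta> r (\<Theta> (\<phi> 0) (\<phi> 1)) \<le> real r * real CARD('p) * (K * \<delta>)"
        using K(1) \<delta> by (intro hom_norm_le) auto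
      then show ?thesis by (simp add: rho_def C_def mult.assoc)
    next
      case False
      then have "C * \<delta>\<^sub>0 \<le> C * \<delta>" using C by (intro mult_left_mono) auto
      then show ?thesis using \<sigma>(3)[OF ends] by (simp add: rho_def)
    qed
  qed
qed

text \<open>The reversed ray is an integral curve from \<eta> with the opposite coefficients. The
  size bound guarantees that these are the coordinates seen from \<eta>, as \<epsilon> serves both
  base points.\<close>

lemma Theta_antisym:
  assumes "\<xi> \<in> ball \<xi>\<^sub>0 R\<^sub>1" "\<eta> \<in> ball \<xi>\<^sub>0 R\<^sub>1" "norm (\<Theta> \<xi> \<eta>) < \<epsilon>"
  shows "\<Theta> \<eta> \<xi> = - \<Theta> \<xi> \<eta>"
proof -
  have "(\<xi>, \<eta>) \<in> N" using ball_N[OF assms(1)] assms(2) radii by simp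
  then obtain \<phi> where \<phi>: "integral_curve \<Omega> (comb_field X \<beta> (\<Theta> \<xi> \<eta>)) \<xi> \<phi>" "\<phi> 1 = \<eta>"
    by (rule Theta_curve)
  have "integral_curve \<Omega> (comb_field X \<beta> (- \<Theta> \<xi> \<eta>)) \<eta> (\<lambda>s. \<phi> (1 - s))"
    using integral_curve_affine[OF \<phi>(1), of "-1" 1] \<phi>(2) by simp
  from endpoint_coordinates(2)[OF assms(2) _ this] assms(3)
  have "\<Theta> \<eta> (\<phi> 0) = - \<Theta> \<xi> \<eta>" by simp
  then show ?thesis using \<phi>(1) by (simp add: integral_curve_def)
qed

end

section \<open>Comparison of d with \<rho>, and the two-step curve\<close>

context canonical_map
begin

lemma cc_dist_le:
  "\<phi> \<in> admissible_curves n r \<Omega> X \<delta> \<Longrightarrow> 0 < \<delta> \<Longrightarrow> cc_dist n r \<Omega> X (\<phi> 0) (\<phi> 1) \<le> ereal \<delta>"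
  unfolding cc_dist_def by (rule INF_lower) blast

lemma cc_dist_le_rho:
  assumes "(\<xi>, \<eta>) \<in> N"
  shows "cc_dist n r \<Omega> X \<xi> \<eta> \<le> ereal (rho \<beta> r \<Theta> \<xi> \<eta>)"
proof (rule ereal_le_epsilon2)
  fix e :: real assume "0 < e"
  obtain \<phi> where \<phi>: "integral_curve \<Omega> (comb_field X \<beta> (\<Theta> \<xi> \<eta>)) \<xi> \<phi>" "\<phi> 1 = \<eta>"
    using Theta_curve[OF assms] .
  \<comment> \<open>The distance is an infimum over positive \<delta>, whereas \<rho> may vanish;
    hence the additional e.\<close>
  let ?d = "rho \<beta> r \<Theta> \<xi> \<eta> + e"
  have nn: "0 \<le> rho \<beta> r \<Theta> \<xi> \<eta>" by (simp add: rho_def hom_norm_nonneg)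
  have "\<phi> \<in> admissible_curves n r \<Omega> X ?d"
  proof (rule integral_curve_admissible[OF \<phi>(1)])
    fix k
    have "rho \<beta> r \<Theta> \<xi> \<eta> ^ w k \<le> ?d ^ w k" using nn \<open>0 < e\<close> by (intro power_mono) auto
    then show "\<bar>\<Theta> \<xi> \<eta> $ k\<bar> \<le> ?d ^ w k"
      using component_le_hom_norm[of "\<Theta> \<xi> \<eta>" k] by (simp add: rho_def)
  qed (use nn \<open>0 < e\<close> in simp)
  from cc_dist_le[OF this] show "cc_dist n r \<Omega> X \<xi> \<eta> \<le> ereal (rho \<beta> r \<Theta> \<xi> \<eta>) + ereal e"
    using \<phi> nn \<open>0 < e\<close> by (simp add: integral_curve_def)
qed

lemma two_step_curve:
  assumes "(\<xi>, \<zeta>) \<in> N" "(\<zeta>, \<eta>) \<in> N" "0 < e"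
  obtains \<phi> where "\<phi> 0 = \<xi>" "\<phi> 1 = \<eta>"
    "\<phi> \<in> admissible_curves n r \<Omega> X (2 * (rho \<beta> r \<Theta> \<xi> \<zeta> + rho \<beta> r \<Theta> \<zeta> \<eta> + e))"
proof -
  obtain \<phi> where \<phi>: "integral_curve \<Omega> (comb_field X \<beta> (\<Theta> \<xi> \<zeta>)) \<xi> \<phi>" "\<phi> 1 = \<zeta>"
    using Theta_curve[OF assms(1)] .
  obtain \<psi> where \<psi>: "integral_curve \<Omega> (comb_field X \<beta> (\<Theta> \<zeta> \<eta>)) (\<phi> 1) \<psi>" "\<psi> 1 = \<eta>"
    using Theta_curve[OF assms(2)] \<phi>(2) by metis
  let ?s = "rho \<beta> r \<Theta> \<xi> \<zeta> + rho \<beta> r \<Theta> \<zeta> \<eta> + e"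
  have nn: "0 \<le> rho \<beta> r \<Theta> x y" for x y by (simp add: rho_def hom_norm_nonneg)
  have double: "2 * \<bar>\<Theta> x y $ k\<bar> \<le> (2 * ?s) ^ w k" if "rho \<beta> r \<Theta> x y \<le> ?s" for x y k
  proof -
    have "\<bar>\<Theta> x y $ k\<bar> \<le> ?s ^ w k"
      using component_le_hom_norm[of "\<Theta> x y" k] power_mono[OF that nn, of "w k"] by (simp add: rho_def)
    \<comment> \<open>Since each weight is at least 1, the factor 2 from the doubled speed fits into
      the power of the doubled parameter.\<close>
    moreover have "2 * ?s ^ w k \<le> 2 ^ w k * ?s ^ w k"
      using nn[of \<xi> \<zeta>] nn[of \<zeta> \<eta>] assms(3) self_le_power[of 2 "w k"] w_bounds(1)[of k]
      by (intro mult_right_mono) auto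
    ultimately show ?thesis unfolding power_mult_distrib by linarith
  qed
  have "(\<lambda>t. if t \<le> 1 / 2 then \<phi> (2 * t) else \<psi> (2 * t - 1)) \<in> admissible_curves n r \<Omega> X (2 * ?s)"
  proof (rule concatenation_admissible[OF \<phi>(1) \<psi>(1)])
    show "0 \<le> 2 * ?s" using nn[of \<xi> \<zeta>] nn[of \<zeta> \<eta>] assms(3) by simp
    show "2 * \<bar>\<Theta> \<xi> \<zeta> $ k\<bar> \<le> (2 * ?s) ^ w k" "2 * \<bar>\<Theta> \<zeta> \<eta> $ k\<bar> \<le> (2 * ?s) ^ w k" for k
      using nn[of \<xi> \<zeta>] nn[of \<zeta> \<eta>] assms(3) by (intro double; simp)+
  qed
  then show thesis by (rule that[rotated 2]) (use \<phi> \<psi> in \<open>auto simp: integral_curve_def\<close>)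
qed

end

theorem proposition22:
  fixes X :: "nat \<Rightarrow> real ^ 'p \<Rightarrow> real ^ 'p"
    and \<Omega> :: "(real ^ 'p) set"
    and n r :: nat
    and \<beta> :: "'p::finite \<Rightarrow> nat list"
    and N :: "((real ^ 'p) \<times> (real ^ 'p)) set"
    and \<Theta> :: "real ^ 'p \<Rightarrow> real ^ 'p \<Rightarrow> real ^ 'p"
    and \<xi>\<^sub>0 :: "real ^ 'p"
  assumes "open \<Omega>" and "connected \<Omega>" and "bounded \<Omega>"
    and "\<And>i. i \<le> n \<Longrightarrow> smooth_on (X i) \<Omega>"
    and "free_up_to_weight n r \<Omega> X"
    and "hormander n r \<Omega> X"
    and "bracket_basis n r \<Omega> X \<beta>"
    and "is_Theta \<Omega> X \<beta> N \<Theta>"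
    and "\<xi>\<^sub>0 \<in> \<Omega>"
  shows "\<exists>W c c\<^sub>1 c\<^sub>2. open W \<and> \<xi>\<^sub>0 \<in> W \<and> W \<subseteq> \<Omega> \<and> W \<times> W \<subseteq> N \<and> 0 < c \<and> 0 < c\<^sub>1 \<and> 0 < c\<^sub>2 \<and>
    (\<forall>\<xi>\<in>W. \<forall>\<eta>\<in>W. \<forall>\<zeta>\<in>W.
       rho \<beta> r \<Theta> \<xi> \<eta> \<ge> 0 \<and>
       (rho \<beta> r \<Theta> \<xi> \<eta> = 0 \<longleftrightarrow> \<xi> = \<eta>) \<and>
       rho \<beta> r \<Theta> \<xi> \<eta> = rho \<beta> r \<Theta> \<eta> \<xi> \<and>
       rho \<beta> r \<Theta> \<xi> \<eta> \<le> c * (rho \<beta> r \<Theta> \<xi> \<zeta> + rho \<beta> r \<Theta> \<zeta> \<eta>) \<and>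
       ereal c\<^sub>1 * cc_dist n r \<Omega> X \<xi> \<eta> \<le> ereal (rho \<beta> r \<Theta> \<xi> \<eta>) \<and>
       ereal (rho \<beta> r \<Theta> \<xi> \<eta>) \<le> ereal c\<^sub>2 * cc_dist n r \<Omega> X \<xi> \<eta>)"
proof -
  interpret canonical_map X \<Omega> n r \<beta> N \<Theta>
    by unfold_locales (use assms in auto)
  obtain R R\<^sub>1 \<epsilon> where "0 < R" "0 < R\<^sub>1" "R\<^sub>1 \<le> R" "0 < \<epsilon>" "cball \<xi>\<^sub>0 R \<times> cball \<xi>\<^sub>0 R \<subseteq> N"
    "\<And>\<xi> u. \<xi> \<in> ball \<xi>\<^sub>0 R\<^sub>1 \<Longrightarrow> u \<in> ball 0 \<epsilon> \<Longrightarrow> \<exists>\<zeta>\<in>ball \<xi>\<^sub>0 R. \<Theta> \<xi> \<zeta> = u"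
    using uniform_coordinate_ball[OF assms(9)] by blast
  then interpret uniform_chart X \<Omega> n r \<beta> N \<Theta> \<xi>\<^sub>0 R R\<^sub>1 \<epsilon>
    by unfold_locales
  obtain C \<sigma> where C: "0 < C" and \<sigma>: "0 < \<sigma>" "\<sigma> \<le> R\<^sub>1"
    and small: "\<And>\<xi> \<eta>. \<xi> \<in> ball \<xi>\<^sub>0 \<sigma> \<Longrightarrow> \<eta> \<in> ball \<xi>\<^sub>0 \<sigma> \<Longrightarrow> norm (\<Theta> \<xi> \<eta>) < \<epsilon>"
    and upper: "\<And>\<delta> \<phi>. \<phi> \<in> admissible_curves n r \<Omega> X \<delta> \<Longrightarrow> 0 < \<delta> \<Longrightarrow> \<phi> 0 \<in> ball \<xi>\<^sub>0 \<sigma> \<Longrightarrow>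
      \<phi> 1 \<in> ball \<xi>\<^sub>0 \<sigma> \<Longrightarrow> rho \<beta> r \<Theta> (\<phi> 0) (\<phi> 1) \<le> C * \<delta>"
    using rho_le_admissible[OF assms(9)] by blast
  define W where "W = ball \<xi>\<^sub>0 \<sigma>"
  have W: "W \<subseteq> ball \<xi>\<^sub>0 R\<^sub>1" "W \<subseteq> cball \<xi>\<^sub>0 R" using \<sigma> radii by (auto simp: W_def)
  have WN: "(\<xi>, \<eta>) \<in> N" if "\<xi> \<in> W" "\<eta> \<in> W" for \<xi> \<eta> using ball_N W that by blast
  have nonneg: "0 \<le> rho \<beta> r \<Theta> \<xi> \<eta>" for \<xi> \<eta> by (simp add: rho_def hom_norm_nonneg)
  have zero: "rho \<beta> r \<Theta> \<xi> \<eta> = 0 \<longleftrightarrow> \<xi> = \<eta>" if "\<xi> \<in> W" "\<eta> \<in> W" for \<xi> \<eta>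
  proof -
    have self: "\<Theta> \<xi> \<xi> = 0" using Theta_self ball_\<Omega> W(1) that(1) by blast
    then have "\<Theta> \<xi> \<eta> = 0 \<longleftrightarrow> \<xi> = \<eta>" using Theta_inj[OF WN[OF that(1,1)] WN[OF that]] by auto
    then show ?thesis by (simp add: rho_def hom_norm_eq_0_iff)
  qed
  have sym: "rho \<beta> r \<Theta> \<xi> \<eta> = rho \<beta> r \<Theta> \<eta> \<xi>" if "\<xi> \<in> W" "\<eta> \<in> W" for \<xi> \<eta>
  proof -
    have "\<Theta> \<eta> \<xi> = - \<Theta> \<xi> \<eta>"
      using that W(1) by (intro Theta_antisym small) (auto simp: W_def)
    then show ?thesis by (simp add: rho_def hom_norm_uminus)
  qed
  have triangle: "rho \<beta> r \<Theta> \<xi> \<eta> \<le> 2 * C * (rho \<beta> r \<Theta> \<xi> \<zeta> + rho \<beta> r \<Theta> \<zeta> \<eta>)"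
    if "\<xi> \<in> W" "\<eta> \<in> W" "\<zeta> \<in> W" for \<xi> \<eta> \<zeta>
  proof (rule field_le_epsilon)
    fix e :: real assume "0 < e"
    then have e: "0 < e / (2 * C)" using C by simp
    let ?s = "rho \<beta> r \<Theta> \<xi> \<zeta> + rho \<beta> r \<Theta> \<zeta> \<eta>"
    have N: "(\<xi>, \<zeta>) \<in> N" "(\<zeta>, \<eta>) \<in> N" using WN that by auto
    obtain \<phi> where \<phi>: "\<phi> 0 = \<xi>" "\<phi> 1 = \<eta>" "\<phi> \<in> admissible_curves n r \<Omega> X (2 * (?s + e / (2 * C)))"
      using two_step_curve[OF N e] by blast
    have "0 < 2 * (?s + e / (2 * C))" by (intro mult_pos_pos add_nonneg_pos add_nonneg_nonneg nonneg e) simp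
    then have "rho \<beta> r \<Theta> \<xi> \<eta> \<le> C * (2 * (?s + e / (2 * C)))"
      using upper[OF \<phi>(3)] \<phi>(1,2) that by (simp add: W_def)
    also have "\<dots> = 2 * C * ?s + e" using C by (simp add: field_simps)
    finally show "rho \<beta> r \<Theta> \<xi> \<eta> \<le> 2 * C * ?s + e" .
  qed
  have lower: "ereal (rho \<beta> r \<Theta> \<xi> \<eta>) \<le> ereal C * cc_dist n r \<Omega> X \<xi> \<eta>"
    if "\<xi> \<in> W" "\<eta> \<in> W" for \<xi> \<eta>
  proof -
    \<comment> \<open>Bounding each admissible \<delta> from below also covers an empty set of
      curves, where the distance is infinite.\<close>
    have "ereal (rho \<beta> r \<Theta> \<xi> \<eta> / C) \<le> cc_dist n r \<Omega> X \<xi> \<eta>"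
      unfolding cc_dist_def
    proof (rule INF_greatest)
      fix \<delta> assume "\<delta> \<in> {\<delta>. 0 < \<delta> \<and> (\<exists>\<phi>\<in>admissible_curves n r \<Omega> X \<delta>. \<phi> 0 = \<xi> \<and> \<phi> 1 = \<eta>)}"
      then obtain \<phi> where "0 < \<delta>" "\<phi> \<in> admissible_curves n r \<Omega> X \<delta>" "\<phi> 0 = \<xi>" "\<phi> 1 = \<eta>" by blast
      then have "rho \<beta> r \<Theta> \<xi> \<eta> \<le> C * \<delta>" using upper[of \<phi> \<delta>] that by (simp add: W_def)
      then show "ereal (rho \<beta> r \<Theta> \<xi> \<eta> / C) \<le> ereal \<delta>" using C by (simp add: field_simps)
    qed
    then have "ereal C * ereal (rho \<beta> r \<Theta> \<xi> \<eta> / C) \<le> ereal C * cc_dist n r \<Omega> X \<xi> \<eta>"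
      using C by (intro ereal_mult_left_mono) auto
    then show ?thesis using C by simp
  qed
  show ?thesis
  \<comment> \<open>The constant 2 C comes from the two-step curve, \<open>c\<^sub>1 = 1\<close>
    from rays being admissible, and \<open>c\<^sub>2 = C\<close> from the bound along arbitrary
    admissible curves.\<close>
  proof (rule exI[of _ W], rule exI[of _ "2 * C"], rule exI[of _ 1], rule exI[of _ C], intro conjI ballI)
    show "open W" "\<xi>\<^sub>0 \<in> W" using \<sigma> by (auto simp: W_def)
    show "W \<subseteq> \<Omega>" using W(2) cball_\<Omega> by blast
    show "W \<times> W \<subseteq> N" using WN by blast
    fix \<xi> \<eta> \<zeta> assume "\<xi> \<in> W" "\<eta> \<in> W"
    then show "ereal 1 * cc_dist n r \<Omega> X \<xi> \<eta> \<le> ereal (rho \<beta> r \<Theta> \<xi> \<eta>)"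
      using cc_dist_le_rho[OF WN] by (simp add: one_ereal_def[symmetric])
  qed (use C nonneg zero sym triangle lower in auto)
qed

end
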